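(* Fix a real number $J\neq 0$, constants $\beta<-1/2$ and $\rho_0>0$, and let $u_0=(v_0,Y_0)$ be the extreme Kerr initial data with angular momentum $J$ (described in the context). Let $\mathcal{B}$ be the Banach space of pairs $\varphi=(\alpha,y)$ defined in the context, and define $\mathcal{M}:\mathcal{B}\to\mathbb{R}$ by $\mathcal{M}(\varphi)=\mathcal{M}(u_0+\varphi)$, where for a pair $(v,Y)$ $$\mathcal{M}(v,Y)=\frac{1}{32\pi}\int_{\mathbb{R}^3}\left(|\partial v|^2+\rho^{-4}e^{-2v}|\partial Y|^2\right)d\mu .$$ Then $u_0$ is a strict local minimum of $\mathcal{M}$ on $u_0+\mathcal{B}$: there exists $\epsilon>0$ such that $$\mathcal{M}(u_0+\varphi)>\mathcal{M}(u_0)$$ for all $\varphi\in\mathcal{B}$ with $\|\varphi\|_{\mathcal{B}}<\epsilon$ and $\varphi\neq 0$.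
   Context: Let $(\rho,z,\phi)$ be cylindrical coordinates on $\mathbb{R}^3$, $r=\sqrt{\rho^2+z^2}$, $\sigma=\sqrt{r^2+1}$, $d\mu=\rho\,dz\,d\rho\,d\phi$ the Euclidean volume element, and for axisymmetric functions (functions of $(\rho,z)$ only) $\partial$ denotes the partial derivatives in $\rho,z$, so $|\partial f|^2=f_{,\rho}^2+f_{,z}^2$. Extreme Kerr data: put $m_0=\sqrt{|J|}$. Let $\tilde r=r$ and $\theta$ be defined by $\rho=\tilde r\sin\theta$, $z=\tilde r\cos\theta$. Set $R=\tilde r+m_0$ (the Boyer–Lindquist radius) and $\Sigma=R^2+m_0^2\cos^2\theta$. The extreme Kerr initial data (a Boyer–Lindquist $t=$ const slice of the extreme Kerr spacetime of mass $m_0$ and angular momentum $J$) have metric $e^{v_0}\big(e^{-2q_0}(d\rho^2+dz^2)+\rho^2d\phi^2\big)$, with norm of the axial Killing vector $X_0=\left(R^2+m_0^2+\frac{2m_0^3R\sin^2\theta}{\Sigma}\right)\sin^2\theta$, so that $v_0=\ln(X_0/\rho^2)$ (singular at the origin, which represents the second asymptotic end), and twist potential $Y_0=2J(\cos^3\theta-3\cos\theta)-\frac{2Jm_0^2\cos\theta\sin^4\theta}{\Sigma}$. One has $\mathcal{M}(v_0,Y_0)=\sqrt{|J|}$. Weighted norm: for a domain $\Omega\subset\mathbb{R}^3$ and an axisymmetric $C^1$ function $f$ on $\Omega$, $\|f\|_{C^1_\beta(\Omega)}=\sup_{x\in\Omega}\{\sigma^{-\beta}|f|+\sigma^{-\beta+1}|\partial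 f|\}$. The space $\mathcal{B}$: pairs $\varphi=(\alpha,y)$ of axisymmetric functions where $\alpha$ is $C^1$ on all of $\mathbb{R}^3$ with $\|\alpha\|_{C^1_\beta(\mathbb{R}^3)}<\infty$, and $y$ vanishes on the cylinder $\{\rho\le\rho_0\}$ (a neighbourhood of the axis) and is $C^1$ with $\|y\|_{C^1_\beta(\Omega_{\rho_0})}<\infty$, where $\Omega_{\rho_0}=\{\rho>\rho_0\}$. The norm is $\|\varphi\|_{\mathcal{B}}=\|\alpha\|_{C^1_\beta(\mathbb{R}^3)}+\|y\|_{C^1_\beta(\Omega_{\rho_0})}$. *)

theory Defs
  imports "HOL-Analysis.Analysis"
begin

definition cyl_rho :: "real^3 \<Rightarrow> real" where
  "cyl_rho x = sqrt ((x$1)^2 + (x$2)^2)"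

definition cyl_z :: "real^3 \<Rightarrow> real" where
  "cyl_z x = x$3"

definition rad :: "real^3 \<Rightarrow> real" where
  "rad x = sqrt ((cyl_rho x)^2 + (cyl_z x)^2)"

definition sigma :: "real^3 \<Rightarrow> real" where
  "sigma x = sqrt ((rad x)^2 + 1)"

definition axisym :: "(real^3 \<Rightarrow> real) \<Rightarrow> bool" where
  "axisym f \<longleftrightarrow> (\<forall>x y. cyl_rho x = cyl_rho y \<and> cyl_z x = cyl_z y \<longrightarrow> f x = f y)"

definition profile :: "(real^3 \<Rightarrow> real) \<Rightarrow> real \<Rightarrow> real \<Rightarrow> real" where
  "profile f r z = f (vector [r, 0, z])"

definition d_rho :: "(real^3 \<Rightarrow> real) \<Rightarrow> real^3 \<Rightarrow> real" where
  "d_rho f x = deriv (\<lambda>s. profile f s (cyl_z x)) (cyl_rho x)"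

definition d_z :: "(real^3 \<Rightarrow> real) \<Rightarrow> real^3 \<Rightarrow> real" where
  "d_z f x = deriv (\<lambda>t. profile f (cyl_rho x) t) (cyl_z x)"

definition grad_abs :: "(real^3 \<Rightarrow> real) \<Rightarrow> real^3 \<Rightarrow> real" where
  "grad_abs f x = sqrt ((d_rho f x)^2 + (d_z f x)^2)"

definition C1_R3 :: "(real^3 \<Rightarrow> real) \<Rightarrow> bool" where
  "C1_R3 f \<longleftrightarrow> (\<exists>f' :: real^3 \<Rightarrow> ((real^3) \<Rightarrow>\<^sub>L real).
      (\<forall>x. (f has_derivative blinfun_apply (f' x)) (at x)) \<and> continuous_on UNIV f')"

definition wquant :: "real \<Rightarrow> (real^3 \<Rightarrow> real) \<Rightarrow> real^3 \<Rightarrow> real" where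
  "wquant \<beta> f x = sigma x powr (-\<beta>) * \<bar>f x\<bar> + sigma x powr (-\<beta> + 1) * grad_abs f x"

definition C1w_finite :: "real \<Rightarrow> (real^3) set \<Rightarrow> (real^3 \<Rightarrow> real) \<Rightarrow> bool" where
  "C1w_finite \<beta> \<Omega> f \<longleftrightarrow> bdd_above (wquant \<beta> f ` \<Omega>)"

definition C1w_norm :: "real \<Rightarrow> (real^3) set \<Rightarrow> (real^3 \<Rightarrow> real) \<Rightarrow> real" where
  "C1w_norm \<beta> \<Omega> f = (SUP x\<in>\<Omega>. wquant \<beta> f x)"

definition Omega_rho :: "real \<Rightarrow> (real^3) set" where
  "Omega_rho \<rho>0 = {x. cyl_rho x > \<rho>0}"

definition in_B :: "real \<Rightarrow> real \<Rightarrow> (real^3 \<Rightarrow> real) \<Rightarrow> (real^3 \<Rightarrow> real) \<Rightarrow> bool" where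
  "in_B \<beta> \<rho>0 \<alpha> y \<longleftrightarrow>
     axisym \<alpha> \<and> C1_R3 \<alpha> \<and> C1w_finite \<beta> UNIV \<alpha> \<and>
     axisym y \<and> (\<forall>x. cyl_rho x \<le> \<rho>0 \<longrightarrow> y x = 0) \<and> C1_R3 y \<and>
     C1w_finite \<beta> (Omega_rho \<rho>0) y"

definition B_norm :: "real \<Rightarrow> real \<Rightarrow> (real^3 \<Rightarrow> real) \<Rightarrow> (real^3 \<Rightarrow> real) \<Rightarrow> real" where
  "B_norm \<beta> \<rho>0 \<alpha> y = C1w_norm \<beta> UNIV \<alpha> + C1w_norm \<beta> (Omega_rho \<rho>0) y"

definition mass_M :: "(real^3 \<Rightarrow> real) \<Rightarrow> (real^3 \<Rightarrow> real) \<Rightarrow> ennreal" where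
  "mass_M v Y = ennreal (1 / (32 * pi)) *
     (\<integral>\<^sup>+ x. ennreal ((grad_abs v x)^2
            + (cyl_rho x) powr (-4) * exp (-2 * v x) * (grad_abs Y x)^2) \<partial>lborel)"

definition m0 :: "real \<Rightarrow> real" where "m0 J = sqrt \<bar>J\<bar>"

definition cos_th :: "real^3 \<Rightarrow> real" where "cos_th x = cyl_z x / rad x"
definition sin_th :: "real^3 \<Rightarrow> real" where "sin_th x = cyl_rho x / rad x"

definition BL_R :: "real \<Rightarrow> real^3 \<Rightarrow> real" where "BL_R J x = rad x + m0 J"

definition Kerr_Sigma :: "real \<Rightarrow> real^3 \<Rightarrow> real" where
  "Kerr_Sigma J x = (BL_R J x)^2 + (m0 J)^2 * (cos_th x)^2"

definition X0 :: "real \<Rightarrow> real^3 \<Rightarrow> real" where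
  "X0 J x = ((BL_R J x)^2 + (m0 J)^2
     + 2 * (m0 J)^3 * BL_R J x * (sin_th x)^2 / Kerr_Sigma J x) * (sin_th x)^2"

definition v0 :: "real \<Rightarrow> real^3 \<Rightarrow> real" where
  "v0 J x = ln (X0 J x / (cyl_rho x)^2)"

definition Y0 :: "real \<Rightarrow> real^3 \<Rightarrow> real" where
  "Y0 J x = 2 * J * ((cos_th x)^3 - 3 * cos_th x)
     - 2 * J * (m0 J)^2 * cos_th x * (sin_th x)^4 / Kerr_Sigma J x"

end

(* Off the axis the integrand of the mass is, up to the divergence of grad (ln rho), the energy density
   of the map (X, Y) with X = rho^2 exp v into the hyperbolic plane, and the extreme Kerr map u0 is
   harmonic. Let u be a perturbed map, d its distance to u0, and V the initial velocity of the geodesics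
   from u0 to u. Since energy densities are convex along geodesics of the hyperbolic plane, pointwise
     e(u) - e(u0) >= 2 div <grad u0, V> + |grad d|^2.
   For small perturbations d is small, so d / sinh d can be handled as a power series in cosh d - 1.
   The flux <grad u0, V> is o(1) against cutoffs whose gradients are O(1 / rho); hence the mass can only
   grow, and strictly so unless d is constant, that is zero by decay along vertical lines. *)

theory Submission
  imports Defs
begin

section \<open>The function d / sinh d near the diagonal\<close>

text \<open>The distance \<open>d\<close> is not differentiable where the two maps meet, so the
  argument runs in \<open>S\<close> = cosh d - 1, which is smooth, and |grad d|^2 is replaced by
  |grad S|^2 = sinh^2 d |grad d|^2, at most 3 times the convexity defect while \<open>S\<close> <=
  1. The density of the map itself cannot be integrated: ln X contributes |2 grad ln \<rho>|^2 = 4 /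
  \<rho>^2, which diverges at the axis. Its removal leaves a flux along grad ln \<rho> with
  coefficient 2 (\<open>G\<close> - \<alpha>). But \<open>G\<close> = \<alpha> wherever y vanishes,
  hence near the axis, and elsewhere \<open>G\<close> - \<alpha> is quadratic in y / X. This is how
  the support of y and the decay exponent make the flux integrable against 1 / \<rho>. An infinite
  perturbed energy is settled separately. In the finite case the comparison is an identity under a
  cutoff, whose defect side is nonnegative and grows with the cutoff; a positive value at one stage
  survives in the limit, and integrability of the defect is never asked for. A small norm keeps
  \<open>S\<close> below a fixed \<open>s0\<close> < 1, where the series is controlled.\<close>

text \<open>\<open>gfun (cosh d - 1) = d / sinh d\<close>; the recursion for the coefficients comes from the
  differential equation \<open>S (S + 2) g' + (1 + S) g = 1\<close>.\<close>
definition gcoef :: "nat \<Rightarrow> real" where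
  "gcoef n = (\<Prod>k<n. - real (Suc k) / real (2 * Suc k + 1))"

definition gfun :: "real \<Rightarrow> real" where
  "gfun S = (\<Sum>n. gcoef n * S ^ n)"

definition gfun' :: "real \<Rightarrow> real" where
  "gfun' S = (\<Sum>n. diffs gcoef n * S ^ n)"

lemma gcoef_Suc: "real (2 * n + 3) * gcoef (Suc n) = - real (Suc n) * gcoef n"
  by (simp add: gcoef_def field_simps)

lemma gcoef_abs: "\<bar>gcoef n\<bar> \<le> 1"
proof (induction n)
  case (Suc n)
  have "\<bar>gcoef (Suc n)\<bar> = \<bar>gcoef n\<bar> * (real (Suc n) / real (2 * Suc n + 1))"
    by (simp add: gcoef_def abs_mult)
  also have "\<dots> \<le> 1 * 1"
    by (intro mult_mono Suc) (auto simp: field_simps)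
  finally show ?case by simp
qed (simp add: gcoef_def)

lemma gcoef_summable: assumes "\<bar>S\<bar> < 1" shows "summable (\<lambda>n. gcoef n * S ^ n)"
proof (rule summable_comparison_test[OF _ summable_geometric])
  show "\<exists>N. \<forall>n\<ge>N. norm (gcoef n * S ^ n) \<le> \<bar>S\<bar> ^ n"
    using gcoef_abs by (auto simp: abs_mult power_abs intro!: mult_left_le_one_le)
qed (use assms in auto)

lemma gfun_deriv: assumes "\<bar>S\<bar> < 1" shows "(gfun has_real_derivative gfun' S) (at S)"
  unfolding gfun_def gfun'_def using assms
  by (intro termdiffs_strong'[where K=1]) (auto intro: gcoef_summable)

lemma gfun'_deriv: assumes "\<bar>S\<bar> < 1"
  shows "(gfun' has_real_derivative (\<Sum>n. diffs (diffs gcoef) n * S ^ n)) (at S)"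
proof -
  have "summable (\<lambda>n. diffs gcoef n * x ^ n)" if "norm x < 1" for x :: real
    by (rule termdiff_converges[OF that]) (auto intro: gcoef_summable)
  then show ?thesis unfolding gfun'_def using assms
    by (intro termdiffs_strong'[where K=1]) auto
qed

text \<open>Coefficients are compared: the recursion \<open>gcoef_Suc\<close> cancels every positive
  power of S, and the constant term 1 is split off by shifting one of the two series by one index.
  It is the equation of d / sinh d in the variable S = cosh d - 1, for which S (S + 2) = sinh^2
  d.\<close>

lemma gfun_ode: assumes "\<bar>S\<bar> < 1"
  shows "S * (S + 2) * gfun' S + (1 + S) * gfun S = 1"
proof -
  define a where "a n = gcoef n * S ^ n" for n
  define b where "b n = diffs gcoef n * S ^ n" for n
  have sa: "summable a" unfolding a_def by (rule gcoef_summable[OF assms])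
  have sb: "summable b"
    unfolding b_def by (rule termdiff_converges[where K=1]) (use assms in \<open>auto intro: gcoef_summable\<close>)
  have g: "a sums gfun S" "b sums gfun' S"
    using sa[THEN summable_sums] sb[THEN summable_sums]
    by (simp_all add: gfun_def gfun'_def flip: a_def b_def)
  have na: "(\<lambda>n. real n * a n) sums (S * gfun' S)"
  proof -
    have "(\<lambda>n. real (Suc n) * a (Suc n)) sums (S * gfun' S)"
      using sums_mult[OF g(2), of S] by (simp add: a_def b_def diffs_def algebra_simps)
    then show ?thesis using sums_Suc[of "\<lambda>n. real n * a n"] by simp
  qed
  have 1: "(\<lambda>n. S * (real n * a n + a n)) sums (S * (S * gfun' S + gfun S))"
    by (intro sums_mult sums_add na g)
  have 2: "(\<lambda>n. 2 * (real n * a n) + a n) sums (2 * (S * gfun' S) + gfun S)"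
    by (intro sums_mult sums_add na g)
  have 3: "(\<lambda>n. 2 * (real (Suc n) * a (Suc n)) + a (Suc n)) sums (2 * (S * gfun' S) + gfun S - 1)"
    using iffD2[OF sums_Suc_iff, of "\<lambda>n. 2 * (real n * a n) + a n"] 2 by (simp add: a_def gcoef_def)
  have "(\<lambda>n. S * (real n * a n + a n) + (2 * (real (Suc n) * a (Suc n)) + a (Suc n)))
          sums (S * (S * gfun' S + gfun S) + (2 * (S * gfun' S) + gfun S - 1))"
    by (intro sums_add 1 3)
  moreover have "S * (real n * a n + a n) + (2 * (real (Suc n) * a (Suc n)) + a (Suc n)) = 0" for n
  proof -
    have "S * (real n * a n + a n) + (2 * (real (Suc n) * a (Suc n)) + a (Suc n))
      = (real (Suc n) * gcoef n + real (2 * n + 3) * gcoef (Suc n)) * (S * S ^ n)"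
      by (simp add: a_def algebra_simps)
    then show ?thesis by (simp only: gcoef_Suc) (simp add: algebra_simps)
  qed
  ultimately have "(S * (S * gfun' S + gfun S) + (2 * (S * gfun' S) + gfun S - 1)) = 0"
    by (metis (no_types, lifting) sums_0 sums_unique2 sums_cong)
  then show ?thesis by (simp add: algebra_simps)
qed

lemma gfun_0: "gfun 0 = 1" "gfun' 0 = - 1 / 3"
  unfolding gfun_def gfun'_def powser_zero by (simp_all add: diffs_def gcoef_def)

text \<open>The bounds that make the normal part of the convexity estimate nonnegative near the diagonal.\<close>
lemma gfun_near_0:
  obtains s0 where "0 < s0" "s0 < 1"
    "\<And>S. 0 \<le> S \<Longrightarrow> S \<le> s0 \<Longrightarrow> 0 \<le> gfun S"
    "\<And>S. 0 \<le> S \<Longrightarrow> S \<le> s0 \<Longrightarrow> gfun S \<le> 1"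
    "\<And>S. 0 \<le> S \<Longrightarrow> S \<le> s0 \<Longrightarrow> 1 \<le> (1 + S) * gfun S"
    "\<And>S T. 0 \<le> S \<Longrightarrow> S \<le> T \<Longrightarrow> T \<le> s0 \<Longrightarrow> \<bar>gfun T - gfun S\<bar> \<le> T - S"
proof -
  have "isCont gfun' 0"
    by (rule DERIV_isCont[OF gfun'_deriv]) simp
  \<comment> \<open>Since \<open>gfun' 0\<close> = -1/3, the tolerance 1/3 keeps
    \<open>gfun'\<close> between -2/3 and 0 near the origin.\<close>
  then have "\<exists>d>0. \<forall>x. dist x 0 < d \<longrightarrow> dist (gfun' x) (gfun' 0) < 1/3"
    unfolding continuous_at_eps_delta by (rule allE[of _ "1/3"]) simp
  then obtain d where d: "d > 0" "\<And>x. \<bar>x\<bar> < d \<Longrightarrow> \<bar>gfun' x - gfun' 0\<bar> < 1/3"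
    by (auto simp: dist_real_def)
  define s0 where "s0 = min (d/2) (1/2)"
  have s0: "0 < s0" "s0 < 1" "s0 < d" using d by (auto simp: s0_def)
  have neg: "gfun' S \<le> 0" "gfun' S \<ge> -1" if "0 \<le> S" "S \<le> s0" for S
    using d(2)[of S] that s0 unfolding gfun_0 by linarith+
  have le: "gfun T \<le> gfun S" "gfun S + S \<le> gfun T + T" if "0 \<le> S" "S \<le> T" "T \<le> s0" for S T
  proof -
    show "gfun T \<le> gfun S"
      by (rule DERIV_nonpos_imp_nonincreasing[OF that(2)])
         (use that s0 in \<open>auto intro!: exI[of _ "gfun' _"] gfun_deriv neg\<close>)
    show "gfun S + S \<le> gfun T + T"
    proof (rule DERIV_nonneg_imp_nondecreasing[OF that(2), of "\<lambda>S. gfun S + S"])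
      fix x assume "S \<le> x" "x \<le> T"
      then have "((\<lambda>S. gfun S + S) has_real_derivative gfun' x + 1) (at x)"
        using that s0 by (intro derivative_intros gfun_deriv) auto
      then show "\<exists>y. ((\<lambda>S. gfun S + S) has_real_derivative y) (at x) \<and> 0 \<le> y"
        using neg[of x] that \<open>S \<le> x\<close> \<open>x \<le> T\<close> by force
    qed
  qed
  show ?thesis
  proof (rule that[OF s0(1,2)])
    fix S assume S: "0 \<le> S" "S \<le> s0"
    show "gfun S \<le> 1" using le(1)[of 0 S] S by (simp add: gfun_0)
    show "0 \<le> gfun S" using le(2)[of 0 S] S s0 by (simp add: gfun_0)
    have "S * (S + 2) * gfun' S \<le> 0"
      using neg(1)[OF S] S by (intro mult_nonneg_nonpos) auto
    then show "1 \<le> (1 + S) * gfun S" using gfun_ode[of S] S s0 by auto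
  next
    fix S T assume "0 \<le> S" "S \<le> T" "T \<le> s0"
    from le[OF this] show "\<bar>gfun T - gfun S\<bar> \<le> T - S" by (simp add: abs_le_iff)
  qed
qed

text \<open>Both sides vanish at 0, and by the differential equation their difference has derivative
  0 on [-|a|, |a|], where cosh t - 1 stays below 1. This identifies the series with d / sinh d; it
  is applied with a = \<alpha>, where |\<alpha>| is the distance of the two maps if y = 0.\<close>

lemma gfun_sinh:
  assumes s0: "s0 < 1" and a: "cosh a - 1 \<le> s0"
  shows "gfun (cosh a - 1) * sinh a = (a::real)"
proof -
  have dz: "((\<lambda>t. gfun (cosh t - 1) * sinh t - t) has_real_derivative 0) (at t)"
    if "\<bar>t\<bar> \<le> \<bar>a\<bar>" for t
  proof -
    have "cosh t \<le> cosh a" using that cosh_real_nonneg_le_iff[of "\<bar>t\<bar>" "\<bar>a\<bar>"] by simp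
    then have t: "\<bar>cosh t - 1\<bar> < 1" using a s0 cosh_real_ge_1[of t] by linarith
    have "((\<lambda>t. gfun (cosh t - 1) * sinh t - t) has_real_derivative
       (gfun' (cosh t - 1) * sinh t * sinh t + gfun (cosh t - 1) * cosh t - 1)) (at t)"
      by (rule derivative_eq_intros DERIV_chain2[where f=gfun and g="\<lambda>t. cosh t - 1", OF gfun_deriv[OF t]] refl | simp)+
    moreover have "gfun' (cosh t - 1) * sinh t * sinh t + gfun (cosh t - 1) * cosh t - 1 = 0"
      using gfun_ode[OF t] cosh_square_eq[of t] by algebra
    ultimately show ?thesis by simp
  qed
  have "\<exists>c. \<forall>t\<in>{-\<bar>a\<bar>..\<bar>a\<bar>}. gfun (cosh t - 1) * sinh t - t = c"
  proof (rule has_field_derivative_zero_constant)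
    fix t assume "t \<in> {-\<bar>a\<bar>..\<bar>a\<bar>}"
    then have "\<bar>t\<bar> \<le> \<bar>a\<bar>" by auto
    then show "((\<lambda>t. gfun (cosh t - 1) * sinh t - t) has_real_derivative 0)
        (at t within {-\<bar>a\<bar>..\<bar>a\<bar>})"
      by (rule has_field_derivative_at_within[OF dz])
  qed simp
  then obtain c where c: "\<And>t. \<bar>t\<bar> \<le> \<bar>a\<bar> \<Longrightarrow> gfun (cosh t - 1) * sinh t - t = c"
    by (auto simp: abs_le_iff)
  from c[of a] c[of 0] show ?thesis by simp
qed

section \<open>Convexity of the energy density along geodesics\<close>

text \<open>With \<open>E\<close> = exp (-\<alpha>), \<open>e1\<close> = exp \<alpha> and w = y /
  X_0 one has 1 + \<open>S\<close> = cosh d in the upper half plane. In orthonormal frames, (1 + S -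
  E, E w) is minus the gradient of cosh d in the first point and (e1 - (1 + S), w) its gradient in
  the second; both have length sinh d.\<close>

lemma convexity_frames:
  fixes w E e1 S :: real
  assumes E: "E * e1 = 1" and S: "S = (e1 + E + E * w\<^sup>2) / 2 - 1"
  shows "(1 + S - E)\<^sup>2 + (E * w)\<^sup>2 = S * (S + 2)" "(e1 - (1 + S))\<^sup>2 + w\<^sup>2 = S * (S + 2)"
  using assms by algebra+

text \<open>The chain rule for cosh d: \<open>T0\<close> and \<open>T1\<close> are sinh d times the
  components of the two derivatives along the connecting geodesic, and the left side is the
  derivative of \<open>S\<close>.\<close>

lemma convexity_tangential:
  fixes a b p q w E e1 S T0 T1 :: real
  assumes E: "E * e1 = 1" and S: "S = (e1 + E + E * w\<^sup>2) / 2 - 1"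
    and T0: "T0 = (1 + S - E) * a + E * w * b"
    and T1: "T1 = (e1 - (1 + S)) * (a + p) + w * E * (b + q)"
  shows "(e1 - (1 + S)) * p + E * w * (q - w * a) = T1 - T0"
  using assms by algebra

text \<open>The bracket on the left is the coefficient of d / sinh d in the derivative of the flux,
  and \<open>n0\<close>, \<open>n1\<close> are the counterparts of \<open>T0\<close>,
  \<open>T1\<close> across the geodesic. Multiplied by sinh^2 d, the tangential and normal parts
  decouple.\<close>

lemma convexity_normal:
  fixes a b p q w E e1 S T0 T1 :: real
  assumes E: "E * e1 = 1" and S: "S = (e1 + E + E * w\<^sup>2) / 2 - 1"
    and T0: "T0 = (1 + S - E) * a + E * w * b"
    and T1: "T1 = (e1 - (1 + S)) * (a + p) + w * E * (b + q)"
    and n0: "n0 = (1 + S - E) * b - E * w * a"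
    and n1: "n1 = (e1 - (1 + S)) * E * (b + q) - w * (a + p)"
  shows "S * (S + 2) * ((T1 - T0 + E * p) * a - (1 + S - E) * b\<^sup>2 - w * b * E * p + E * q * b)
    = (1 + S) * (T1 - T0) * T0 + n0 * n1 - n0\<^sup>2 * (1 + S)"
proof -
  have "S = (inverse E + E + E * w\<^sup>2) / 2 - 1" and [simp]: "E \<noteq> 0" "e1 = inverse E"
    using E S by (auto simp: inverse_unique)
  then show ?thesis unfolding n0 n1 T0 T1 by (simp add: field_simps) algebra
qed

text \<open>Here \<open>a, b\<close> and \<open>a + p, E (b + q)\<close> are the components of the derivatives of two maps
  into the hyperbolic plane in the orthonormal frames at their values; multiplied by
  \<open>S (S + 2) = sinh\<^sup>2 d\<close>, the defect splits into a part along the connecting geodesic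
  and a part across it.\<close>
lemma convexity_identity:
  fixes a b p q w E e1 S g g' dS dk dG Q n0 n1 :: real
  assumes E: "E * e1 = 1" and S: "S = (e1 + E + E * w\<^sup>2) / 2 - 1"
    and ode: "S * (S + 2) * g' + (1 + S) * g = 1"
    and dS: "dS = (e1 - (1 + S)) * p + E * w * (q - w * a)"
    and dG: "dG = g' * dS * (1 + S - E) + g * (dS + E * p)"
    and dk: "dk = g' * dS * E - g * E * p"
    and Q: "Q = (a + p)\<^sup>2 + E\<^sup>2 * (b + q)\<^sup>2 - a\<^sup>2 - b\<^sup>2
              - 2 * (dG * a - g * (1 + S - E) * b\<^sup>2 + w * b * dk + g * E * q * b)"
    and n0: "n0 = (1 + S - E) * b - E * w * a"
    and n1: "n1 = (e1 - (1 + S)) * E * (b + q) - w * (a + p)"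
  shows "S * (S + 2) * Q = dS\<^sup>2 + n1\<^sup>2 - 2 * g * n0 * n1 + n0\<^sup>2 * (2 * g * (1 + S) - 1)"
proof -
  define T0 where "T0 = (1 + S - E) * a + E * w * b"
  define T1 where "T1 = (e1 - (1 + S)) * (a + p) + w * E * (b + q)"
  define M where "M = (T1 - T0 + E * p) * a - (1 + S - E) * b\<^sup>2 - w * b * E * p + E * q * b"
  have dST: "dS = T1 - T0"
    unfolding dS by (rule convexity_tangential[OF E S T0_def T1_def])
  have M: "S * (S + 2) * M = (1 + S) * (T1 - T0) * T0 + n0 * n1 - n0\<^sup>2 * (1 + S)"
    unfolding M_def by (rule convexity_normal[OF E S T0_def T1_def n0 n1])
  have g': "S * (S + 2) * g' = 1 - (1 + S) * g" using ode by simp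
  \<comment> \<open>Pythagoras at each end point: sinh^2 d times the energy density is a tangential
    plus a normal square.\<close>
  have "S * (S + 2) * (a\<^sup>2 + b\<^sup>2) = T0\<^sup>2 + n0\<^sup>2"
    unfolding convexity_frames(1)[OF E S, symmetric] T0_def n0 by algebra
  moreover have "S * (S + 2) * ((a + p)\<^sup>2 + E\<^sup>2 * (b + q)\<^sup>2) = T1\<^sup>2 + n1\<^sup>2"
    unfolding convexity_frames(2)[OF E S, symmetric] T1_def n1 by algebra
  moreover have "dG * a - g * (1 + S - E) * b\<^sup>2 + w * b * dk + g * E * q * b = g' * (dS * T0) + g * M"
    unfolding dG dk M_def dST[symmetric] unfolding T0_def by algebra
  \<comment> \<open>The differential equation removes \<open>g'\<close>, and the tangential terms
    collapse to \<open>dS * T0\<close>.\<close>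
  moreover have "S * (S + 2) * (g' * (dS * T0) + g * M)
      = dS * T0 + g * (n0 * n1 - (1 + S) * n0\<^sup>2)"
    using g' M dST by algebra
  ultimately show ?thesis
    unfolding Q using dST by algebra
qed

text \<open>Completing the square in \<open>n1\<close> leaves \<open>n0^2\<close> times 2 g (1 + S)
  - 1 - g^2, which is nonnegative because (1 + S) g >= 1 >= g^2. The factor 3 bounds S (S + 2) for S
  <= 1.\<close>

lemma convexity_bound:
  fixes a b p q w E e1 S g g' dS dk dG Q :: real
  assumes E: "E * e1 = 1" "E > 0" and S: "S = (e1 + E + E * w\<^sup>2) / 2 - 1" and S1: "S \<le> 1"
    and ode: "S * (S + 2) * g' + (1 + S) * g = 1"
    and g: "0 \<le> g" "g \<le> 1" "1 \<le> (1 + S) * g"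
    and dS: "dS = (e1 - (1 + S)) * p + E * w * (q - w * a)"
    and dG: "dG = g' * dS * (1 + S - E) + g * (dS + E * p)"
    and dk: "dk = g' * dS * E - g * E * p"
    and Q: "Q = (a + p)\<^sup>2 + E\<^sup>2 * (b + q)\<^sup>2 - a\<^sup>2 - b\<^sup>2
              - 2 * (dG * a - g * (1 + S - E) * b\<^sup>2 + w * b * dk + g * E * q * b)"
  shows "dS\<^sup>2 \<le> 3 * Q"
proof -
  define n0 where "n0 = (1 + S - E) * b - E * w * a"
  define n1 where "n1 = (e1 - (1 + S)) * E * (b + q) - w * (a + p)"
  have e1: "e1 > 0" using E by (metis zero_less_mult_pos zero_less_one)
  have "2 * S = (E - 1)\<^sup>2 * e1 + E * w\<^sup>2"
    using E(1) unfolding S by algebra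
  then have S0: "S \<ge> 0" and Sz: "S = 0 \<Longrightarrow> E = 1 \<and> w = 0"
    using E(2) e1
    by (smt (verit) mult_nonneg_nonneg zero_le_power2,
        smt (verit) mult_nonneg_nonneg zero_le_power2 mult_eq_0_iff power2_eq_square)
  show ?thesis
  \<comment> \<open>The identity carries the factor S and gives nothing where the two maps agree;
    there the defect is the sum of squares of p and q outright.\<close>
  proof (cases "S = 0")
    case True
    then have z: "E = 1" "w = 0" "e1 = 1" "g = 1" using Sz E ode by auto
    have "dS = 0" unfolding dS using True z by simp
    moreover have "Q = p\<^sup>2 + q\<^sup>2"
      unfolding Q dG dk using True z \<open>dS = 0\<close> by (simp add: power2_eq_square algebra_simps)
    ultimately show ?thesis by simp
  next
    case False
    have id: "S * (S + 2) * Q = dS\<^sup>2 + n1\<^sup>2 - 2 * g * n0 * n1 + n0\<^sup>2 * (2 * g * (1 + S) - 1)"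
      by (rule convexity_identity[OF E(1) S ode dS dG dk Q n0_def n1_def])
    have "g\<^sup>2 \<le> 1" using g by (simp add: power_le_one)
    then have "g\<^sup>2 * n0\<^sup>2 \<le> (2 * g * (1 + S) - 1) * n0\<^sup>2"
      using g(3) by (intro mult_right_mono) (auto simp: algebra_simps)
    moreover have "0 \<le> (n1 - g * n0)\<^sup>2" by simp
    ultimately have le: "dS\<^sup>2 \<le> S * (S + 2) * Q"
      unfolding id by (simp add: power2_eq_square algebra_simps)
    have "0 < S * (S + 2)" using S0 False by simp
    then have "0 \<le> Q" using le by (smt (verit) zero_le_power2 mult_pos_neg)
    moreover have "S * (S + 2) \<le> 1 * 3" using S0 S1 by (intro mult_mono) auto
    ultimately have "S * (S + 2) * Q \<le> 3 * Q" by (intro mult_right_mono) auto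
    then show ?thesis using le by linarith
  qed
qed

section \<open>The divergence theorem off the axis\<close>

lemma GDERIV_component: "GDERIV (\<lambda>x. x $ i) (x :: real^'n) :> axis i 1"
  unfolding gderiv_def inner_axis
  by (simp add: bounded_linear_imp_has_derivative bounded_linear_vec_nth)

lemma compact_support_integrable:
  fixes f :: "'a::euclidean_space \<Rightarrow> real"
  assumes "continuous_on UNIV f" and "\<And>x. R < norm x \<Longrightarrow> f x = 0"
  shows "integrable lborel f"
proof -
  have "integrable lborel (\<lambda>x. indicator (cball 0 R) x *\<^sub>R f x)"
    by (rule borel_integrable_compact) (use assms(1) continuous_on_subset in \<open>auto\<close>)
  moreover have "(\<lambda>x. indicator (cball 0 R) x *\<^sub>R f x) = f"
    using assms(2) by (auto simp: fun_eq_iff indicator_def not_le)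
  ultimately show ?thesis by simp
qed

text \<open>Translation invariance makes the difference quotients integrate to zero.\<close>
lemma integral_directional_derivative_eq_0:
  fixes f :: "'a::euclidean_space \<Rightarrow> real"
  assumes f': "\<And>x. (f has_derivative f' x) (at x)"
    and B: "\<And>x. \<bar>f' x e\<bar> \<le> B" and R: "\<And>x. R < norm x \<Longrightarrow> f x = 0"
  shows "has_bochner_integral lborel (\<lambda>x. f' x e) 0"
proof -
  define h where "h n = inverse (real (Suc n))" for n
  define D where "D n x = (f (x + h n *\<^sub>R e) - f x) / h n" for n x
  have h0: "0 < h n" "h n \<le> 1" for n by (auto simp: h_def field_simps)
  have hlim: "h \<longlonglongrightarrow> 0" unfolding h_def by (rule LIMSEQ_inverse_real_of_nat)
  have fc: "continuous_on UNIV f"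
    by (metis continuous_at_imp_continuous_on f' has_derivative_continuous)
  have fint: "integrable lborel f" by (rule compact_support_integrable[OF fc R])
  have ft: "integrable lborel (\<lambda>x. f (x + v)) \<and> (\<integral>x. f (x + v) \<partial>lborel) = integral\<^sup>L lborel f" for v
  proof
    have m: "(\<lambda>x. x + v) \<in> measurable lborel borel" by measurable
    have f: "f \<in> borel_measurable borel" using fc by (simp add: borel_measurable_continuous_onI)
    have d: "distr lborel borel (\<lambda>x. x + v) = lborel"
    proof -
      have "(\<lambda>x. x + v) = (+) v" by (auto simp: add.commute)
      then show ?thesis using lborel_distr_plus[of v] by simp
    qed
    show "integrable lborel (\<lambda>x. f (x + v))"
      using integrable_distr[OF m, of f] fint d by simp
    show "(\<integral>x. f (x + v) \<partial>lborel) = integral\<^sup>L lborel f"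
      using integral_distr[OF m f] d by simp
  qed
  have line: "((\<lambda>t. f (x + t *\<^sub>R e)) has_real_derivative f' (x + t *\<^sub>R e) e) (at t)" for x t
  proof -
    have "((\<lambda>t. f (x + t *\<^sub>R e)) has_derivative (\<lambda>s. f' (x + t *\<^sub>R e) (s *\<^sub>R e))) (at t)"
      by (rule has_derivative_compose[where g=f, OF _ f']) (auto intro!: derivative_eq_intros)
    moreover have "f' (x + t *\<^sub>R e) (s *\<^sub>R e) = f' (x + t *\<^sub>R e) e * s" for s
      using linear_cmul[OF has_derivative_linear[OF f']] by simp
    ultimately show ?thesis by (simp add: has_field_derivative_def)
  qed
  have Dlim: "(\<lambda>n. D n x) \<longlonglongrightarrow> f' x e" for x
  proof -
    have "((\<lambda>t. (f (x + t *\<^sub>R e) - f x) / t) \<longlongrightarrow> f' x e) (at 0)"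
      using line[of x 0] by (simp add: has_field_derivative_iff)
    moreover have "filterlim h (at 0) sequentially"
      using hlim h0 by (auto simp: filterlim_at intro!: always_eventually) (metis less_irrefl)
    ultimately show ?thesis unfolding D_def by (rule filterlim_compose)
  qed
  \<comment> \<open>As \<open>h n\<close> <= 1, all difference quotients live in the ball of radius
    \<open>R + norm e\<close>, and the mean value theorem bounds them by \<open>B\<close>: one
    dominating function for every n.\<close>
  have Db: "\<bar>D n x\<bar> \<le> B * indicator (cball 0 (R + norm e)) x" for n x
  proof (cases "norm x \<le> R + norm e")
    case True
    obtain t where "f (x + h n *\<^sub>R e) - f (x + 0 *\<^sub>R e) = (h n - 0) * f' (x + t *\<^sub>R e) e"
      using MVT2[OF h0(1)[of n], of "\<lambda>t. f (x + t *\<^sub>R e)" "\<lambda>t. f' (x + t *\<^sub>R e) e"] line by blast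
    then have "D n x = f' (x + t *\<^sub>R e) e" using h0[of n] by (simp add: D_def)
    then show ?thesis using B True by simp
  next
    case False
    have "norm (h n *\<^sub>R e) \<le> norm e" using h0[of n] by (simp add: mult_left_le_one_le)
    then have "R < norm (x + h n *\<^sub>R e)"
      using False norm_diff_ineq[of x "h n *\<^sub>R e"] by linarith
    moreover have "R < norm x" using False norm_ge_zero[of e] by linarith
    ultimately show ?thesis using False R by (simp add: D_def)
  qed
  have Dm: "D n \<in> borel_measurable lborel" for n
    unfolding D_def using fc
    by (intro borel_measurable_divide borel_measurable_diff)
       (auto intro!: borel_measurable_continuous_onI continuous_intros continuous_on_compose2[of UNIV f])
  have D0: "integral\<^sup>L lborel (D n) = 0" for n
    unfolding D_def using ft fint by simp
  have bint: "integrable lborel (\<lambda>x. B * indicator (cball 0 (R + norm e)) x)"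
    by (intro integrable_mult_right integrable_real_indicator) (use emeasure_bounded_finite[OF bounded_cball, of 0 "R + norm e"] in auto)
  have m: "(\<lambda>x. f' x e) \<in> borel_measurable lborel"
    by (rule borel_measurable_LIMSEQ_real[OF Dlim Dm])
  have "integrable lborel (\<lambda>x. f' x e)"
    by (rule integrable_dominated_convergence[where s=D, OF m Dm bint]) (use Dlim Db in auto)
  moreover have "(\<lambda>n. integral\<^sup>L lborel (D n)) \<longlonglongrightarrow> (\<integral>x. f' x e \<partial>lborel)"
    by (rule integral_dominated_convergence[where s=D, OF m Dm bint]) (use Dlim Db in auto)
  then have "(\<integral>x. f' x e \<partial>lborel) = 0" unfolding D0 by (simp add: LIMSEQ_const_iff)
  ultimately show ?thesis by (simp add: has_bochner_integral_iff)
qed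

text \<open>Each product of \<Psi> with a component of W is differentiable on the whole space,
  because \<Psi> vanishes off a compact subset of U; the values of W outside U are multiplied by 0.
  The previous lemma then applies along every coordinate axis, and continuity of the diagonal
  partial derivatives of W supplies the bound it asks for.\<close>

lemma integral_divergence_eq_0:
  fixes \<Psi> :: "real^'n \<Rightarrow> real" and W :: "real^'n \<Rightarrow> real^'n"
  assumes U: "open U" and K: "compact K" "K \<subseteq> U" "\<And>x. x \<notin> K \<Longrightarrow> \<Psi> x = 0"
    and \<Psi>: "\<And>x. x \<in> U \<Longrightarrow> GDERIV \<Psi> x :> g\<Psi> x" and cont_g: "continuous_on U g\<Psi>"
    and W: "\<And>x i. x \<in> U \<Longrightarrow> GDERIV (\<lambda>x. W x $ i) x :> V i x"
    and cont_V: "\<And>i. continuous_on U (\<lambda>x. V i x $ i)"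
  shows "has_bochner_integral lborel
    (\<lambda>x. if x \<in> U then g\<Psi> x \<bullet> W x + \<Psi> x * (\<Sum>i\<in>UNIV. V i x $ i) else 0) 0"
proof -
  define G where "G i x = (if x \<in> U then \<Psi> x *\<^sub>R V i x + (W x $ i) *\<^sub>R g\<Psi> x else 0)" for i x
  have K': "open (- K)" using K(1) by (simp add: compact_imp_closed open_Compl)
  have g0: "g\<Psi> x = 0" if "x \<in> U" "x \<notin> K" for x
  proof -
    have "((\<lambda>x. 0) has_derivative (\<lambda>h. h \<bullet> g\<Psi> x)) (at x)"
      by (rule has_derivative_transform_within_open[OF \<Psi>[OF that(1), unfolded gderiv_def] K'])
         (use that K(3) in auto)
    then have "(\<lambda>h. h \<bullet> g\<Psi> x) = (\<lambda>h. 0)"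
      by (rule has_derivative_unique) (rule has_derivative_const)
    then show ?thesis by (metis inner_eq_zero_iff)
  qed
  have G0: "G i x = 0" if "x \<notin> K" for i x
    using g0[of x] K(3)[of x] that by (auto simp: G_def)
  have dG: "((\<lambda>x. \<Psi> x * W x $ i) has_derivative (\<lambda>h. h \<bullet> G i x)) (at x)" for i x
  proof (cases "x \<in> U")
    case True
    from GDERIV_mult[OF \<Psi>[OF this] W[OF this]] show ?thesis
      using True by (simp add: gderiv_def G_def)
  next
    case False
    then have x: "x \<notin> K" using K(2) by auto
    have "((\<lambda>x. \<Psi> x * W x $ i) has_derivative (\<lambda>h. 0)) (at x)"
      by (rule has_derivative_transform_within_open[OF has_derivative_const K'])
         (use x K(3) in auto)
    then show ?thesis using G0[OF x] by simp
  qed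
  have "continuous_on K (\<lambda>x. axis i 1 \<bullet> G i x)" for i
  proof -
    have "continuous_on U (\<lambda>x. \<Psi> x * V i x $ i + W x $ i * g\<Psi> x $ i)"
    proof -
      have c: "continuous_on U \<Psi>" "continuous_on U (\<lambda>x. W x $ i)"
        using \<Psi> W[of _ i] unfolding gderiv_def
        by (meson continuous_at_imp_continuous_on has_derivative_continuous)+
      show ?thesis
        by (intro continuous_on_add continuous_on_mult c cont_V continuous_on_component[OF cont_g])
    qed
    then have "continuous_on K (\<lambda>x. \<Psi> x * V i x $ i + W x $ i * g\<Psi> x $ i)"
      using K(2) continuous_on_subset by blast
    then show ?thesis
      by (rule continuous_on_eq) (use K(2) in \<open>auto simp: G_def inner_axis'\<close>)
  qed
  then have "\<exists>B. \<forall>x\<in>K. \<bar>axis i 1 \<bullet> G i x\<bar> \<le> B" for i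
    using compact_imp_bounded[OF compact_continuous_image[OF _ K(1)]]
    by (fastforce simp: bounded_iff)
  then obtain B where B: "\<And>i x. x \<in> K \<Longrightarrow> \<bar>axis i 1 \<bullet> G i x\<bar> \<le> B i" by metis
  obtain R where R: "\<And>x. x \<in> K \<Longrightarrow> norm x \<le> R"
    using compact_imp_bounded[OF K(1)] by (auto simp: bounded_iff)
  have "has_bochner_integral lborel (\<lambda>x. axis i 1 \<bullet> G i x) 0" for i
  proof (rule integral_directional_derivative_eq_0[OF dG])
    show "\<bar>axis i 1 \<bullet> G i x\<bar> \<le> \<bar>B i\<bar>" for x
      using B[of x i] G0[of x i] by (cases "x \<in> K") auto
    show "\<Psi> x * W x $ i = 0" if "R < norm x" for x
      using R[of x] K(3)[of x] that by force
  qed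
  then have "has_bochner_integral lborel (\<lambda>x. \<Sum>i\<in>UNIV. axis i 1 \<bullet> G i x) (\<Sum>i\<in>(UNIV::'n set). 0)"
    by (intro has_bochner_integral_sum)
  moreover have "(\<Sum>i\<in>UNIV. axis i 1 \<bullet> G i x)
     = (if x \<in> U then g\<Psi> x \<bullet> W x + \<Psi> x * (\<Sum>i\<in>UNIV. V i x $ i) else 0)" for x
  proof -
    have "axis i 1 \<bullet> G i x = G i x $ i" for i by (simp add: inner_axis')
    then show ?thesis
      by (simp add: G_def inner_vec_def sum.distrib sum_distrib_left algebra_simps)
  qed
  ultimately show ?thesis by simp
qed

section \<open>The complement of the axis and divergences in the variables r and cos
  \<theta>\<close>

definition off_axis :: "(real^3) set" where
  "off_axis = {x. x $ 1 \<noteq> 0 \<or> x $ 2 \<noteq> 0}"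

abbreviation off_axis_ext :: "(real^3 \<Rightarrow> real) \<Rightarrow> real^3 \<Rightarrow> real" where
  "off_axis_ext f x \<equiv> if x \<in> off_axis then f x else 0"

definition cos_grad :: "real^3 \<Rightarrow> real^3" where
  "cos_grad x = (1 / norm x) *\<^sub>R axis 3 1 - (x $ 3 / norm x ^ 3) *\<^sub>R x"

abbreviation polar_dom :: "(real \<times> real) set" where
  "polar_dom \<equiv> {0<..} \<times> {-1<..<1}"

text \<open>The arguments are \<open>r\<close> and \<open>c = cos \<theta>\<close>; \<open>fr\<close> and \<open>fc\<close> are the partial derivatives of \<open>f\<close>.\<close>
definition C1_polar :: "(real \<Rightarrow> real \<Rightarrow> real) \<Rightarrow> (real \<Rightarrow> real \<Rightarrow> real) \<Rightarrow> (real \<Rightarrow> real \<Rightarrow> real) \<Rightarrow> bool" where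
  "C1_polar f fr fc \<longleftrightarrow>
     (\<forall>r>0. \<forall>c. \<bar>c\<bar> < 1 \<longrightarrow>
        ((\<lambda>p. f (fst p) (snd p)) has_derivative (\<lambda>h. fr r c * fst h + fc r c * snd h)) (at (r, c))) \<and>
     continuous_on polar_dom (\<lambda>p. fr (fst p) (snd p)) \<and>
     continuous_on polar_dom (\<lambda>p. fc (fst p) (snd p))"

lemma open_off_axis: "open off_axis"
proof -
  have "off_axis = - {x. x $ 1 = 0} \<union> - {x. x $ 2 = 0}" by (auto simp: off_axis_def)
  moreover have "closed {x::real^3. x $ i = 0}" for i
    by (intro closed_Collect_eq continuous_intros)
  ultimately show ?thesis by (metis open_Compl open_Un)
qed

lemma norm_sq_3: "(norm x)\<^sup>2 = (x $ 1)\<^sup>2 + (x $ 2)\<^sup>2 + (x $ 3)\<^sup>2" for x :: "real^3"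
  by (simp only: power2_norm_eq_inner) (simp add: inner_vec_def sum_3 power2_eq_square)

lemma off_axis_polar:
  assumes "x \<in> off_axis"
  shows "norm x > 0" "\<bar>x $ 3 / norm x\<bar> < 1"
proof -
  have p: "(x $ 1)\<^sup>2 + (x $ 2)\<^sup>2 > 0"
    using assms by (auto simp: off_axis_def sum_power2_gt_zero_iff)
  show n: "norm x > 0" using assms by (auto simp: off_axis_def)
  have "(x $ 3)\<^sup>2 < (norm x)\<^sup>2" using p norm_sq_3[of x] by linarith
  then have "\<bar>x $ 3\<bar> < norm x"
    using abs_le_square_iff[of "norm x" "x $ 3"] by (simp add: not_le[symmetric])
  then show "\<bar>x $ 3 / norm x\<bar> < 1" using n by (simp add: abs_divide)
qed

lemma cos_GDERIV:
  assumes "x \<noteq> 0" shows "GDERIV (\<lambda>x. x $ 3 / norm x) x :> cos_grad x"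
proof -
  show ?thesis
    unfolding divide_inverse
    by (rule GDERIV_subst[OF GDERIV_mult[OF GDERIV_component GDERIV_inverse[OF GDERIV_norm[OF assms]]]])
       (use assms in \<open>auto simp: cos_grad_def sgn_div_norm field_simps power2_eq_square power3_eq_cube\<close>)
qed

lemma C1_polar_GDERIV:
  assumes "C1_polar f fr fc" "x \<in> off_axis"
  shows "GDERIV (\<lambda>x. f (norm x) (x $ 3 / norm x)) x :>
     (fr (norm x) (x $ 3 / norm x) / norm x) *\<^sub>R x + fc (norm x) (x $ 3 / norm x) *\<^sub>R cos_grad x"
proof -
  note p = off_axis_polar[OF assms(2)]
  have nz: "x \<noteq> 0" using p(1) by auto
  have d: "((\<lambda>x. (norm x, x $ 3 / norm x)) has_derivative (\<lambda>h. (h \<bullet> sgn x, h \<bullet> cos_grad x))) (at x)"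
    using GDERIV_norm[OF nz] cos_GDERIV[OF nz] unfolding gderiv_def by (rule has_derivative_Pair)
  have "((\<lambda>x. f (fst (norm x, x $ 3 / norm x)) (snd (norm x, x $ 3 / norm x))) has_derivative
     (\<lambda>h. fr (norm x) (x $ 3 / norm x) * fst (h \<bullet> sgn x, h \<bullet> cos_grad x)
        + fc (norm x) (x $ 3 / norm x) * snd (h \<bullet> sgn x, h \<bullet> cos_grad x))) (at x)"
    by (rule has_derivative_compose[OF d]) (use assms(1) p in \<open>auto simp: C1_polar_def\<close>)
  then show ?thesis
    unfolding gderiv_def by (simp add: inner_add_right sgn_div_norm divide_inverse algebra_simps)
qed

lemma continuous_on_polar:
  assumes "continuous_on polar_dom (\<lambda>p. f (fst p) (snd p))"
  shows "continuous_on off_axis (\<lambda>x. f (norm x) (x $ 3 / norm x))"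
proof -
  have "continuous_on off_axis (\<lambda>x::real^3. (norm x, x $ 3 / norm x))"
    using off_axis_polar(1) by (intro continuous_intros) force
  moreover have "(\<lambda>x::real^3. (norm x, x $ 3 / norm x)) ` off_axis \<subseteq> polar_dom"
  proof (rule image_subsetI)
    fix x :: "real^3" assume "x \<in> off_axis"
    from off_axis_polar[OF this] have "norm x > 0" "-1 < x $ 3 / norm x" "x $ 3 / norm x < 1"
      by linarith+
    then show "(norm x, x $ 3 / norm x) \<in> polar_dom" by simp
  qed
  ultimately have "continuous_on off_axis (\<lambda>x::real^3. (\<lambda>p. f (fst p) (snd p)) (norm x, x $ 3 / norm x))"
    by (intro continuous_on_compose2[OF assms])
  then show ?thesis by simp
qed

text \<open>The field \<open>P \<partial>r + Q \<partial>c\<close>; it is the gradient of \<open>f (r, c)\<close> for \<open>P = f\<^sub>r\<close>, \<open>Q = f\<^sub>c\<close>.\<close>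
definition polar_field :: "(real \<Rightarrow> real \<Rightarrow> real) \<Rightarrow> (real \<Rightarrow> real \<Rightarrow> real) \<Rightarrow> real^3 \<Rightarrow> real^3" where
  "polar_field P Q x = (P (norm x) (x $ 3 / norm x) / norm x) *\<^sub>R x
     + Q (norm x) (x $ 3 / norm x) *\<^sub>R cos_grad x"

lemma cos_grad_component_GDERIV:
  assumes "x \<noteq> 0"
  shows "GDERIV (\<lambda>x. cos_grad x $ i) x :>
     (if i = 3 then - (1 / norm x ^ 3) *\<^sub>R x else 0)
       - (x $ i / norm x ^ 3) *\<^sub>R axis 3 1 - (x $ 3 / norm x ^ 3) *\<^sub>R axis i 1
       + (3 * x $ 3 * x $ i / norm x ^ 5) *\<^sub>R x"
proof -
  have n: "norm x \<noteq> 0" using assms by simp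
  define k :: real where "k = (if i = 3 then 1 else 0)"
  have eq: "(\<lambda>x. cos_grad x $ i) = (\<lambda>x. k / norm x - x $ 3 * x $ i * (1 / norm x ^ 3))"
    by (auto simp: cos_grad_def axis_def k_def)
  have d1: "((\<lambda>t. k / t) has_real_derivative - k / (norm x)\<^sup>2) (at (norm x))"
    by (rule derivative_eq_intros refl n)+ (use n in \<open>simp add: power2_eq_square\<close>)
  have d3: "((\<lambda>t. 1 / t ^ 3) has_real_derivative - 3 / norm x ^ 4) (at (norm x))"
    by (rule derivative_eq_intros refl n)+ (use n in \<open>simp_all add: field_simps eval_nat_numeral\<close>)
  note N = GDERIV_norm[OF assms]
  show ?thesis
    unfolding eq
    by (rule GDERIV_subst[OF GDERIV_diff[OF GDERIV_DERIV_compose[OF N d1]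
          GDERIV_mult[OF GDERIV_mult[OF GDERIV_component GDERIV_component] GDERIV_DERIV_compose[OF N d3]]]])
       (use n in \<open>simp add: vec_eq_iff k_def sgn_div_norm algebra_simps
         divide_simps eval_nat_numeral\<close>)
qed

text \<open>For P = f_r and Q = f_c the trace is the Laplacian of f in r and c = cos \<theta>. The
  mixed derivatives \<open>Pc\<close> and \<open>Qr\<close> drop out because the gradients of r and
  c are orthogonal.\<close>

lemma polar_field_GDERIV:
  assumes P: "C1_polar P Pr Pc" and Q: "C1_polar Q Qr Qc"
  obtains V where
    "\<And>x i. x \<in> off_axis \<Longrightarrow> GDERIV (\<lambda>x. polar_field P Q x $ i) x :> V i x"
    "\<And>i. continuous_on off_axis (\<lambda>x. V i x $ i)"
    "\<And>x. x \<in> off_axis \<Longrightarrow> (\<Sum>i\<in>UNIV. V i x $ i) =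
       (let r = norm x; c = x $ 3 / norm x in
         Pr r c + 2 * P r c / r + ((1 - c\<^sup>2) * Qc r c - 2 * c * Q r c) / r\<^sup>2)"
proof -
  define p where "p f x = f (norm x) (x $ 3 / norm x)" for f :: "real \<Rightarrow> real \<Rightarrow> real" and x :: "real^3"
  define gp where "gp fr fc x = (p fr x / norm x) *\<^sub>R x + p fc x *\<^sub>R cos_grad x"
    for fr fc :: "real \<Rightarrow> real \<Rightarrow> real" and x :: "real^3"
  define gc where "gc i x = (if i = 3 then - (1 / norm x ^ 3) *\<^sub>R x else 0)
       - (x $ i / norm x ^ 3) *\<^sub>R axis 3 1 - (x $ 3 / norm x ^ 3) *\<^sub>R axis i 1
       + (3 * x $ 3 * x $ i / norm x ^ 5) *\<^sub>R x" for i and x :: "real^3"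
  define V where "V i x = (p P x / norm x) *\<^sub>R axis i 1
      + x $ i *\<^sub>R ((1 / norm x) *\<^sub>R gp Pr Pc x - (p P x / norm x ^ 3) *\<^sub>R x)
      + (p Q x *\<^sub>R gc i x + cos_grad x $ i *\<^sub>R gp Qr Qc x)" for i x
  have n: "norm x \<noteq> 0" "x \<noteq> 0" if "x \<in> off_axis" for x
    using off_axis_polar(1)[OF that] by auto
  have g: "GDERIV (p P) x :> gp Pr Pc x" "GDERIV (p Q) x :> gp Qr Qc x" if "x \<in> off_axis" for x
    using C1_polar_GDERIV[OF P that] C1_polar_GDERIV[OF Q that] by (simp_all add: p_def[abs_def] gp_def)
  have cont: "continuous_on off_axis (p P)" "continuous_on off_axis (p Q)"
    using g unfolding gderiv_def
    by (meson continuous_at_imp_continuous_on has_derivative_continuous)+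
  have cont': "continuous_on off_axis (p Pr)" "continuous_on off_axis (p Pc)"
     "continuous_on off_axis (p Qr)" "continuous_on off_axis (p Qc)"
    using P Q unfolding C1_polar_def p_def[abs_def] by (auto intro!: continuous_on_polar)
  show ?thesis
  proof (rule that[of V])
    fix x i assume x: "x \<in> off_axis"
    have 2: "GDERIV (\<lambda>x. cos_grad x $ i) x :> gc i x"
      unfolding gc_def by (rule cos_grad_component_GDERIV[OF n(2)[OF x]])
    have 3: "GDERIV (\<lambda>x. inverse (norm x)) x :> - (inverse (norm x))\<^sup>2 *\<^sub>R sgn x"
      by (rule GDERIV_inverse[OF GDERIV_norm]) (use n[OF x] in auto)
    have eq: "(\<lambda>x. polar_field P Q x $ i) = (\<lambda>x. p P x * inverse (norm x) * x $ i + p Q x * cos_grad x $ i)"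
      by (simp add: fun_eq_iff polar_field_def p_def divide_inverse)
    show "GDERIV (\<lambda>x. polar_field P Q x $ i) x :> V i x"
      unfolding eq
      by (rule GDERIV_subst[OF GDERIV_add[OF GDERIV_mult[OF GDERIV_mult[OF g(1)[OF x] 3] GDERIV_component]
              GDERIV_mult[OF g(2)[OF x] 2]]])
         (use n[OF x] in \<open>simp add: V_def sgn_div_norm scaleR_add_right scaleR_diff_right
            divide_inverse power2_eq_square power3_eq_cube mult_ac\<close>)
  next
    fix i
    show "continuous_on off_axis (\<lambda>x. V i x $ i)"
    proof -
      have nn: "\<forall>x\<in>off_axis. norm x \<noteq> 0" "\<forall>x\<in>off_axis. norm x ^ m \<noteq> 0" for m
        using n by auto
      have cn: "continuous_on off_axis norm" "continuous_on off_axis (\<lambda>x. x $ j)" for j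
        by (intro continuous_intros)+
      have cg: "continuous_on off_axis cos_grad"
        unfolding cos_grad_def[abs_def]
        by (intro continuous_intros) (use nn in auto)
      have cgc: "continuous_on off_axis (gc i)"
      proof (cases "i = 3")
        case True
        then show ?thesis unfolding gc_def[abs_def] by simp (intro continuous_intros; use nn in auto)
      next
        case False
        then show ?thesis unfolding gc_def[abs_def] by simp (intro continuous_intros; use nn in auto)
      qed
      have cgp: "continuous_on off_axis (gp Pr Pc)" "continuous_on off_axis (gp Qr Qc)"
        unfolding gp_def[abs_def]
        by (intro continuous_on_add continuous_on_scaleR continuous_on_divide cont' cg cn(1)
             continuous_on_id nn)+
      have "continuous_on off_axis (V i)"
        unfolding V_def[abs_def]
        by (intro continuous_on_add continuous_on_scaleR continuous_on_divide continuous_on_diff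
             continuous_on_power continuous_on_component[OF cg] cont cgp cgc cn
             continuous_on_id continuous_on_const nn)
      then show ?thesis by (rule continuous_on_component)
    qed
  next
    fix x assume x: "x \<in> off_axis"
    define r c where "r = norm x" and "c = x $ 3 / r"
    have r: "r \<noteq> 0" "(x $ 1)\<^sup>2 + (x $ 2)\<^sup>2 + (x $ 3)\<^sup>2 = r\<^sup>2" and x3: "x $ 3 = c * r"
      using n[OF x] norm_sq_3 by (auto simp: r_def c_def)
    have cg: "cos_grad x $ 1 = - (c / r\<^sup>2) * x $ 1" "cos_grad x $ 2 = - (c / r\<^sup>2) * x $ 2"
       "cos_grad x $ 3 = 1 / r - (c / r\<^sup>2) * x $ 3"
      using r(1) by (simp_all add: cos_grad_def axis_def r_def[symmetric] x3 power2_eq_square power3_eq_cube)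
    \<comment> \<open>Four contractions determine the trace: |x|^2, the inner product of x with grad
      c, |grad c|^2, and div grad c.\<close>
    have s1: "(\<Sum>i\<in>UNIV. x $ i * x $ i) = r\<^sup>2"
      using r(2) by (simp add: sum_3 power2_eq_square)
    have s2: "(\<Sum>i\<in>UNIV. x $ i * cos_grad x $ i) = 0"
    proof -
      have "(\<Sum>i\<in>UNIV. x $ i * cos_grad x $ i) = x $ 3 / r - (c / r\<^sup>2) * (\<Sum>i\<in>UNIV. x $ i * x $ i)"
        by (simp add: sum_3 cg algebra_simps)
      then show ?thesis using r(1) by (simp add: s1 x3)
    qed
    have s3: "(\<Sum>i\<in>UNIV. cos_grad x $ i * cos_grad x $ i) = (1 - c\<^sup>2) / r\<^sup>2"
    proof -
      have "(\<Sum>i\<in>UNIV. cos_grad x $ i * cos_grad x $ i)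
         = cos_grad x $ 3 / r - (c / r\<^sup>2) * (\<Sum>i\<in>UNIV. x $ i * cos_grad x $ i)"
        by (simp add: sum_3 cg algebra_simps diff_divide_distrib power2_eq_square)
      then show ?thesis using r(1) by (simp add: s2 cg x3 field_simps power2_eq_square)
    qed
    have s4: "(\<Sum>i\<in>UNIV. gc i x $ i) = - 2 * c / r\<^sup>2"
    proof -
      have "(\<Sum>i\<in>UNIV. gc i x $ i) = - 5 * x $ 3 / r ^ 3 + 3 * x $ 3 / r ^ 5 * (\<Sum>i\<in>UNIV. x $ i * x $ i)"
        by (simp add: gc_def sum_3 axis_def r_def[symmetric] algebra_simps add_divide_distrib)
      then show ?thesis using r(1) by (simp add: s1 x3 field_simps eval_nat_numeral)
    qed
    have "(\<Sum>i\<in>UNIV. V i x $ i) = 3 * (p P x / r)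
        + (p Pr x / r\<^sup>2 - p P x / r ^ 3) * (\<Sum>i\<in>UNIV. x $ i * x $ i)
        + (p Pc x / r + p Qr x / r) * (\<Sum>i\<in>UNIV. x $ i * cos_grad x $ i)
        + p Q x * (\<Sum>i\<in>UNIV. gc i x $ i)
        + p Qc x * (\<Sum>i\<in>UNIV. cos_grad x $ i * cos_grad x $ i)"
      by (simp add: V_def gp_def sum_3 axis_def r_def[symmetric] algebra_simps power2_eq_square)
    then show "(\<Sum>i\<in>UNIV. V i x $ i) =
       (let r = norm x; c = x $ 3 / norm x in
         Pr r c + 2 * P r c / r + ((1 - c\<^sup>2) * Qc r c - 2 * c * Q r c) / r\<^sup>2)"
      unfolding s1 s2 s3 s4 using r(1)
      by (simp add: Let_def p_def flip: r_def c_def)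
         (simp add: field_simps eval_nat_numeral)
  qed
qed

section \<open>The extreme Kerr data\<close>

text \<open>With \<open>R = r + m\<close> and \<open>\<Sigma> = kerr_S\<close>, one has \<open>X = (1 - c\<^sup>2) kerr_A / \<Sigma>\<close> and
  \<open>Y\<^sub>c = - 2 J (1 - c\<^sup>2) kerr_T / \<Sigma>\<^sup>2\<close>.\<close>
definition kerr_A :: "real \<Rightarrow> real \<Rightarrow> real \<Rightarrow> real" where
  "kerr_A m r c = ((r + m)\<^sup>2 + m\<^sup>2)\<^sup>2 - r\<^sup>2 * m\<^sup>2 * (1 - c\<^sup>2)"
definition kerr_S :: "real \<Rightarrow> real \<Rightarrow> real \<Rightarrow> real" where
  "kerr_S m r c = (r + m)\<^sup>2 + m\<^sup>2 * c\<^sup>2"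
definition kerr_T :: "real \<Rightarrow> real \<Rightarrow> real \<Rightarrow> real" where
  "kerr_T m r c = 3 * (kerr_S m r c)\<^sup>2 + m\<^sup>2 * kerr_S m r c * (1 - 5 * c\<^sup>2) - 2 * m ^ 4 * c\<^sup>2 * (1 - c\<^sup>2)"
definition kerr_Ar :: "real \<Rightarrow> real \<Rightarrow> real \<Rightarrow> real" where
  "kerr_Ar m r c = 4 * (r + m) * ((r + m)\<^sup>2 + m\<^sup>2) - 2 * r * m\<^sup>2 * (1 - c\<^sup>2)"
definition kerr_Ac :: "real \<Rightarrow> real \<Rightarrow> real \<Rightarrow> real" where
  "kerr_Ac m r c = 2 * r\<^sup>2 * m\<^sup>2 * c"

text \<open>The field equation \<Delta> v = - |\<partial>Y|^2 / X^2 cleared of its denominators by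
  r^2 A^2 S^2, with m^4 standing for J^2. The three groups on the left come from ln A, ln S and 2 ln
  r.\<close>

lemma kerr_laplace_identity:
  fixes m r c :: real
  defines "A \<equiv> kerr_A m r c" and "S \<equiv> kerr_S m r c" and "T \<equiv> kerr_T m r c"
    and "Ar \<equiv> kerr_Ar m r c" and "Ac \<equiv> kerr_Ac m r c"
  shows "S\<^sup>2 * (r\<^sup>2 * (A * (12 * (r + m)\<^sup>2 + 4 * m\<^sup>2 - 2 * m\<^sup>2 * (1 - c\<^sup>2)) - Ar\<^sup>2) + 2 * r * A * Ar
      + (1 - c\<^sup>2) * (A * (2 * r\<^sup>2 * m\<^sup>2) - Ac\<^sup>2) - 2 * c * A * Ac)
    - A\<^sup>2 * (r\<^sup>2 * (2 * S - (2 * (r + m))\<^sup>2) + 2 * r * S * (2 * (r + m))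
      + (1 - c\<^sup>2) * (2 * m\<^sup>2 * S - (2 * m\<^sup>2 * c)\<^sup>2) - 2 * c * S * (2 * m\<^sup>2 * c))
    - 2 * A\<^sup>2 * S\<^sup>2
    = - (4 * m ^ 4 * (1 - c\<^sup>2) * (4 * m ^ 4 * c\<^sup>2 * (r + m)\<^sup>2 * (1 - c\<^sup>2) * r\<^sup>2 + T\<^sup>2))"
  unfolding assms kerr_A_def kerr_S_def kerr_T_def kerr_Ar_def kerr_Ac_def
  by algebra

text \<open>The numerator of div (X^-2 \<partial>Y) over the common denominator r^2 A^3, with the
  factor J removed.\<close>

lemma kerr_twist_identity:
  fixes m r c :: real
  defines "A \<equiv> kerr_A m r c" and "S \<equiv> kerr_S m r c" and "T \<equiv> kerr_T m r c"
    and "Ar \<equiv> kerr_Ar m r c" and "Ac \<equiv> kerr_Ac m r c"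
  shows "r\<^sup>2 * (4 * m\<^sup>2 * c * A - 8 * m\<^sup>2 * c * (r + m) * Ar) + 2 * r * (4 * m\<^sup>2 * c * (r + m) * A)
    - 2 * (A * (6 * S * (2 * m\<^sup>2 * c) + m\<^sup>2 * (2 * m\<^sup>2 * c) * (1 - 5 * c\<^sup>2) - 10 * m\<^sup>2 * c * S
         - 2 * m ^ 4 * (2 * c - 4 * c ^ 3)) - 2 * T * Ac) = 0"
  unfolding assms kerr_A_def kerr_S_def kerr_T_def kerr_Ar_def kerr_Ac_def
  by algebra

section \<open>Differentiation rules in the variables r and c\<close>

lemma C1_polar_const: "C1_polar (\<lambda>r c. k) (\<lambda>r c. 0) (\<lambda>r c. 0)"
  by (simp add: C1_polar_def)

lemma C1_polar_r: "C1_polar (\<lambda>r c. r) (\<lambda>r c. 1) (\<lambda>r c. 0)"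
  and C1_polar_c: "C1_polar (\<lambda>r c. c) (\<lambda>r c. 0) (\<lambda>r c. 1)"
  by (auto simp: C1_polar_def intro!: derivative_eq_intros)

lemma C1_polar_continuous:
  assumes "C1_polar f fr fc"
  shows "continuous_on polar_dom (\<lambda>p. f (fst p) (snd p))"
    "continuous_on polar_dom (\<lambda>p. fr (fst p) (snd p))"
    "continuous_on polar_dom (\<lambda>p. fc (fst p) (snd p))"
proof -
  have "isCont (\<lambda>p. f (fst p) (snd p)) q" if "q \<in> polar_dom" for q
  proof -
    obtain r c where q: "q = (r, c)" by (cases q)
    have "0 < r" "\<bar>c\<bar> < 1" using that q by (auto simp: abs_less_iff)
    then show ?thesis using assms has_derivative_continuous unfolding C1_polar_def q by blast
  qed
  then show "continuous_on polar_dom (\<lambda>p. f (fst p) (snd p))"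
    by (rule continuous_at_imp_continuous_on[rule_format])
qed (use assms in \<open>auto simp: C1_polar_def\<close>)

lemma C1_polar_add:
  assumes "C1_polar f fr fc" "C1_polar g gr gc"
  shows "C1_polar (\<lambda>r c. f r c + g r c) (\<lambda>r c. fr r c + gr r c) (\<lambda>r c. fc r c + gc r c)"
  using assms unfolding C1_polar_def
  by (auto intro!: continuous_intros derivative_eq_intros simp: algebra_simps)

lemma C1_polar_diff:
  assumes "C1_polar f fr fc" "C1_polar g gr gc"
  shows "C1_polar (\<lambda>r c. f r c - g r c) (\<lambda>r c. fr r c - gr r c) (\<lambda>r c. fc r c - gc r c)"
  using assms unfolding C1_polar_def
  by (auto intro!: continuous_intros derivative_eq_intros simp: algebra_simps)

lemma C1_polar_mult:
  assumes "C1_polar f fr fc" "C1_polar g gr gc"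
  shows "C1_polar (\<lambda>r c. f r c * g r c) (\<lambda>r c. f r c * gr r c + fr r c * g r c)
    (\<lambda>r c. f r c * gc r c + fc r c * g r c)"
  unfolding C1_polar_def
proof (intro conjI allI impI)
  fix r c :: real assume rc: "0 < r" "\<bar>c\<bar> < 1"
  show "((\<lambda>p. f (fst p) (snd p) * g (fst p) (snd p)) has_derivative
     (\<lambda>h. (f r c * gr r c + fr r c * g r c) * fst h + (f r c * gc r c + fc r c * g r c) * snd h)) (at (r, c))"
    by (rule has_derivative_eq_rhs, rule has_derivative_mult)
       (use assms rc in \<open>auto simp: C1_polar_def algebra_simps\<close>)
qed (intro continuous_intros C1_polar_continuous[OF assms(1)] C1_polar_continuous[OF assms(2)])+

lemma C1_polar_compose:
  assumes "C1_polar f fr fc"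
    and k: "\<And>r c. 0 < r \<Longrightarrow> \<bar>c\<bar> < 1 \<Longrightarrow> (k has_real_derivative k' (f r c)) (at (f r c))"
    and k': "\<And>r c. 0 < r \<Longrightarrow> \<bar>c\<bar> < 1 \<Longrightarrow> isCont k' (f r c)"
  shows "C1_polar (\<lambda>r c. k (f r c)) (\<lambda>r c. k' (f r c) * fr r c) (\<lambda>r c. k' (f r c) * fc r c)"
  unfolding C1_polar_def
proof (intro conjI allI impI)
  fix r c :: real assume rc: "0 < r" "\<bar>c\<bar> < 1"
  have d: "((\<lambda>p. f (fst p) (snd p)) has_derivative (\<lambda>h. fr r c * fst h + fc r c * snd h)) (at (r, c))"
    using assms(1) rc by (auto simp: C1_polar_def)
  have "(k has_derivative (*) (k' (f r c))) (at (f (fst (r, c)) (snd (r, c))))"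
    using k[OF rc] by (simp add: has_field_derivative_def)
  from has_derivative_compose[OF d this]
  show "((\<lambda>p. k (f (fst p) (snd p))) has_derivative
     (\<lambda>h. k' (f r c) * fr r c * fst h + k' (f r c) * fc r c * snd h)) (at (r, c))"
    by (simp add: algebra_simps)
next
  have cont: "continuous_on polar_dom (\<lambda>p. k' (f (fst p) (snd p)))"
  proof (intro continuous_at_imp_continuous_on ballI)
    fix q assume "q \<in> polar_dom"
    then obtain r c where q: "q = (r, c)" and rc: "0 < r" "\<bar>c\<bar> < 1"
      by (cases q) (auto simp: abs_less_iff)
    have "isCont (\<lambda>p. f (fst p) (snd p)) q"
      using assms(1) rc has_derivative_continuous unfolding C1_polar_def q by blast
    then show "isCont (\<lambda>p. k' (f (fst p) (snd p))) q"
      by (rule continuous_within_compose3[rotated]) (use k'[OF rc] q in simp)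
  qed
  show "continuous_on polar_dom (\<lambda>p. k' (f (fst p) (snd p)) * fr (fst p) (snd p))"
    "continuous_on polar_dom (\<lambda>p. k' (f (fst p) (snd p)) * fc (fst p) (snd p))"
    by (rule continuous_on_mult[OF cont] C1_polar_continuous[OF assms(1)])+
qed

lemma C1_polar_inverse:
  assumes "C1_polar f fr fc" "\<And>r c. 0 < r \<Longrightarrow> \<bar>c\<bar> < 1 \<Longrightarrow> f r c \<noteq> 0"
  shows "C1_polar (\<lambda>r c. inverse (f r c)) (\<lambda>r c. - inverse ((f r c)\<^sup>2) * fr r c)
     (\<lambda>r c. - inverse ((f r c)\<^sup>2) * fc r c)"
  by (rule C1_polar_compose[OF assms(1)])
     (use assms(2) in \<open>auto intro!: derivative_eq_intros continuous_intros simp: power2_eq_square\<close>)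

lemma C1_polar_ln:
  assumes "C1_polar f fr fc" "\<And>r c. 0 < r \<Longrightarrow> \<bar>c\<bar> < 1 \<Longrightarrow> f r c > 0"
  shows "C1_polar (\<lambda>r c. ln (f r c)) (\<lambda>r c. inverse (f r c) * fr r c) (\<lambda>r c. inverse (f r c) * fc r c)"
  by (rule C1_polar_compose[OF assms(1)])
     (use assms(2) in \<open>fastforce intro!: derivative_eq_intros continuous_intros simp: divide_inverse\<close>)+

lemma C1_polar_power:
  assumes "C1_polar f fr fc"
  shows "C1_polar (\<lambda>r c. f r c ^ n) (\<lambda>r c. (real n * f r c ^ (n - 1)) * fr r c)
     (\<lambda>r c. (real n * f r c ^ (n - 1)) * fc r c)"
  by (rule C1_polar_compose[OF assms, of "\<lambda>t. t ^ n"])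
     (auto intro!: derivative_eq_intros continuous_intros)

lemma C1_polar_divide:
  assumes "C1_polar f fr fc" "C1_polar g gr gc" "\<And>r c. 0 < r \<Longrightarrow> \<bar>c\<bar> < 1 \<Longrightarrow> g r c \<noteq> 0"
  shows "C1_polar (\<lambda>r c. f r c / g r c)
    (\<lambda>r c. f r c * (- inverse ((g r c)\<^sup>2) * gr r c) + fr r c * inverse (g r c))
    (\<lambda>r c. f r c * (- inverse ((g r c)\<^sup>2) * gc r c) + fc r c * inverse (g r c))"
  unfolding divide_inverse by (intro C1_polar_mult C1_polar_inverse assms)

lemmas C1_polar_intros = C1_polar_const C1_polar_r C1_polar_c C1_polar_add C1_polar_diff
  C1_polar_mult C1_polar_divide C1_polar_power

lemma C1_polar_cong:
  assumes "C1_polar f fr fc"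
    and "\<And>r c. 0 < r \<Longrightarrow> \<bar>c\<bar> < 1 \<Longrightarrow> fr r c = fr' r c"
    and "\<And>r c. 0 < r \<Longrightarrow> \<bar>c\<bar> < 1 \<Longrightarrow> fc r c = fc' r c"
  shows "C1_polar f fr' fc'"
proof -
  have "continuous_on polar_dom (\<lambda>p. fr' (fst p) (snd p))"
    by (rule continuous_on_eq[OF C1_polar_continuous(2)[OF assms(1)]])
       (use assms(2) in \<open>auto simp: abs_less_iff\<close>)
  moreover have "continuous_on polar_dom (\<lambda>p. fc' (fst p) (snd p))"
    by (rule continuous_on_eq[OF C1_polar_continuous(3)[OF assms(1)]])
       (use assms(3) in \<open>auto simp: abs_less_iff\<close>)
  ultimately show ?thesis
    using assms unfolding C1_polar_def by simp
qed

text \<open>The divergence of a polar field contains only the r-derivative of its first and the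
  c-derivative of its second coefficient. The other derivative is kept existential, which spares a
  closed form for it.\<close>

lemma C1_polar_fst_partial:
  assumes "C1_polar f fr fc" and "\<And>r c. 0 < r \<Longrightarrow> \<bar>c\<bar> < 1 \<Longrightarrow> fr r c = fr' r c"
  shows "\<exists>fc. C1_polar f fr' fc"
  using C1_polar_cong[OF assms refl] by blast

lemma C1_polar_snd_partial:
  assumes "C1_polar f fr fc" and "\<And>r c. 0 < r \<Longrightarrow> \<bar>c\<bar> < 1 \<Longrightarrow> fc r c = fc' r c"
  shows "\<exists>fr. C1_polar f fr fc'"
  using C1_polar_cong[OF assms(1) refl assms(2)] by blast

section \<open>The Kerr functions and their field equations\<close>

lemma kerr_A_ge: assumes "0 < m" "0 < r" "\<bar>c\<bar> \<le> 1" shows "(r + m) ^ 4 \<le> kerr_A m r c"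
proof -
  have "r\<^sup>2 * m\<^sup>2 * (1 - c\<^sup>2) \<le> (r + m)\<^sup>2 * m\<^sup>2 * 1"
    using assms by (intro mult_mono power_mono) (auto simp: abs_square_le_1)
  moreover have "((r + m)\<^sup>2 + m\<^sup>2)\<^sup>2 = (r + m) ^ 4 + 2 * ((r + m)\<^sup>2 * m\<^sup>2) + m ^ 4" by algebra
  moreover have "0 \<le> m ^ 4" "0 \<le> (r + m)\<^sup>2 * m\<^sup>2" by auto
  ultimately show ?thesis unfolding kerr_A_def by linarith
qed

lemma kerr_A_pos: assumes "0 < m" "0 < r" "\<bar>c\<bar> \<le> 1" shows "0 < kerr_A m r c"
  using kerr_A_ge[OF assms] assms zero_less_power[of "r + m" 4] by linarith

lemma kerr_S_ge: "(r + m)\<^sup>2 \<le> kerr_S m r c"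
  by (simp add: kerr_S_def)

lemma kerr_S_pos: assumes "0 < m" "0 < r" shows "0 < kerr_S m r c"
  using kerr_S_ge[of r m c] assms zero_less_power[of "r + m" 2] by linarith

lemma C1_kerr_S: "C1_polar (kerr_S m) (\<lambda>r c. 2 * (r + m)) (\<lambda>r c. 2 * m\<^sup>2 * c)"
  unfolding kerr_S_def[abs_def] by (rule C1_polar_cong, (rule C1_polar_intros)+) auto

lemma C1_kerr_A: "C1_polar (kerr_A m) (kerr_Ar m) (kerr_Ac m)"
  unfolding kerr_A_def[abs_def] by (rule C1_polar_cong, (rule C1_polar_intros)+)
    (auto simp: kerr_Ar_def kerr_Ac_def algebra_simps power2_eq_square)

lemma C1_kerr_Ar: "C1_polar (kerr_Ar m)
    (\<lambda>r c. 12 * (r + m)\<^sup>2 + 4 * m\<^sup>2 - 2 * m\<^sup>2 * (1 - c\<^sup>2)) (\<lambda>r c. 4 * r * m\<^sup>2 * c)"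
  unfolding kerr_Ar_def[abs_def] by (rule C1_polar_cong, (rule C1_polar_intros)+)
    (auto simp: algebra_simps power2_eq_square)

lemma C1_kerr_Ac: "C1_polar (kerr_Ac m) (\<lambda>r c. 4 * r * m\<^sup>2 * c) (\<lambda>r c. 2 * r\<^sup>2 * m\<^sup>2)"
  unfolding kerr_Ac_def[abs_def] by (rule C1_polar_cong, (rule C1_polar_intros)+)
    (auto simp: algebra_simps power2_eq_square)

lemma C1_kerr_T: "\<exists>Tr. C1_polar (kerr_T m) Tr
    (\<lambda>r c. 6 * kerr_S m r c * (2 * m\<^sup>2 * c) + m\<^sup>2 * (2 * m\<^sup>2 * c) * (1 - 5 * c\<^sup>2)
        - 10 * m\<^sup>2 * c * kerr_S m r c - 2 * m ^ 4 * (2 * c - 4 * c ^ 3))"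
  unfolding kerr_T_def[abs_def]
  by (rule C1_polar_snd_partial, (rule C1_polar_intros C1_kerr_S)+)
     (auto simp: algebra_simps power2_eq_square power3_eq_cube)

definition kerr_v :: "real \<Rightarrow> real \<Rightarrow> real \<Rightarrow> real" where
  "kerr_v m r c = ln (kerr_A m r c) - ln (kerr_S m r c) - 2 * ln r"
definition kerr_vr :: "real \<Rightarrow> real \<Rightarrow> real \<Rightarrow> real" where
  "kerr_vr m r c = kerr_Ar m r c / kerr_A m r c - 2 * (r + m) / kerr_S m r c - 2 / r"
definition kerr_vc :: "real \<Rightarrow> real \<Rightarrow> real \<Rightarrow> real" where
  "kerr_vc m r c = kerr_Ac m r c / kerr_A m r c - 2 * m\<^sup>2 * c / kerr_S m r c"
definition kerr_X :: "real \<Rightarrow> real \<Rightarrow> real \<Rightarrow> real" where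
  "kerr_X m r c = (1 - c\<^sup>2) * kerr_A m r c / kerr_S m r c"
definition kerr_Y :: "real \<Rightarrow> real \<Rightarrow> real \<Rightarrow> real \<Rightarrow> real" where
  "kerr_Y J m r c = 2 * J * (c ^ 3 - 3 * c) - 2 * J * m\<^sup>2 * c * (1 - c\<^sup>2)\<^sup>2 / kerr_S m r c"

text \<open>\<open>kerr_wr = Y\<^sub>r / X\<^sup>2\<close> and \<open>kerr_wc = Y\<^sub>c / X\<^sup>2\<close>, the divergence-free twist current.\<close>
definition kerr_wr :: "real \<Rightarrow> real \<Rightarrow> real \<Rightarrow> real \<Rightarrow> real" where
  "kerr_wr J m r c = 4 * J * m\<^sup>2 * c * (r + m) / (kerr_A m r c)\<^sup>2"
definition kerr_wc :: "real \<Rightarrow> real \<Rightarrow> real \<Rightarrow> real \<Rightarrow> real" where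
  "kerr_wc J m r c = - 2 * J * kerr_T m r c / ((1 - c\<^sup>2) * (kerr_A m r c)\<^sup>2)"

lemma C1_kerr_v:
  assumes "0 < m" shows "C1_polar (kerr_v m) (kerr_vr m) (kerr_vc m)"
  unfolding kerr_v_def[abs_def]
  by (rule C1_polar_cong, (rule C1_polar_intros C1_polar_ln C1_kerr_A C1_kerr_S
        | simp add: kerr_A_pos kerr_S_pos assms)+)
     (auto simp: kerr_vr_def kerr_vc_def divide_inverse)

lemma kerr_A_nz: "0 < m \<Longrightarrow> 0 < r \<Longrightarrow> \<bar>c\<bar> < 1 \<Longrightarrow> kerr_A m r c \<noteq> 0"
  using kerr_A_pos[of m r c] by simp

lemma kerr_S_nz: "0 < m \<Longrightarrow> 0 < r \<Longrightarrow> kerr_S m r c \<noteq> 0"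
  using kerr_S_pos[of m r c] by simp

text \<open>The derivatives are stated with the factor X^2 pulled out, so that the current X^-2
  \<partial>Y of the second field equation can be read off.\<close>

lemma C1_kerr_Y:
  assumes "0 < m"
  shows "C1_polar (kerr_Y J m) (\<lambda>r c. (kerr_X m r c)\<^sup>2 * kerr_wr J m r c)
    (\<lambda>r c. (kerr_X m r c)\<^sup>2 * kerr_wc J m r c)"
  unfolding kerr_Y_def[abs_def]
proof (rule C1_polar_cong, (rule C1_polar_intros C1_kerr_S | simp add: kerr_S_nz assms)+, goal_cases)
  case (1 r c)
  have nz: "kerr_A m r c \<noteq> 0" "kerr_S m r c \<noteq> 0" using 1 kerr_A_nz kerr_S_nz assms by auto
  show ?case using nz by (simp add: kerr_X_def kerr_wr_def field_simps eval_nat_numeral)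
next
  case (2 r c)
  have nz: "kerr_A m r c \<noteq> 0" "kerr_S m r c \<noteq> 0" using 2 kerr_A_nz kerr_S_nz assms by auto
  have c: "1 - c\<^sup>2 \<noteq> 0" using 2 abs_square_less_1[of c] by auto
  have "(kerr_X m r c)\<^sup>2 * kerr_wc J m r c = - 2 * J * (1 - c\<^sup>2) * kerr_T m r c / (kerr_S m r c)\<^sup>2"
    using nz c by (simp add: kerr_X_def kerr_wc_def field_simps eval_nat_numeral)
  then show ?case using nz c
    by (simp only:) (simp add: kerr_T_def field_simps eval_nat_numeral)
qed

lemma kerr_wr_partial:
  assumes "0 < m"
  shows "\<exists>wrc. C1_polar (kerr_wr J m)
    (\<lambda>r c. 4 * J * m\<^sup>2 * c / (kerr_A m r c)\<^sup>2
       - 8 * J * m\<^sup>2 * c * (r + m) * kerr_Ar m r c / (kerr_A m r c) ^ 3) wrc"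
  unfolding kerr_wr_def[abs_def]
proof (rule C1_polar_fst_partial, (rule C1_polar_intros C1_kerr_A | simp add: kerr_A_nz assms)+, goal_cases)
  case (1 r c)
  then show ?case using kerr_A_nz[OF assms] by (simp add: field_simps eval_nat_numeral)
qed

lemma kerr_wc_partial:
  assumes "0 < m"
  defines "Tc \<equiv> \<lambda>r c. 6 * kerr_S m r c * (2 * m\<^sup>2 * c) + m\<^sup>2 * (2 * m\<^sup>2 * c) * (1 - 5 * c\<^sup>2)
        - 10 * m\<^sup>2 * c * kerr_S m r c - 2 * m ^ 4 * (2 * c - 4 * c ^ 3)"
  shows "\<exists>wcr. C1_polar (kerr_wc J m) wcr
    (\<lambda>r c. - 2 * J * (Tc r c / ((1 - c\<^sup>2) * (kerr_A m r c)\<^sup>2)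
        + 2 * c * kerr_T m r c / ((1 - c\<^sup>2)\<^sup>2 * (kerr_A m r c)\<^sup>2)
        - 2 * kerr_T m r c * kerr_Ac m r c / ((1 - c\<^sup>2) * (kerr_A m r c) ^ 3)))"
proof -
  obtain Tr where T: "C1_polar (kerr_T m) Tr Tc" using C1_kerr_T[of m] unfolding Tc_def by blast
  have c: "c\<^sup>2 \<noteq> 1" if "\<bar>c\<bar> < 1" for c :: real using that abs_square_less_1[of c] by auto
  show ?thesis
    unfolding kerr_wc_def[abs_def]
  proof (rule C1_polar_snd_partial, (rule C1_polar_intros C1_kerr_A T | simp add: kerr_A_nz c assms(1))+, goal_cases)
    case (1 r x)
    define A d where "A = kerr_A m r x" and "d = 1 - x\<^sup>2"
    have "A \<noteq> 0" "d \<noteq> 0" using kerr_A_nz[OF assms(1) 1] c[OF 1(2)] by (auto simp: A_def d_def)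
    then show ?case
      unfolding A_def[symmetric] d_def[symmetric]
      by (simp add: divide_simps) (simp add: algebra_simps eval_nat_numeral)
  qed
qed

lemma kerr_vr_partial:
  assumes "0 < m"
  shows "\<exists>vrc. C1_polar (kerr_vr m)
    (\<lambda>r c. (12 * (r + m)\<^sup>2 + 4 * m\<^sup>2 - 2 * m\<^sup>2 * (1 - c\<^sup>2)) / kerr_A m r c - (kerr_Ar m r c)\<^sup>2 / (kerr_A m r c)\<^sup>2
      - 2 / kerr_S m r c + (2 * (r + m))\<^sup>2 / (kerr_S m r c)\<^sup>2 + 2 / r\<^sup>2) vrc"
  unfolding kerr_vr_def[abs_def]
proof (rule C1_polar_fst_partial,
    (rule C1_polar_intros C1_kerr_A C1_kerr_Ar C1_kerr_S | simp add: kerr_A_nz kerr_S_nz assms)+, goal_cases)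
  case (1 r c)
  then show ?case using kerr_A_nz[OF assms] kerr_S_nz[OF assms]
    by (simp add: divide_inverse power2_eq_square algebra_simps)
qed

lemma kerr_vc_partial:
  assumes "0 < m"
  shows "\<exists>vcr. C1_polar (kerr_vc m) vcr
    (\<lambda>r c. 2 * r\<^sup>2 * m\<^sup>2 / kerr_A m r c - (kerr_Ac m r c)\<^sup>2 / (kerr_A m r c)\<^sup>2
      - 2 * m\<^sup>2 / kerr_S m r c + (2 * m\<^sup>2 * c)\<^sup>2 / (kerr_S m r c)\<^sup>2)"
  unfolding kerr_vc_def[abs_def]
proof (rule C1_polar_snd_partial,
    (rule C1_polar_intros C1_kerr_A C1_kerr_Ac C1_kerr_S | simp add: kerr_A_nz kerr_S_nz assms)+, goal_cases)
  case (1 r c)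
  then show ?case using kerr_A_nz[OF assms] kerr_S_nz[OF assms]
    by (simp add: divide_inverse power2_eq_square algebra_simps)
qed

text \<open>After multiplication by r^2 A^2 S^2 this is \<open>kerr_laplace_identity\<close>. The
  relation J^2 = m^4, the extremality of the data, matches the size of the twist term to the left
  side.\<close>

lemma kerr_laplace:
  fixes m r c J :: real
  assumes m: "0 < m" "J\<^sup>2 = m ^ 4" and rc: "0 < r" "\<bar>c\<bar> < 1"
  defines "A \<equiv> kerr_A m r c" and "S \<equiv> kerr_S m r c" and "Ar \<equiv> kerr_Ar m r c" and "Ac \<equiv> kerr_Ac m r c"
  shows "((12 * (r + m)\<^sup>2 + 4 * m\<^sup>2 - 2 * m\<^sup>2 * (1 - c\<^sup>2)) / A - Ar\<^sup>2 / A\<^sup>2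
      - 2 / S + (2 * (r + m))\<^sup>2 / S\<^sup>2 + 2 / r\<^sup>2) + 2 * kerr_vr m r c / r
     + ((1 - c\<^sup>2) * (2 * r\<^sup>2 * m\<^sup>2 / A - Ac\<^sup>2 / A\<^sup>2 - 2 * m\<^sup>2 / S + (2 * m\<^sup>2 * c)\<^sup>2 / S\<^sup>2)
        - 2 * c * kerr_vc m r c) / r\<^sup>2
     = - ((kerr_X m r c)\<^sup>2 * ((kerr_wr J m r c)\<^sup>2 + (1 - c\<^sup>2) * (kerr_wc J m r c)\<^sup>2 / r\<^sup>2))"
    (is "?L = ?R")
proof -
  have nz: "A \<noteq> 0" "S \<noteq> 0" "r \<noteq> 0" "1 - c\<^sup>2 \<noteq> 0"
    using kerr_A_nz kerr_S_nz m rc abs_square_less_1[of c] by (auto simp: A_def S_def)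
  define Arr where "Arr = 12 * (r + m)\<^sup>2 + 4 * m\<^sup>2 - 2 * m\<^sup>2 * (1 - c\<^sup>2)"
  define d where "d = 1 - c\<^sup>2"
  define R where "R = r + m"
  define T where "T = kerr_T m r c"
  have "?L * (r\<^sup>2 * A\<^sup>2 * S\<^sup>2) = S\<^sup>2 * (r\<^sup>2 * (A * Arr - Ar\<^sup>2) + 2 * r * A * Ar
      + d * (A * (2 * r\<^sup>2 * m\<^sup>2) - Ac\<^sup>2) - 2 * c * A * Ac)
    - A\<^sup>2 * (r\<^sup>2 * (2 * S - (2 * R)\<^sup>2) + 2 * r * S * (2 * R)
      + d * (2 * m\<^sup>2 * S - (2 * m\<^sup>2 * c)\<^sup>2) - 2 * c * S * (2 * m\<^sup>2 * c))
    - 2 * A\<^sup>2 * S\<^sup>2"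
    unfolding kerr_vr_def kerr_vc_def A_def[symmetric] S_def[symmetric] Ar_def[symmetric] Ac_def[symmetric]
    unfolding Arr_def[symmetric] unfolding d_def[symmetric] R_def[symmetric]
    using nz by (simp add: divide_simps) (simp add: algebra_simps power2_eq_square)
  also have "\<dots> = - (4 * m ^ 4 * d * (4 * m ^ 4 * c\<^sup>2 * R\<^sup>2 * d * r\<^sup>2 + T\<^sup>2))"
    unfolding A_def S_def Ar_def Ac_def Arr_def d_def R_def T_def by (rule kerr_laplace_identity)
  also have "\<dots> = ?R * (r\<^sup>2 * A\<^sup>2 * S\<^sup>2)"
    unfolding kerr_wr_def kerr_wc_def kerr_X_def A_def[symmetric] S_def[symmetric] d_def[symmetric]
      R_def[symmetric] T_def[symmetric] m(2)[symmetric]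
    using nz unfolding d_def[symmetric]
    by (simp add: divide_simps, simp add: algebra_simps eval_nat_numeral,
        use m(2) in \<open>simp add: eval_nat_numeral\<close>)
  finally have "?L * (r\<^sup>2 * A\<^sup>2 * S\<^sup>2) = ?R * (r\<^sup>2 * A\<^sup>2 * S\<^sup>2)" .
  moreover have "r\<^sup>2 * A\<^sup>2 * S\<^sup>2 \<noteq> 0" using nz by simp
  ultimately show ?thesis using mult_right_cancel by blast
qed

lemma kerr_twist_div:
  fixes m r c J :: real
  assumes m: "0 < m" and rc: "0 < r" "\<bar>c\<bar> < 1"
  defines "A \<equiv> kerr_A m r c" and "S \<equiv> kerr_S m r c" and "T \<equiv> kerr_T m r c"
     and "Ar \<equiv> kerr_Ar m r c" and "Ac \<equiv> kerr_Ac m r c"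
  defines "Tc \<equiv> 6 * S * (2 * m\<^sup>2 * c) + m\<^sup>2 * (2 * m\<^sup>2 * c) * (1 - 5 * c\<^sup>2)
        - 10 * m\<^sup>2 * c * S - 2 * m ^ 4 * (2 * c - 4 * c ^ 3)"
  shows "(4 * J * m\<^sup>2 * c / A\<^sup>2 - 8 * J * m\<^sup>2 * c * (r + m) * Ar / A ^ 3)
    + 2 * kerr_wr J m r c / r
    + ((1 - c\<^sup>2) * (- 2 * J * (Tc / ((1 - c\<^sup>2) * A\<^sup>2) + 2 * c * T / ((1 - c\<^sup>2)\<^sup>2 * A\<^sup>2)
        - 2 * T * Ac / ((1 - c\<^sup>2) * A ^ 3))) - 2 * c * kerr_wc J m r c) / r\<^sup>2 = 0"
    (is "?L = 0")
proof -
  have nz: "A \<noteq> 0" "r \<noteq> 0" "1 - c\<^sup>2 \<noteq> 0"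
    using kerr_A_nz m rc abs_square_less_1[of c] by (auto simp: A_def)
  define d where "d = 1 - c\<^sup>2"
  define R where "R = r + m"
  have "?L * (r\<^sup>2 * A ^ 3) = J * (r\<^sup>2 * (4 * m\<^sup>2 * c * A - 8 * m\<^sup>2 * c * R * Ar) + 2 * r * (4 * m\<^sup>2 * c * R * A)
    - 2 * (A * Tc - 2 * T * Ac))"
    unfolding kerr_wr_def kerr_wc_def A_def[symmetric] T_def[symmetric] R_def[symmetric] d_def[symmetric]
    using nz unfolding d_def[symmetric]
    by (simp add: divide_simps) (simp add: algebra_simps eval_nat_numeral)
  also have "\<dots> = 0"
    unfolding Tc_def A_def T_def S_def Ar_def Ac_def R_def
    using kerr_twist_identity[of r m c] by (simp only: mult_zero_right)
  finally show ?thesis using nz by simp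
qed

section \<open>Decay of the Kerr gradients at both ends\<close>

lemma kerr_sizes:
  assumes "0 < m" "0 < r" "\<bar>c\<bar> < 1" and "R = r + m" "A = kerr_A m r c" "S = kerr_S m r c"
  shows "0 < R" "m \<le> R" "r \<le> R" "R ^ 4 \<le> A" "0 < A" "R\<^sup>2 \<le> S" "0 < S"
  using kerr_A_ge[of m r c] kerr_A_pos[of m r c] kerr_S_ge[of r m c] kerr_S_pos[of m r c] assms by auto

text \<open>The three terms are compared with 4/R, 2/R and 2/R, whose combination 4/R - 2/R - 2/R
  vanishes; the errors are O(m / (r R)) with constants 12, 2 and 2. The bound is of order 1 / r at
  the origin, which is the second end, and m / r^2 at infinity.\<close>

lemma kerr_vr_bound:
  assumes m: "0 < m" and r: "0 < r" and c: "\<bar>c\<bar> < 1"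
  shows "\<bar>kerr_vr m r c\<bar> \<le> 16 * m / (r * (r + m))"
proof -
  define R A S where "R = r + m" and "A = kerr_A m r c" and "S = kerr_S m r c"
  note R = kerr_sizes(1-3)[OF m r c R_def A_def S_def]
    and A = kerr_sizes(4,5)[OF m r c R_def A_def S_def]
    and S = kerr_sizes(6,7)[OF m r c R_def A_def S_def]
  have c2: "c\<^sup>2 \<le> 1" "0 \<le> 1 - c\<^sup>2" "1 - c\<^sup>2 \<le> 1" using c by (auto simp: abs_square_le_1)
  define N where "N = - 4 * R\<^sup>2 * m\<^sup>2 - 4 * m ^ 4 + m\<^sup>2 * (1 - c\<^sup>2) * (4 * r\<^sup>2 - 2 * r * R)"
  have e: "kerr_vr m r c = N / (A * R) + 2 * m\<^sup>2 * c\<^sup>2 / (S * R) - 2 * m / (r * R)"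
  proof -
    have 1: "kerr_Ar m r c / A - 4 / R = N / (A * R)"
    proof -
      have "R * kerr_Ar m r c - 4 * A = N" unfolding N_def A_def R_def kerr_Ar_def kerr_A_def by algebra
      then show ?thesis using A(2) R(1) by (simp add: field_simps)
    qed
    have 2: "2 * R / S - 2 / R = - (2 * m\<^sup>2 * c\<^sup>2 / (S * R)) + 0"
    proof -
      have "S = R\<^sup>2 + m\<^sup>2 * c\<^sup>2" by (simp add: S_def R_def kerr_S_def)
      then have "2 * R * R - 2 * S = - (2 * m\<^sup>2 * c\<^sup>2)" by algebra
      moreover have "2 * R / S - 2 / R = (2 * R * R - 2 * S) / (S * R)" using S(2) R(1) by (simp add: field_simps)
      ultimately show ?thesis by simp
    qed
    have 3: "2 / R - 2 / r = - (2 * m / (r * R))" using r R(1) by (simp add: R_def field_simps)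
    have "kerr_vr m r c = (kerr_Ar m r c / A - 4 / R) - (2 * R / S - 2 / R) + (2 / R - 2 / r)"
      by (simp add: kerr_vr_def A_def S_def R_def)
    then show ?thesis unfolding 1 2 3 by simp
  qed
  have N: "\<bar>N\<bar> \<le> 12 * (m\<^sup>2 * R\<^sup>2)"
  proof -
    have "m ^ 4 \<le> m\<^sup>2 * R\<^sup>2" using mult_mono[of "m\<^sup>2" "m\<^sup>2" "m\<^sup>2" "R\<^sup>2"] R m
      by (simp add: power_mono flip: power_add)
    moreover define t where "t = m\<^sup>2 * (1 - c\<^sup>2) * (4 * r\<^sup>2 - 2 * r * R)"
    have "\<bar>t\<bar> \<le> m\<^sup>2 * 1 * (4 * R\<^sup>2)"
      unfolding t_def abs_mult
    proof (intro mult_mono)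
      have "r\<^sup>2 \<le> R\<^sup>2" "r * R \<le> R\<^sup>2" "0 \<le> r * R" "0 \<le> r\<^sup>2"
        using R r by (auto simp: power_mono power2_eq_square mult_mono)
      then show "\<bar>4 * r\<^sup>2 - 2 * r * R\<bar> \<le> 4 * R\<^sup>2" by linarith
    qed (use c2 in auto)
    then have "\<bar>t\<bar> \<le> 4 * (m\<^sup>2 * R\<^sup>2)" by simp
    moreover have "0 \<le> m ^ 4" "0 \<le> m\<^sup>2 * R\<^sup>2" by auto
    moreover have "N = - 4 * (m\<^sup>2 * R\<^sup>2) - 4 * m ^ 4 + t" by (simp add: N_def t_def)
    ultimately show ?thesis by linarith
  qed
  have R3: "m * (r * R) \<le> R ^ 3"
    using R r m by (simp add: power3_eq_cube mult_mono mult.assoc)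
  have "\<bar>N / (A * R)\<bar> \<le> 12 * (m\<^sup>2 * R\<^sup>2) / (R ^ 4 * R)"
    unfolding abs_divide using N A R by (intro frac_le mult_mono) auto
  also have "\<dots> = 12 * m * (m * (r * R)) / (R ^ 3 * (r * R))"
    using R r by (simp add: field_simps eval_nat_numeral)
  also have "\<dots> \<le> 12 * m * R ^ 3 / (R ^ 3 * (r * R))"
    using R3 m R r by (intro divide_right_mono mult_left_mono) auto
  also have "\<dots> = 12 * m / (r * R)" using R r by simp
  finally have b1: "\<bar>N / (A * R)\<bar> \<le> 12 * m / (r * R)" .
  have "2 * m\<^sup>2 * c\<^sup>2 / (S * R) \<le> 2 * m\<^sup>2 * 1 / (R\<^sup>2 * R)"
    using S R c2 by (intro frac_le mult_mono) auto
  also have "\<dots> = 2 * m * (m * (r * R)) / (R ^ 3 * (r * R))"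
    using R r by (simp add: field_simps eval_nat_numeral)
  also have "\<dots> \<le> 2 * m * R ^ 3 / (R ^ 3 * (r * R))"
    using R3 m R r by (intro divide_right_mono mult_left_mono) auto
  also have "\<dots> = 2 * m / (r * R)" using R r by simp
  finally have b2: "2 * m\<^sup>2 * c\<^sup>2 / (S * R) \<le> 2 * m / (r * R)" .
  define u v K where "u = N / (A * R)" and "v = 2 * m\<^sup>2 * c\<^sup>2 / (S * R)" and "K = m / (r * R)"
  have "\<bar>u\<bar> \<le> 12 * K" "v \<le> 2 * K" "0 \<le> v" "0 \<le> K"
    using b1 b2 S R m r by (auto simp: u_def v_def K_def)
  moreover have "kerr_vr m r c = u + v - 2 * K" unfolding e by (simp add: u_def v_def K_def)
  ultimately have "\<bar>kerr_vr m r c\<bar> \<le> 16 * K" by linarith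
  then show ?thesis by (simp add: K_def R_def)
qed

text \<open>As |grad c| <= 1 / r, this controls the angular part of the gradient. Each of the two
  terms of \<open>kerr_vc\<close> is at most 2 m^2 / R^2.\<close>

lemma kerr_vc_bound:
  assumes m: "0 < m" and r: "0 < r" and c: "\<bar>c\<bar> < 1"
  shows "\<bar>kerr_vc m r c\<bar> / r \<le> 4 * m / (r * (r + m))"
proof -
  define R A S where "R = r + m" and "A = kerr_A m r c" and "S = kerr_S m r c"
  note R = kerr_sizes(1-3)[OF m r c R_def A_def S_def]
    and A = kerr_sizes(4,5)[OF m r c R_def A_def S_def]
    and S = kerr_sizes(6,7)[OF m r c R_def A_def S_def]
  have "\<bar>2 * r\<^sup>2 * m\<^sup>2 * c / A\<bar> \<le> 2 * R\<^sup>2 * m\<^sup>2 * 1 / R ^ 4"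
    unfolding abs_divide abs_mult using A R c r by (intro frac_le mult_mono power_mono) auto
  also have "\<dots> = 2 * (m\<^sup>2 / R\<^sup>2)" using R by (simp add: field_simps eval_nat_numeral)
  finally have 1: "\<bar>2 * r\<^sup>2 * m\<^sup>2 * c / A\<bar> \<le> 2 * (m\<^sup>2 / R\<^sup>2)" .
  have "\<bar>2 * m\<^sup>2 * c / S\<bar> \<le> 2 * m\<^sup>2 * 1 / R\<^sup>2"
    unfolding abs_divide abs_mult using S R c by (intro frac_le mult_mono) auto
  then have 2: "\<bar>2 * m\<^sup>2 * c / S\<bar> \<le> 2 * (m\<^sup>2 / R\<^sup>2)" by simp
  have "\<bar>kerr_vc m r c\<bar> \<le> 4 * (m\<^sup>2 / R\<^sup>2)"
    using order_trans[OF abs_triangle_ineq4 add_mono[OF 1 2]]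
    by (simp add: kerr_vc_def kerr_Ac_def flip: A_def S_def)
  also have "\<dots> = 4 * m * m / R\<^sup>2" by (simp add: power2_eq_square)
  also have "\<dots> \<le> 4 * m * R / R\<^sup>2" using R m by (intro divide_right_mono mult_left_mono) auto
  also have "\<dots> = 4 * m / R" using R by (simp add: power2_eq_square)
  finally have "\<bar>kerr_vc m r c\<bar> / r \<le> 4 * m / R / r" using r by (intro divide_right_mono) auto
  then show ?thesis by (simp add: R_def mult.commute)
qed

text \<open>The left side dominates |\<partial>Y| / X, the twist measured in an orthonormal frame.
  The factor 1 - c^2 in X cancels the pole of \<open>kerr_wc\<close> on the axis. The constant is 4
  from the radial and 24 from the angular part.\<close>

lemma kerr_w_bound:
  assumes m: "0 < m" and J: "\<bar>J\<bar> = m\<^sup>2" and r: "0 < r" and c: "\<bar>c\<bar> < 1"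
  shows "kerr_X m r c * (\<bar>kerr_wr J m r c\<bar> + \<bar>kerr_wc J m r c\<bar> / r) \<le> 28 * m / (r * (r + m))"
proof -
  define R A S T where "R = r + m" and "A = kerr_A m r c" and "S = kerr_S m r c" and "T = kerr_T m r c"
  note R = kerr_sizes(1-3)[OF m r c R_def A_def S_def]
    and A = kerr_sizes(4,5)[OF m r c R_def A_def S_def]
    and S = kerr_sizes(6,7)[OF m r c R_def A_def S_def]
  have c2: "c\<^sup>2 < 1" "0 < 1 - c\<^sup>2" "1 - c\<^sup>2 \<le> 1" using c by (auto simp: abs_square_less_1)
  have mR: "m\<^sup>2 \<le> R\<^sup>2" using m R by (simp add: power_mono)
  have S2: "S \<le> 2 * R\<^sup>2"
  proof -
    have "m\<^sup>2 * c\<^sup>2 \<le> m\<^sup>2 * 1" using c2 by (intro mult_left_mono) auto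
    then show ?thesis using mR by (simp add: S_def kerr_S_def R_def)
  qed
  have X0: "kerr_X m r c \<ge> 0" using A S c2 by (simp add: kerr_X_def A_def[symmetric] S_def[symmetric])
  have "kerr_X m r c * \<bar>kerr_wr J m r c\<bar> = 4 * m\<^sup>2 * m\<^sup>2 * (\<bar>c\<bar> * (1 - c\<^sup>2)) * R / (S * A)"
    unfolding kerr_X_def kerr_wr_def A_def[symmetric] S_def[symmetric] R_def[symmetric] abs_mult abs_divide J
    using A S R by (simp add: field_simps power2_eq_square)
  also have "\<dots> \<le> 4 * m\<^sup>2 * m\<^sup>2 * (1 * 1) * R / (R\<^sup>2 * R ^ 4)"
    using A S R c2 c by (intro frac_le mult_mono mult_nonneg_nonneg) auto
  also have "\<dots> = 4 * m * (m * m * m * r) / (R ^ 4 * (r * R))"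
    using R r by (simp add: field_simps eval_nat_numeral)
  also have "\<dots> \<le> 4 * m * (R * R * R * R) / (R ^ 4 * (r * R))"
    using R m r by (intro divide_right_mono mult_mono mult_left_mono mult_nonneg_nonneg) auto
  also have "\<dots> = 4 * m / (r * R)" using R by (simp add: field_simps eval_nat_numeral)
  finally have 1: "kerr_X m r c * \<bar>kerr_wr J m r c\<bar> \<le> 4 * m / (r * R)" .
  have T: "\<bar>T\<bar> \<le> 12 * (S * R\<^sup>2)"
  proof -
    have "\<bar>1 - 5 * c\<^sup>2\<bar> \<le> 4" using c2(1) zero_le_power2[of c] by linarith
    then have "\<bar>m\<^sup>2 * S * (1 - 5 * c\<^sup>2)\<bar> \<le> R\<^sup>2 * S * 4"
      unfolding abs_mult using S c2 mR by (intro mult_mono) auto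
    then have "\<bar>m\<^sup>2 * S * (1 - 5 * c\<^sup>2)\<bar> \<le> 4 * (S * R\<^sup>2)" by (simp add: mult_ac)
    moreover have "\<bar>2 * m ^ 4 * c\<^sup>2 * (1 - c\<^sup>2)\<bar> \<le> 2 * (S * R\<^sup>2) * 1 * 1"
    proof -
      have "m ^ 4 = m\<^sup>2 * m\<^sup>2" by (simp flip: power_add)
      also have "\<dots> \<le> S * R\<^sup>2" using S mR by (intro mult_mono) auto
      finally show ?thesis unfolding abs_mult using c2 S by (intro mult_mono) auto
    qed
    moreover have "\<bar>3 * S\<^sup>2\<bar> \<le> 6 * (S * R\<^sup>2)"
      using mult_left_mono[OF S2, of S] S by (simp add: power2_eq_square)
    ultimately show ?thesis unfolding T_def kerr_T_def S_def[symmetric] by linarith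
  qed
  have "kerr_X m r c * \<bar>kerr_wc J m r c\<bar> = 2 * m\<^sup>2 * \<bar>T\<bar> / (S * A)"
    unfolding kerr_X_def kerr_wc_def A_def[symmetric] S_def[symmetric] T_def[symmetric] abs_mult abs_divide
    using A S c2 J by (simp add: field_simps power2_eq_square)
  also have "\<dots> \<le> 2 * m\<^sup>2 * (12 * (S * R\<^sup>2)) / (S * R ^ 4)"
    using A S R T by (intro frac_le mult_mono) auto
  also have "\<dots> = 24 * m * m / R\<^sup>2" using S R by (simp add: field_simps eval_nat_numeral)
  also have "\<dots> \<le> 24 * m * R / R\<^sup>2" using R m by (intro divide_right_mono mult_left_mono) auto
  also have "\<dots> = 24 * m / R" using R by (simp add: power2_eq_square)
  finally have "kerr_X m r c * \<bar>kerr_wc J m r c\<bar> / r \<le> 24 * m / R / r"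
    using r by (intro divide_right_mono) auto
  then have "kerr_X m r c * \<bar>kerr_wc J m r c\<bar> / r \<le> 24 * m / (r * R)" by (simp add: mult.commute)
  from add_mono[OF 1 this]
  have "kerr_X m r c * (\<bar>kerr_wr J m r c\<bar> + \<bar>kerr_wc J m r c\<bar> / r) \<le> 4 * m / (r * R) + 24 * m / (r * R)"
    unfolding distrib_left times_divide_eq_right .
  then show ?thesis unfolding R_def by (simp flip: add_divide_distrib)
qed

section \<open>The given data in the variables r and c\<close>

lemma cyl_rho_sq: "(cyl_rho x)\<^sup>2 = (x $ 1)\<^sup>2 + (x $ 2)\<^sup>2"
  by (simp add: cyl_rho_def)

lemma rad_eq_norm: "rad x = norm x"
proof -
  have "(cyl_rho x)\<^sup>2 + (cyl_z x)\<^sup>2 = (norm x)\<^sup>2" by (simp add: norm_sq_3 cyl_rho_sq cyl_z_def)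
  then show ?thesis unfolding rad_def by simp
qed

lemma cyl_rho_pos: "x \<in> off_axis \<Longrightarrow> 0 < cyl_rho x"
  by (auto simp: cyl_rho_def off_axis_def sum_power2_gt_zero_iff)

lemma off_axis_trig:
  assumes "x \<in> off_axis"
  shows "cos_th x = x $ 3 / norm x" "(sin_th x)\<^sup>2 = 1 - (x $ 3 / norm x)\<^sup>2"
    "(cyl_rho x)\<^sup>2 = (norm x)\<^sup>2 * (1 - (x $ 3 / norm x)\<^sup>2)"
proof -
  have n: "norm x \<noteq> 0" using off_axis_polar(1)[OF assms] by simp
  show "cos_th x = x $ 3 / norm x" by (simp add: cos_th_def rad_eq_norm cyl_z_def)
  have "(cyl_rho x)\<^sup>2 = (norm x)\<^sup>2 - (x $ 3)\<^sup>2" by (simp add: cyl_rho_sq norm_sq_3)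
  then show "(cyl_rho x)\<^sup>2 = (norm x)\<^sup>2 * (1 - (x $ 3 / norm x)\<^sup>2)"
    using n by (simp add: power_divide right_diff_distrib)
  then show "(sin_th x)\<^sup>2 = 1 - (x $ 3 / norm x)\<^sup>2"
    using n by (simp add: sin_th_def rad_eq_norm power_divide)
qed

lemma m0_pos: "J \<noteq> 0 \<Longrightarrow> 0 < m0 J" and m0_sq: "(m0 J)\<^sup>2 = \<bar>J\<bar>" and m0_4: "J\<^sup>2 = m0 J ^ 4"
proof -
  show "(m0 J)\<^sup>2 = \<bar>J\<bar>" by (simp add: m0_def)
  then have "((m0 J)\<^sup>2)\<^sup>2 = J\<^sup>2" by simp
  then show "J\<^sup>2 = m0 J ^ 4" by (simp flip: power_mult)
qed (simp add: m0_def)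

text \<open>Adding the two terms of X over the denominator \<Sigma> produces the usual Kerr
  expression (R^2 + a^2)^2 - \<Delta> a^2 sin^2 \<theta>, here with a = m and \<Delta> = (R - m)^2 =
  r^2; this is \<open>kerr_A\<close>.\<close>

lemma X0_eq:
  assumes J: "J \<noteq> 0" and x: "x \<in> off_axis"
  shows "X0 J x = kerr_X (m0 J) (norm x) (x $ 3 / norm x)"
proof -
  define m r c where "m = m0 J" and "r = norm x" and "c = x $ 3 / r"
  have m: "0 < m" using m0_pos[OF J] by (simp add: m_def)
  have r: "0 < r" using off_axis_polar(1)[OF x] by (simp add: r_def)
  define S where "S = kerr_S m r c"
  have S: "S > 0" using kerr_S_pos[OF m r] by (simp add: S_def)
  have KS: "Kerr_Sigma J x = S"
    by (simp add: Kerr_Sigma_def BL_R_def rad_eq_norm off_axis_trig[OF x] S_def kerr_S_def m_def r_def c_def)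
  have "((r + m)\<^sup>2 + m\<^sup>2) * S + 2 * m ^ 3 * (r + m) * (1 - c\<^sup>2) = kerr_A m r c"
    unfolding S_def kerr_A_def kerr_S_def by algebra
  then have "(r + m)\<^sup>2 + m\<^sup>2 + 2 * m ^ 3 * (r + m) * (1 - c\<^sup>2) / S = kerr_A m r c / S"
    using S by (simp add: field_simps)
  then show ?thesis
    unfolding X0_def KS off_axis_trig[OF x] BL_R_def rad_eq_norm kerr_X_def
    by (simp add: m_def r_def c_def S_def)
qed

text \<open>A exceeds (r + m)^2 S by a sum of nonnegative terms. The bound X >= \<rho>^2 is what
  later makes y / X at most |y| / \<rho>^2, and positivity lets the logarithm of X be used off the
  axis.\<close>

lemma kerr_X_ge:
  assumes "0 < m" "0 < r" "\<bar>c\<bar> < 1" shows "r\<^sup>2 * (1 - c\<^sup>2) \<le> kerr_X m r c" "0 < kerr_X m r c"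
proof -
  have c: "0 < 1 - c\<^sup>2" using assms(3) by (auto simp: abs_square_less_1)
  have S: "0 < kerr_S m r c" using kerr_S_pos assms by auto
  have "r\<^sup>2 * kerr_S m r c \<le> kerr_A m r c"
  proof -
    have "r\<^sup>2 * kerr_S m r c \<le> (r + m)\<^sup>2 * kerr_S m r c"
      using assms S by (intro mult_right_mono power_mono) auto
    also have "\<dots> = (r + m) ^ 4 + (r + m)\<^sup>2 * m\<^sup>2 * c\<^sup>2" unfolding kerr_S_def by algebra
    also have "\<dots> \<le> (r + m) ^ 4 + (r + m)\<^sup>2 * m\<^sup>2 * c\<^sup>2 + (2 * r * m + m\<^sup>2) * m\<^sup>2 * (1 - c\<^sup>2) + (r + m)\<^sup>2 * m\<^sup>2 + m ^ 4"
      using assms c by (auto intro!: add_increasing2 mult_nonneg_nonneg add_nonneg_nonneg)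
    also have "\<dots> = kerr_A m r c" unfolding kerr_A_def by algebra
    finally show ?thesis .
  qed
  then have "r\<^sup>2 \<le> kerr_A m r c / kerr_S m r c" using S by (simp add: field_simps)
  from mult_right_mono[OF this, of "1 - c\<^sup>2"] c show "r\<^sup>2 * (1 - c\<^sup>2) \<le> kerr_X m r c"
    by (simp add: kerr_X_def field_simps)
  moreover have "0 < r\<^sup>2 * (1 - c\<^sup>2)" using assms c by auto
  ultimately show "0 < kerr_X m r c" by linarith
qed

lemma X0_ge:
  assumes "J \<noteq> 0" "x \<in> off_axis" shows "(cyl_rho x)\<^sup>2 \<le> X0 J x" "0 < X0 J x"
  using kerr_X_ge[OF m0_pos off_axis_polar] assms by (auto simp: X0_eq off_axis_trig)

lemma exp_v0:
  assumes "J \<noteq> 0" "x \<in> off_axis" shows "exp (v0 J x) = X0 J x / (cyl_rho x)\<^sup>2"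
  unfolding v0_def using X0_ge[OF assms] cyl_rho_pos[OF assms(2)] by (subst exp_ln) auto

lemma v0_eq:
  assumes J: "J \<noteq> 0" and x: "x \<in> off_axis"
  shows "v0 J x = kerr_v (m0 J) (norm x) (x $ 3 / norm x)"
proof -
  define m r c where "m = m0 J" and "r = norm x" and "c = x $ 3 / r"
  have m: "0 < m" using m0_pos[OF J] by (simp add: m_def)
  have r: "0 < r" "\<bar>c\<bar> < 1" using off_axis_polar[OF x] by (simp_all add: r_def c_def)
  have c: "0 < 1 - c\<^sup>2" using r(2) by (auto simp: abs_square_less_1)
  have A: "0 < kerr_A m r c" "0 < kerr_S m r c" using kerr_A_pos kerr_S_pos m r by auto
  have "X0 J x / (cyl_rho x)\<^sup>2 = kerr_A m r c / kerr_S m r c / r\<^sup>2"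
    unfolding X0_eq[OF J x] off_axis_trig(3)[OF x] kerr_X_def using c r A
    by (simp flip: m_def r_def c_def)
  then show ?thesis
    unfolding v0_def using A r by (simp add: kerr_v_def ln_div ln_mult ln_realpow flip: m_def r_def c_def)
qed

lemma Y0_eq:
  assumes x: "x \<in> off_axis"
  shows "Y0 J x = kerr_Y J (m0 J) (norm x) (x $ 3 / norm x)"
proof -
  have "(sin_th x) ^ 4 = ((sin_th x)\<^sup>2)\<^sup>2" by simp
  then show ?thesis
    by (simp add: Y0_def kerr_Y_def Kerr_Sigma_def kerr_S_def BL_R_def rad_eq_norm off_axis_trig[OF x])
qed

section \<open>The gradient fields of the data and their divergences\<close>

definition grad_v0 :: "real \<Rightarrow> real^3 \<Rightarrow> real^3" where
  "grad_v0 J = polar_field (kerr_vr (m0 J)) (kerr_vc (m0 J))"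
definition twist_field :: "real \<Rightarrow> real^3 \<Rightarrow> real^3" where
  "twist_field J = polar_field (kerr_wr J (m0 J)) (kerr_wc J (m0 J))"
text \<open>Obtained from ln \<rho> = ln r + ln (1 - c^2) / 2; in this form one divergence formula
  serves all three fields.\<close>

definition grad_ln_rho :: "real^3 \<Rightarrow> real^3" where
  "grad_ln_rho = polar_field (\<lambda>r c. 1 / r) (\<lambda>r c. - c / (1 - c\<^sup>2))"

lemma GDERIV_transform_off_axis:
  assumes "GDERIV f x :> D" "x \<in> off_axis" "\<And>y. y \<in> off_axis \<Longrightarrow> f y = g y"
  shows "GDERIV g x :> D"
  using has_derivative_transform_within_open[OF assms(1)[unfolded gderiv_def] open_off_axis assms(2)] assms(3)
  by (simp add: gderiv_def)

lemma v0_GDERIV: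
  assumes "J \<noteq> 0" "x \<in> off_axis" shows "GDERIV (v0 J) x :> grad_v0 J x"
proof (rule GDERIV_transform_off_axis[OF _ assms(2)])
  show "GDERIV (\<lambda>x. kerr_v (m0 J) (norm x) (x $ 3 / norm x)) x :> grad_v0 J x"
    unfolding grad_v0_def polar_field_def
    by (rule C1_polar_GDERIV[OF C1_kerr_v[OF m0_pos[OF assms(1)]] assms(2)])
qed (simp add: v0_eq assms(1))

lemma Y0_GDERIV:
  assumes "J \<noteq> 0" "x \<in> off_axis" shows "GDERIV (Y0 J) x :> (X0 J x)\<^sup>2 *\<^sub>R twist_field J x"
proof (rule GDERIV_transform_off_axis[OF _ assms(2)])
  show "GDERIV (\<lambda>x. kerr_Y J (m0 J) (norm x) (x $ 3 / norm x)) x :> (X0 J x)\<^sup>2 *\<^sub>R twist_field J x"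
    by (rule GDERIV_subst[OF C1_polar_GDERIV[OF C1_kerr_Y[OF m0_pos[OF assms(1)]] assms(2)]])
       (simp add: twist_field_def polar_field_def X0_eq assms scaleR_add_right)
qed (simp add: Y0_eq)

lemma cos_grad_inner:
  assumes "x \<noteq> 0"
  shows "x \<bullet> cos_grad x = 0" "cos_grad x \<bullet> cos_grad x = (1 - (x $ 3 / norm x)\<^sup>2) / (norm x)\<^sup>2"
proof -
  have n: "norm x \<noteq> 0" using assms by simp
  have xx: "x \<bullet> x = (norm x)\<^sup>2" by (simp add: power2_norm_eq_inner)
  have a: "x \<bullet> axis 3 1 = x $ 3" "axis 3 1 \<bullet> x = x $ 3" "axis 3 (1::real) \<bullet> (axis 3 1 :: real^3) = 1"
    by (simp_all add: inner_axis inner_axis')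
  show "x \<bullet> cos_grad x = 0"
    using n by (simp add: cos_grad_def inner_diff_right a xx field_simps eval_nat_numeral)
  then have "cos_grad x \<bullet> cos_grad x = (1 / norm x) * (axis 3 1 \<bullet> cos_grad x)"
    by (subst (1) cos_grad_def) (simp add: inner_diff_left)
  then show "cos_grad x \<bullet> cos_grad x = (1 - (x $ 3 / norm x)\<^sup>2) / (norm x)\<^sup>2"
    using n by (simp add: cos_grad_def inner_diff_right a field_simps eval_nat_numeral)
qed

text \<open>The gradients of r and c are orthogonal, of lengths 1 and sqrt (1 - c^2) / r.\<close>

lemma polar_field_norm:
  assumes "x \<in> off_axis" and r_def: "r = norm x" and c_def': "c = x $ 3 / norm x"
  shows "(norm (polar_field P Q x))\<^sup>2 = (P r c)\<^sup>2 + (1 - c\<^sup>2) * (Q r c)\<^sup>2 / r\<^sup>2"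
    and "norm (polar_field P Q x) \<le> \<bar>P r c\<bar> + \<bar>Q r c\<bar> / r"
proof -
  have c_def: "c = x $ 3 / r" by (simp add: r_def c_def')
  have r: "0 < r" "\<bar>c\<bar> < 1" using off_axis_polar[OF assms(1)] by (auto simp: r_def c_def)
  have nz: "x \<noteq> 0" using r by (auto simp: r_def)
  have xx: "x \<bullet> x = r\<^sup>2" by (simp add: power2_norm_eq_inner r_def)
  show *: "(norm (polar_field P Q x))\<^sup>2 = (P r c)\<^sup>2 + (1 - c\<^sup>2) * (Q r c)\<^sup>2 / r\<^sup>2"
    unfolding power2_norm_eq_inner polar_field_def
    using r(1) cos_grad_inner[OF nz]
    by (simp add: inner_add_left inner_add_right inner_commute[of "cos_grad x" x] xx flip: r_def c_def)
       (simp add: field_simps power2_eq_square)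
  have "(1 - c\<^sup>2) * (Q r c)\<^sup>2 / r\<^sup>2 \<le> 1 * (Q r c)\<^sup>2 / r\<^sup>2"
    by (intro divide_right_mono mult_right_mono) auto
  then have "(norm (polar_field P Q x))\<^sup>2 \<le> (\<bar>P r c\<bar> + \<bar>Q r c\<bar> / r)\<^sup>2"
    unfolding * using r(1) by (simp add: power2_sum power_divide add_increasing2)
  then show "norm (polar_field P Q x) \<le> \<bar>P r c\<bar> + \<bar>Q r c\<bar> / r"
    using r(1) by (rule_tac power2_le_imp_le) auto
qed

lemma grad_v0_bound:
  assumes "J \<noteq> 0" "x \<in> off_axis"
  shows "norm (grad_v0 J x) \<le> 20 * m0 J / (norm x * (norm x + m0 J))"
  using polar_field_norm(2)[OF assms(2) refl refl, of "kerr_vr (m0 J)" "kerr_vc (m0 J)"]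
    kerr_vr_bound[OF m0_pos[OF assms(1)] off_axis_polar[OF assms(2)]]
    kerr_vc_bound[OF m0_pos[OF assms(1)] off_axis_polar[OF assms(2)]]
  by (simp add: grad_v0_def)

lemma twist_field_bound:
  assumes "J \<noteq> 0" "x \<in> off_axis"
  shows "X0 J x * norm (twist_field J x) \<le> 28 * m0 J / (norm x * (norm x + m0 J))"
proof -
  have "X0 J x * norm (twist_field J x) \<le> X0 J x * (\<bar>kerr_wr J (m0 J) (norm x) (x $ 3 / norm x)\<bar>
      + \<bar>kerr_wc J (m0 J) (norm x) (x $ 3 / norm x)\<bar> / norm x)"
    unfolding twist_field_def
    by (rule mult_left_mono[OF polar_field_norm(2)[OF assms(2) refl refl]]) (use X0_ge[OF assms] in auto)
  also have "\<dots> \<le> 28 * m0 J / (norm x * (norm x + m0 J))"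
    unfolding X0_eq[OF assms]
    by (rule kerr_w_bound[OF m0_pos[OF assms(1)] m0_sq[symmetric] off_axis_polar[OF assms(2)]])
  finally show ?thesis .
qed

lemma grad_ln_rho_eq:
  assumes "x \<in> off_axis"
  shows "grad_ln_rho x = (1 / (cyl_rho x)\<^sup>2) *\<^sub>R vector [x $ 1, x $ 2, 0]"
proof -
  define r c where "r = norm x" and "c = x $ 3 / r"
  have r: "r > 0" "\<bar>c\<bar> < 1" using off_axis_polar[OF assms] by (auto simp: r_def c_def)
  have d: "1 - c\<^sup>2 > 0" using r(2) by (auto simp: abs_square_less_1)
  have x3: "x $ 3 = c * r" using r by (simp add: c_def)
  have rho: "(cyl_rho x)\<^sup>2 = r\<^sup>2 * (1 - c\<^sup>2)" using off_axis_trig(3)[OF assms] by (simp add: r_def c_def)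
  show ?thesis
    unfolding vec_eq_iff rho
  proof
    fix i :: 3
    consider "i = 1" | "i = 2" | "i = 3" using exhaust_3 by blast
    then show "grad_ln_rho x $ i = ((1 / (r\<^sup>2 * (1 - c\<^sup>2))) *\<^sub>R vector [x $ 1, x $ 2, 0]) $ i"
      by cases (use r d in \<open>simp_all add: grad_ln_rho_def polar_field_def cos_grad_def axis_def
         x3 field_simps eval_nat_numeral flip: r_def c_def\<close>)
  qed
qed

lemma continuous_polar_field:
  assumes "continuous_on polar_dom (\<lambda>p. P (fst p) (snd p))" "continuous_on polar_dom (\<lambda>p. Q (fst p) (snd p))"
  shows "continuous_on off_axis (polar_field P Q)"
proof -
  have n: "\<forall>x\<in>off_axis. norm x \<noteq> 0" "\<forall>x\<in>off_axis. norm x ^ 3 \<noteq> 0" using off_axis_polar(1) by force+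
  have "continuous_on off_axis cos_grad"
    unfolding cos_grad_def[abs_def] by (intro continuous_intros) (use n in auto)
  then show ?thesis
    unfolding polar_field_def[abs_def]
    by (intro continuous_on_add continuous_on_scaleR continuous_on_divide continuous_on_polar assms
          continuous_on_norm continuous_on_id n)
qed

text \<open>Packages what \<open>integral_divergence_eq_0\<close> asks of a vector field. The
  gradients of the components stay existential, since later arguments use only their trace.\<close>

definition div_on_off_axis :: "(real^3 \<Rightarrow> real^3) \<Rightarrow> (real^3 \<Rightarrow> real) \<Rightarrow> bool" where
  "div_on_off_axis W d \<longleftrightarrow> (\<exists>V. (\<forall>x\<in>off_axis. \<forall>i. GDERIV (\<lambda>x. W x $ i) x :> V i x) \<and>
     (\<forall>i. continuous_on off_axis (\<lambda>x. V i x $ i)) \<and> (\<forall>x\<in>off_axis. (\<Sum>i\<in>UNIV. V i x $ i) = d x))"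

lemma polar_field_div:
  assumes P: "C1_polar P Pr Pc" and Q: "C1_polar Q Qr Qc"
    and d: "\<And>x r c. x \<in> off_axis \<Longrightarrow> r = norm x \<Longrightarrow> c = x $ 3 / norm x \<Longrightarrow> 0 < r \<Longrightarrow> \<bar>c\<bar> < 1 \<Longrightarrow>
      Pr r c + 2 * P r c / r + ((1 - c\<^sup>2) * Qc r c - 2 * c * Q r c) / r\<^sup>2 = d x"
  shows "div_on_off_axis (polar_field P Q) d"
proof -
  show ?thesis
  proof (rule polar_field_GDERIV[OF P Q], goal_cases)
    case (1 V)
    have "(\<Sum>i\<in>UNIV. V i x $ i) = d x" if "x \<in> off_axis" for x
      using 1(3)[OF that] d[OF that refl refl off_axis_polar[OF that]] unfolding Let_def by (rule trans)
    then show ?case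
      unfolding div_on_off_axis_def using 1(1,2) by blast
  qed
qed

text \<open>The Euler-Lagrange equation of the mass with respect to v. Together with the
  conservation law for the twist it says that the data form a harmonic map.\<close>

lemma div_grad_v0:
  assumes "J \<noteq> 0"
  shows "div_on_off_axis (grad_v0 J) (\<lambda>x. - (X0 J x * norm (twist_field J x))\<^sup>2)"
proof -
  note m = m0_pos[OF assms]
  show ?thesis
    unfolding grad_v0_def
  proof (rule exE[OF kerr_vr_partial[OF m]], rule exE[OF kerr_vc_partial[OF m]], rule polar_field_div,
      assumption, assumption, goal_cases)
    case (1 vrc vcr x r c)
    then show ?case
      by (subst kerr_laplace[OF m m0_4])
         (auto simp: power_mult_distrib twist_field_def polar_field_norm(1)[OF _ refl refl] X0_eq assms)
  qed
qed

text \<open>The Euler-Lagrange equation with respect to Y: a conservation law, because the mass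
  depends on Y only through its derivatives.\<close>

lemma div_twist_field:
  assumes "J \<noteq> 0"
  shows "div_on_off_axis (twist_field J) (\<lambda>x. 0)"
proof -
  note m = m0_pos[OF assms]
  show ?thesis
    unfolding twist_field_def
    by (rule exE[OF kerr_wr_partial[OF m, of J]], rule exE[OF kerr_wc_partial[OF m, of J]],
        rule polar_field_div, assumption, assumption, rule kerr_twist_div[OF m])
qed

lemma C1_ln_rho:
  shows "C1_polar (\<lambda>r c. 1 / r) (\<lambda>r c. - 1 / r\<^sup>2) (\<lambda>r c. 0)"
    "C1_polar (\<lambda>r c. - c / (1 - c\<^sup>2)) (\<lambda>r c. 0) (\<lambda>r c. - (1 + c\<^sup>2) / (1 - c\<^sup>2)\<^sup>2)"
proof -
  have c: "c\<^sup>2 \<noteq> 1" if "\<bar>c\<bar> < 1" for c :: real using that abs_square_less_1[of c] by auto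
  show "C1_polar (\<lambda>r c. 1 / r) (\<lambda>r c. - 1 / r\<^sup>2) (\<lambda>r c. 0)"
    by (rule C1_polar_cong[OF C1_polar_divide[OF C1_polar_const C1_polar_r]]) (auto simp: divide_inverse)
  have "C1_polar (\<lambda>r c. (0 - c) / (1 - c\<^sup>2)) (\<lambda>r c. 0) (\<lambda>r c. - (1 + c\<^sup>2) / (1 - c\<^sup>2)\<^sup>2)"
  proof (rule C1_polar_cong, (rule C1_polar_intros | simp add: c)+, goal_cases)
    case (1 r c)
    define d where "d = 1 - c\<^sup>2"
    have "d \<noteq> 0" "d + c * c = 1" using c[OF 1(2)] by (auto simp: d_def power2_eq_square)
    then show ?case
      unfolding d_def[symmetric] by (simp add: field_simps eval_nat_numeral; algebra)
  qed
  then show "C1_polar (\<lambda>r c. - c / (1 - c\<^sup>2)) (\<lambda>r c. 0) (\<lambda>r c. - (1 + c\<^sup>2) / (1 - c\<^sup>2)\<^sup>2)" by simp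
qed

lemma div_grad_ln_rho: "div_on_off_axis grad_ln_rho (\<lambda>x. 0)"
  unfolding grad_ln_rho_def
proof (rule polar_field_div[OF C1_ln_rho])
  fix r c :: real assume "0 < r" "\<bar>c\<bar> < 1"
  moreover define d where "d = 1 - c\<^sup>2"
  ultimately have "r \<noteq> 0" "d \<noteq> 0" "c\<^sup>2 = 1 - d" using abs_square_less_1[of c] by auto
  then show "- 1 / r\<^sup>2 + 2 * (1 / r) / r + ((1 - c\<^sup>2) * (- (1 + c\<^sup>2) / (1 - c\<^sup>2)\<^sup>2) - 2 * c * (- c / (1 - c\<^sup>2))) / r\<^sup>2 = 0"
    unfolding d_def[symmetric] by (simp add: field_simps power2_eq_square) algebra
qed

lemma continuous_kerr_fields:
  assumes "J \<noteq> 0"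
  shows "continuous_on off_axis (grad_v0 J)" "continuous_on off_axis (twist_field J)"
    "continuous_on off_axis grad_ln_rho"
proof -
  note m = m0_pos[OF assms]
  show "continuous_on off_axis (grad_v0 J)"
    unfolding grad_v0_def using C1_polar_continuous[OF C1_kerr_v[OF m]]
    by (intro continuous_polar_field)
  show "continuous_on off_axis (twist_field J)"
    unfolding twist_field_def using kerr_wr_partial[OF m, of J] kerr_wc_partial[OF m, of J]
    by (auto intro!: continuous_polar_field dest: C1_polar_continuous)
  show "continuous_on off_axis grad_ln_rho"
    unfolding grad_ln_rho_def by (intro continuous_polar_field C1_ln_rho[THEN C1_polar_continuous(1)])
qed

section \<open>Integrable bounds\<close>

lemma prod_3: "prod f (UNIV :: 3 set) = f 1 * f 2 * (f 3 :: real)"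
  unfolding UNIV_3 by (simp add: ac_simps)

text \<open>The condition a < 1 takes care of 0 and a + b > 1 of infinity: the weight is dominated
  by t powr (-a) on [0, 1] and by t powr (-(a + b)) beyond 1, reflected for negative t.\<close>

lemma powr_weight_finite:
  fixes a b :: real
  assumes a: "0 \<le> a" "a < 1" and b: "0 \<le> b" "1 < a + b"
  shows "(\<integral>\<^sup>+t. ennreal (\<bar>t\<bar> powr (-a) * (1 + \<bar>t\<bar>) powr (-b)) \<partial>lborel) < \<infinity>"
proof -
  define h where "h t = \<bar>t\<bar> powr (-a) * (1 + \<bar>t\<bar>) powr (-b)" for t :: real
  define f where "f t = indicator {0..1} t * t powr (-a) + indicator {1..} t * t powr (-(a + b))" for t :: real
  have hm[measurable]: "h \<in> borel_measurable borel" unfolding h_def by measurable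
  have fm[measurable]: "f \<in> borel_measurable borel" unfolding f_def by measurable
  have f0: "0 \<le> f t" for t by (simp add: f_def)
  have 1: "(\<integral>\<^sup>+t. ennreal (indicator {0..1} t * t powr (-a)) \<partial>lborel) < \<infinity>"
    using nn_integral_has_integral_lebesgue[OF _ has_integral_powr_from_0[of "-a" 1]] a by simp
  have 2: "(\<integral>\<^sup>+t. ennreal (indicator {1..} t * t powr (-(a + b))) \<partial>lborel) < \<infinity>"
  proof -
    have "(\<integral>\<^sup>+t. ennreal (indicator {1..} t * t powr (-(a + b))) \<partial>lborel)
        = ennreal (- (1 powr (-(a + b) + 1)) / (-(a + b) + 1))"
      by (rule nn_integral_has_integral_lebesgue[OF _ has_integral_powr_to_inf]) (use b in auto)
    then show ?thesis by (simp only: ennreal_less_top infinity_ennreal_def)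
  qed
  have fin: "(\<integral>\<^sup>+t. ennreal (f t) \<partial>lborel) < \<infinity>"
    unfolding f_def using 1 2
    by (simp add: nn_integral_add ennreal_plus del: ennreal_plus[symmetric])
  have fin': "(\<integral>\<^sup>+t. ennreal (f (-t)) \<partial>lborel) < \<infinity>"
    using fin nn_integral_real_affine[of "\<lambda>t. ennreal (f t)" "-1" 0] by simp
  have hf: "h t \<le> f t" if "0 < t" for t
  proof (cases "t \<le> 1")
    case True
    have "(1 + t) powr (-b) \<le> (1 + t) powr 0" using that b by (intro powr_mono) auto
    then have "h t \<le> t powr (-a) * 1" unfolding h_def using that by (intro mult_mono) auto
    then show ?thesis using True that by (auto simp: f_def indicator_def)
  next
    case False
    have "(1 + t) powr (-b) \<le> t powr (-b)" using that b by (intro powr_mono2') auto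
    then have "h t \<le> t powr (-a) * t powr (-b)" unfolding h_def using that by (intro mult_mono) auto
    then show ?thesis using False that by (simp add: f_def indicator_def flip: powr_add)
  qed
  have "h t \<le> f t + f (-t)" if "t \<noteq> 0" for t
  proof (cases "t > 0")
    case True then show ?thesis using hf[of t] f0[of "-t"] by simp
  next
    case False then show ?thesis using hf[of "-t"] f0[of t] that by (simp add: h_def)
  qed
  then have "AE t in lborel. ennreal (h t) \<le> ennreal (f t) + ennreal (f (-t))"
    using AE_lborel_singleton[of 0] f0 by (auto simp: simp flip: ennreal_plus elim!: eventually_mono intro!: ennreal_leI)
  then have "(\<integral>\<^sup>+t. ennreal (h t) \<partial>lborel) \<le> (\<integral>\<^sup>+t. ennreal (f t) + ennreal (f (-t)) \<partial>lborel)"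
    by (rule nn_integral_mono_AE)
  also have "\<dots> = (\<integral>\<^sup>+t. ennreal (f t) \<partial>lborel) + (\<integral>\<^sup>+t. ennreal (f (-t)) \<partial>lborel)"
    by (rule nn_integral_add) auto
  also have "\<dots> < \<infinity>" using fin fin' by simp
  finally show ?thesis by (simp add: h_def)
qed

lemma powr_weight_prod_finite:
  fixes a b :: real
  assumes "0 \<le> a" "a < 1" "0 \<le> b" "1 < a + b"
  shows "(\<integral>\<^sup>+x. ennreal (\<Prod>i\<in>UNIV. \<bar>(x::real^'n) $ i\<bar> powr (-a) * (1 + \<bar>x $ i\<bar>) powr (-b)) \<partial>lborel) < \<infinity>"
proof -
  define h where "h t = \<bar>t\<bar> powr (-a) * (1 + \<bar>t\<bar>) powr (-b)" for t :: real
  have hm[measurable]: "h \<in> borel_measurable borel" unfolding h_def by measurable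
  have Basis: "Basis = (\<lambda>i. axis i 1 :: real^'n) ` UNIV" by (auto simp: Basis_vec_def)
  have inj: "inj (\<lambda>i. axis i 1 :: real^'n)" by (auto simp: inj_on_def axis_eq_axis)
  have "(\<integral>\<^sup>+x. ennreal (\<Prod>i\<in>UNIV. h ((x::real^'n) $ i)) \<partial>lborel)
     = (\<integral>\<^sup>+(x::real^'n). (\<Prod>b\<in>Basis. ennreal (h (x \<bullet> b))) \<partial>lborel)"
    unfolding Basis by (simp add: prod.reindex[OF inj] inner_axis prod_ennreal h_def)
  also have "\<dots> = (\<Prod>b\<in>(Basis::(real^'n) set). (\<integral>\<^sup>+t. ennreal (h t) \<partial>lborel))"
    by (rule nn_integral_lborel_prod[of "\<lambda>_ t. ennreal (h t)"]) auto
  also have "\<dots> < \<infinity>"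
    using powr_weight_finite[OF assms] by (simp add: h_def power_less_top_ennreal)
  finally show ?thesis by (simp add: h_def)
qed

lemma AE_components_nonzero: "AE x in lborel. \<forall>i. (x::real^'n) $ i \<noteq> 0"
proof -
  have "AE x in lborel. (x::real^'n) $ i \<noteq> 0" for i
  proof -
    have "closed {x::real^'n. x $ i = 0}" by (intro closed_Collect_eq continuous_intros)
    then have "{x::real^'n. x $ i = 0} \<in> sets lborel" by simp
    moreover have "negligible {x::real^'n. x $ i = 0}" by (rule negligible_standard_hyperplane_cart)
    ultimately have "{x::real^'n. x $ i = 0} \<in> null_sets lborel"
      using null_sets_completion_iff by (metis negligible_iff_null_sets)
    from AE_not_in[OF this] show ?thesis by simp
  qed
  then show ?thesis by (simp add: AE_all_countable)
qed

lemma AE_off_axis: "AE x in lborel. x \<in> off_axis"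
  using AE_components_nonzero by (rule eventually_mono) (auto simp: off_axis_def)

lemma abs_le_cyl_rho: "\<bar>x $ 1\<bar> \<le> cyl_rho x" "\<bar>x $ 2\<bar> \<le> cyl_rho x"
  unfolding cyl_rho_def by (auto intro!: real_le_rsqrt)

lemma cyl_rho_le_norm: "cyl_rho x \<le> norm x"
  using abs_le_cyl_rho unfolding cyl_rho_def norm_eq_sqrt_inner
  by (auto intro!: real_sqrt_le_mono simp: inner_vec_def sum_3 power2_eq_square)

lemma cyl_rho_nonneg: "0 \<le> cyl_rho x"
  by (simp add: cyl_rho_def)

lemma measurable_component[measurable]: "(\<lambda>x. (x::real^'n) $ i) \<in> borel_measurable borel"
  by (intro borel_measurable_continuous_onI continuous_intros)

lemma measurable_cyl_rho[measurable]: "cyl_rho \<in> borel_measurable borel"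
  unfolding cyl_rho_def[abs_def] by measurable

text \<open>The bound is asked only where every coordinate is nonzero, which is almost everywhere.
  Since \<open>0 powr (-a)\<close> is 0, the product on the right vanishes on the coordinate planes
  and could not dominate there.\<close>

lemma integrable_prod_bound:
  fixes f :: "real^'n \<Rightarrow> real"
  assumes ab: "0 \<le> a" "a < 1" "0 \<le> b" "1 < a + b" and f: "f \<in> borel_measurable borel" "\<And>x. 0 \<le> f x"
    and le: "\<And>x. (\<forall>i. x $ i \<noteq> 0) \<Longrightarrow>
      f x \<le> C * (\<Prod>i\<in>UNIV. \<bar>x $ i\<bar> powr (-a) * (1 + \<bar>x $ i\<bar>) powr (-b))"
  shows "integrable lborel f"
proof (rule integrableI_nonneg)
  define P where "P x = (\<Prod>i\<in>UNIV. \<bar>(x::real^'n) $ i\<bar> powr (-a) * (1 + \<bar>x $ i\<bar>) powr (-b))" for x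
  have P0: "0 \<le> P x" for x by (auto simp: P_def intro!: prod_nonneg)
  have [measurable]: "P \<in> borel_measurable borel" unfolding P_def[abs_def] by measurable
  have "(\<integral>\<^sup>+x. ennreal (f x) \<partial>lborel) \<le> (\<integral>\<^sup>+x. ennreal \<bar>C\<bar> * ennreal (P x) \<partial>lborel)"
  proof (rule nn_integral_mono_AE)
    show "AE x in lborel. ennreal (f x) \<le> ennreal \<bar>C\<bar> * ennreal (P x)"
      using AE_components_nonzero
    proof eventually_elim
      case (elim x)
      have "f x \<le> C * P x" using le[of x] elim by (simp add: P_def)
      also have "\<dots> \<le> \<bar>C\<bar> * P x" using P0 by (intro mult_right_mono) auto
      finally show ?case by (simp add: P0 ennreal_leI flip: ennreal_mult)
    qed
  qed
  also have "\<dots> = ennreal \<bar>C\<bar> * (\<integral>\<^sup>+x. ennreal (P x) \<partial>lborel)" by (rule nn_integral_cmult) auto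
  also have "\<dots> < \<infinity>"
    using powr_weight_prod_finite[OF ab, where 'n='n] by (simp add: P_def ennreal_mult_less_top)
  finally show "(\<integral>\<^sup>+x. ennreal (f x) \<partial>lborel) < \<infinity>" .
qed (use f in auto)

text \<open>Collects three decay rates: 1 / \<rho> from the gradient of a cutoff, 1 / (r (1 + r))
  from the Kerr fields, and (1 + r) powr (-1/2) from a perturbation with \<beta> < -1/2.\<close>

definition dom_far :: "real^3 \<Rightarrow> real" where
  "dom_far x = 1 / (cyl_rho x * norm x * (1 + norm x) powr (3/2))"

lemma dom_far_nonneg: "0 \<le> dom_far x"
  by (simp add: dom_far_def cyl_rho_nonneg)

text \<open>By AM-GM-type bounds \<open>\<rho> r\<close> dominates \<open>\<Prod> |x\<^sub>i| powr (2/3)\<close>, so that Tonelli applies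
  without a change of variables.\<close>
lemma dom_far_integrable: "integrable lborel dom_far"
proof (rule integrable_prod_bound[where a="2/3" and b="1/2" and C=1])
  show "dom_far \<in> borel_measurable borel" unfolding dom_far_def[abs_def] by measurable
  fix x :: "real^3" assume x: "\<forall>i. x $ i \<noteq> 0"
  define r where "r = norm x"
  have p: "0 < \<bar>x $ i\<bar>" "\<bar>x $ i\<bar> \<le> r" for i using x component_le_norm_cart[of x i] by (auto simp: r_def)
  have r: "0 < r" using p[of 1] by linarith
  have powr_split: "t = t powr u * t powr v" if "0 < t" "u + v = 1" for t u v :: real
    using that by (simp flip: powr_add)
  \<comment> \<open>The exponents are chosen so that each coordinate collects 2/3 in total: \<rho>
    gives 1/2 to each of x_1 and x_2, and r gives 1/6, 1/6 and 2/3. The remaining factor gives every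
    coordinate a weight of exponent 1/2, and 2/3 + 1/2 > 1.\<close>
  have "\<bar>x $ 1\<bar> powr (1/2) * \<bar>x $ 2\<bar> powr (1/2) \<le> cyl_rho x powr (1/2) * cyl_rho x powr (1/2)"
    using abs_le_cyl_rho by (intro mult_mono powr_mono2) auto
  also have "\<dots> = cyl_rho x"
    using powr_split[of "cyl_rho x" "1/2" "1/2"] abs_le_cyl_rho(1)[of x] p(1)[of 1] by simp
  finally have rho: "\<bar>x $ 1\<bar> powr (1/2) * \<bar>x $ 2\<bar> powr (1/2) \<le> cyl_rho x" .
  have "\<bar>x $ 1\<bar> powr (1/6) * \<bar>x $ 2\<bar> powr (1/6) * \<bar>x $ 3\<bar> powr (2/3)
      \<le> r powr (1/6) * r powr (1/6) * r powr (2/3)"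
    using p by (intro mult_mono powr_mono2) (auto intro: order.strict_implies_order)
  also have "\<dots> = r" using r by (simp flip: powr_add)
  finally have rr: "\<bar>x $ 1\<bar> powr (1/6) * \<bar>x $ 2\<bar> powr (1/6) * \<bar>x $ 3\<bar> powr (2/3) \<le> r" .
  have "(1 + \<bar>x $ 1\<bar>) powr (1/2) * (1 + \<bar>x $ 2\<bar>) powr (1/2) * (1 + \<bar>x $ 3\<bar>) powr (1/2)
      \<le> (1 + r) powr (1/2) * (1 + r) powr (1/2) * (1 + r) powr (1/2)"
    using p(2) by (intro mult_mono powr_mono2) auto
  also have "\<dots> = (1 + r) powr (3/2)" using r by (simp add: powr_mult_base flip: powr_add)
  finally have rw: "(1 + \<bar>x $ 1\<bar>) powr (1/2) * (1 + \<bar>x $ 2\<bar>) powr (1/2) * (1 + \<bar>x $ 3\<bar>) powr (1/2)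
     \<le> (1 + r) powr (3/2)" .
  have e: "t powr (2/3) = t powr (1/2) * t powr (1/6)" if "0 < t" for t :: real
    by (simp flip: powr_add)
  have "(\<Prod>i\<in>UNIV. \<bar>x $ i\<bar> powr (2/3) * (1 + \<bar>x $ i\<bar>) powr (1/2))
    = (\<bar>x $ 1\<bar> powr (1/2) * \<bar>x $ 2\<bar> powr (1/2)) * (\<bar>x $ 1\<bar> powr (1/6) * \<bar>x $ 2\<bar> powr (1/6) * \<bar>x $ 3\<bar> powr (2/3))
      * ((1 + \<bar>x $ 1\<bar>) powr (1/2) * (1 + \<bar>x $ 2\<bar>) powr (1/2) * (1 + \<bar>x $ 3\<bar>) powr (1/2))"
    using e[OF p(1)[of 1]] e[OF p(1)[of 2]] by (simp add: prod_3 mult_ac)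
  also have "\<dots> \<le> cyl_rho x * r * (1 + r) powr (3/2)"
    using rho rr rw r cyl_rho_nonneg by (intro mult_mono) auto
  finally have le: "(\<Prod>i\<in>UNIV. \<bar>x $ i\<bar> powr (2/3) * (1 + \<bar>x $ i\<bar>) powr (1/2)) \<le> cyl_rho x * r * (1 + r) powr (3/2)" .
  have pos: "0 < (\<Prod>i\<in>UNIV. \<bar>x $ i\<bar> powr (2/3) * (1 + \<bar>x $ i\<bar>) powr (1/2))"
    using x by (intro prod_pos) (auto simp: add_pos_nonneg)
  have "dom_far x \<le> 1 / (\<Prod>i\<in>UNIV. \<bar>x $ i\<bar> powr (2/3) * (1 + \<bar>x $ i\<bar>) powr (1/2))"
    unfolding dom_far_def r_def[symmetric] using le pos by (intro divide_left_mono) auto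
  also have "\<dots> = 1 * (\<Prod>i\<in>UNIV. \<bar>x $ i\<bar> powr (-(2/3)) * (1 + \<bar>x $ i\<bar>) powr (-(1/2)))"
    by (simp add: powr_minus_divide prod_dividef)
  finally show "dom_far x \<le> 1 * (\<Prod>i\<in>UNIV. \<bar>x $ i\<bar> powr (-(2/3)) * (1 + \<bar>x $ i\<bar>) powr (-(1/2)))" .
qed (auto simp: dom_far_nonneg)

text \<open>Dominates (y / X)^2 / \<rho>^2, because |y| / X is at most sigma powr \<beta> / \<rho>^2
  and y lives on \<open>Omega_rho\<close>.\<close>

definition dom_cyl :: "real \<Rightarrow> real \<Rightarrow> real^3 \<Rightarrow> real" where
  "dom_cyl \<beta> \<rho>0 x = indicator (Omega_rho \<rho>0) x * sigma x powr (2 * \<beta>) / cyl_rho x ^ 6"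

lemma sigma_eq: "sigma x = sqrt ((norm x)\<^sup>2 + 1)"
  by (simp add: sigma_def rad_eq_norm)

lemma sigma_ge_1: "1 \<le> sigma x"
  by (simp add: sigma_eq)

lemma sigma_ge_norm: "1 + norm x \<le> 2 * sigma x" "norm x \<le> sigma x"
proof -
  show *: "norm x \<le> sigma x" unfolding sigma_eq by (intro real_le_rsqrt) simp
  show "1 + norm x \<le> 2 * sigma x" using * sigma_ge_1[of x] by linarith
qed

lemma dom_cyl_integrable:
  assumes \<beta>: "\<beta> < -1/2" and \<rho>0: "0 < \<rho>0"
  shows "integrable lborel (dom_cyl \<beta> \<rho>0)"
proof -
  \<comment> \<open>The factor \<rho>^-6 supplies exponent 3 in each of x_1 and x_2, and sigma powr
    (2 \<beta>) supplies -2 \<beta> > 1 in x_3. A common exponent for all coordinates has to lie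
    below both.\<close>
  define b where "b = min (-2 * \<beta>) 3"
  have b: "1 < b" "b \<le> -2 * \<beta>" "b \<le> 3" using \<beta> by (auto simp: b_def)
  define K where "K = (1 + 1 / \<rho>0) ^ 6"
  show ?thesis
  proof (rule integrable_prod_bound[where a=0 and b=b and C="2 powr (-2 * \<beta>) * K"])
    have [measurable]: "sigma \<in> borel_measurable borel" unfolding sigma_eq[abs_def] by measurable
    have [measurable]: "Omega_rho \<rho>0 \<in> sets borel" unfolding Omega_rho_def by measurable
    show "dom_cyl \<beta> \<rho>0 \<in> borel_measurable borel" unfolding dom_cyl_def[abs_def] by measurable
    show "0 \<le> dom_cyl \<beta> \<rho>0 x" for x by (simp add: dom_cyl_def)
    fix x :: "real^3" assume x: "\<forall>i. x $ i \<noteq> 0"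
    define h where "h t = (1 + \<bar>t\<bar>) powr (-b)" for t :: real
    have h: "(\<Prod>i\<in>UNIV. \<bar>x $ i\<bar> powr (-0) * (1 + \<bar>x $ i\<bar>) powr (-b)) = h (x $ 1) * h (x $ 2) * h (x $ 3)"
      using x by (simp add: prod_3 h_def)
    show "dom_cyl \<beta> \<rho>0 x \<le> 2 powr (-2 * \<beta>) * K * (\<Prod>i\<in>UNIV. \<bar>x $ i\<bar> powr (-0) * (1 + \<bar>x $ i\<bar>) powr (-b))"
    proof (cases "x \<in> Omega_rho \<rho>0")
      case True
      define p where "p = cyl_rho x"
      have p: "\<rho>0 < p" "0 < p" using True \<rho>0 by (auto simp: Omega_rho_def p_def)
      have "1 + \<bar>x $ i\<bar> \<le> (1 + 1 / \<rho>0) * p" if "i = 1 \<or> i = 2" for i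
      proof -
        have "1 + \<bar>x $ i\<bar> \<le> 1 + p" using abs_le_cyl_rho[of x] that by (auto simp: p_def)
        also have "\<dots> \<le> (1 + 1 / \<rho>0) * p" using p \<rho>0 by (simp add: field_simps)
        finally show ?thesis .
      qed
      then have le: "(1 + \<bar>x $ i\<bar>) ^ 3 \<le> ((1 + 1 / \<rho>0) * p) ^ 3" if "i = 1 \<or> i = 2" for i
        using that by (intro power_mono) auto
      have h3: "1 / (1 + \<bar>x $ i\<bar>) ^ 3 \<le> h (x $ i)" for i
      proof -
        have "(1 + \<bar>x $ i\<bar>) powr (-3) \<le> h (x $ i)" unfolding h_def using b by (intro powr_mono) auto
        then show ?thesis by (simp add: powr_minus_divide powr_numeral add_pos_nonneg)
      qed
      have "1 / p ^ 6 = K * (1 / ((1 + 1 / \<rho>0) * p) ^ 3 * (1 / ((1 + 1 / \<rho>0) * p) ^ 3))"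
      proof -
        define k where "k = 1 + 1 / \<rho>0"
        have "k > 0" using \<rho>0 by (simp add: k_def add_pos_pos)
        then show ?thesis unfolding K_def k_def[symmetric] using p
          by (simp add: power_mult_distrib field_simps flip: power_add)
      qed
      also have "\<dots> \<le> K * (1 / (1 + \<bar>x $ 1\<bar>) ^ 3 * (1 / (1 + \<bar>x $ 2\<bar>) ^ 3))"
        using le[of 1] le[of 2] p \<rho>0
        by (intro mult_left_mono mult_mono divide_left_mono) (auto simp: K_def add_pos_nonneg intro!: mult_pos_pos zero_less_power)
      also have "\<dots> \<le> K * (h (x $ 1) * h (x $ 2))"
        using h3 \<rho>0 by (intro mult_left_mono mult_mono) (auto simp: K_def h_def)
      finally have 1: "1 / p ^ 6 \<le> K * (h (x $ 1) * h (x $ 2))" .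
      have "sigma x powr (2 * \<beta>) \<le> ((1 + \<bar>x $ 3\<bar>) / 2) powr (2 * \<beta>)"
        using \<beta> sigma_ge_norm(1)[of x] component_le_norm_cart[of x 3]
        by (intro powr_mono2') auto
      also have "\<dots> = 2 powr (-2 * \<beta>) * (1 + \<bar>x $ 3\<bar>) powr (2 * \<beta>)"
        by (simp add: powr_divide powr_minus_divide)
      also have "\<dots> \<le> 2 powr (-2 * \<beta>) * h (x $ 3)"
        unfolding h_def using b by (intro mult_left_mono powr_mono) auto
      finally have 2: "sigma x powr (2 * \<beta>) \<le> 2 powr (-2 * \<beta>) * h (x $ 3)" .
      have "dom_cyl \<beta> \<rho>0 x = sigma x powr (2 * \<beta>) * (1 / p ^ 6)"
        using True by (simp add: dom_cyl_def p_def)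
      also have "\<dots> \<le> (2 powr (-2 * \<beta>) * h (x $ 3)) * (K * (h (x $ 1) * h (x $ 2)))"
        using p by (intro mult_mono 1 2) (auto simp: h_def)
      finally show ?thesis unfolding h by (simp add: mult_ac)
    next
      case False
      then show ?thesis using \<rho>0 unfolding h by (simp add: dom_cyl_def K_def h_def)
    qed
  qed (use b in auto)
qed

section \<open>Axisymmetric gradients and cutoffs\<close>

lemma GDERIV_unique:
  assumes "GDERIV f x :> a" "GDERIV f x :> b" shows "a = b"
proof -
  have "(\<lambda>h. h \<bullet> a) = (\<lambda>h. h \<bullet> b)"
    using has_derivative_unique assms unfolding gderiv_def by blast
  then have "(a - b) \<bullet> a = (a - b) \<bullet> b" by (rule fun_cong)
  then have "(a - b) \<bullet> (a - b) = 0" by (simp add: inner_diff_right)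
  then show ?thesis by simp
qed

lemma cyl_rho_sq_GDERIV: "GDERIV (\<lambda>x. (cyl_rho x)\<^sup>2) x :> 2 *\<^sub>R vector [x $ 1, x $ 2, 0]"
  unfolding cyl_rho_sq unfolding power2_eq_square
  by (rule GDERIV_subst[OF GDERIV_add[OF GDERIV_mult[OF GDERIV_component GDERIV_component]
        GDERIV_mult[OF GDERIV_component GDERIV_component]]])
     (simp add: vec_eq_iff forall_3 axis_def)

lemma norm_vector_cyl: "norm (vector [x $ 1, x $ 2, 0] :: real^3) = cyl_rho x"
  by (rule power2_eq_imp_eq) (simp_all add: norm_sq_3 cyl_rho_sq cyl_rho_nonneg)

lemma cyl_rho_GDERIV:
  assumes "x \<in> off_axis"
  shows "GDERIV cyl_rho x :> (1 / cyl_rho x) *\<^sub>R vector [x $ 1, x $ 2, 0]"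
proof -
  note p = cyl_rho_pos[OF assms]
  have d: "(sqrt has_real_derivative (inverse (cyl_rho x) / 2)) (at ((cyl_rho x)\<^sup>2))"
    using DERIV_real_sqrt[of "(cyl_rho x)\<^sup>2"] p by simp
  have "GDERIV (\<lambda>x. sqrt ((cyl_rho x)\<^sup>2)) x :> (inverse (cyl_rho x) / 2) *\<^sub>R (2 *\<^sub>R vector [x $ 1, x $ 2, 0])"
    by (rule GDERIV_DERIV_compose[OF cyl_rho_sq_GDERIV d])
  moreover have "(\<lambda>x. sqrt ((cyl_rho x)\<^sup>2)) = cyl_rho" by (simp add: cyl_rho_nonneg fun_eq_iff)
  ultimately show ?thesis by (simp add: inverse_eq_divide)
qed

text \<open>An axisymmetric f is its restriction to the meridian half plane x_2 = 0 composed with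
  (\<rho>, z). The chain rule writes the gradient at x as the two profile derivatives along the
  radial and the vertical unit vector, which are orthonormal off the axis.\<close>

lemma grad_abs_eq_norm:
  assumes "axisym f" and D: "\<And>x. x \<in> off_axis \<Longrightarrow> GDERIV f x :> gf x" and x: "x \<in> off_axis"
  shows "(grad_abs f x)\<^sup>2 = (norm (gf x))\<^sup>2"
proof -
  define \<Phi> :: "real \<Rightarrow> real \<Rightarrow> real^3" where "\<Phi> s t = s *\<^sub>R axis 1 1 + t *\<^sub>R axis 3 1" for s t
  have \<Phi>: "vector [s, 0, t] = \<Phi> s t" for s t
    by (simp add: \<Phi>_def vec_eq_iff forall_3 axis_def)
  define p z where "p = cyl_rho x" and "z = cyl_z x"
  have p: "0 < p" using cyl_rho_pos[OF x] by (simp add: p_def)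
  have U: "\<Phi> p z \<in> off_axis" using p by (simp add: \<Phi>_def off_axis_def axis_def)
  define d where "d = gf (\<Phi> p z)"
  have fd: "(f has_derivative (\<lambda>h. h \<bullet> d)) (at (\<Phi> p z))"
    using D[OF U] by (simp add: gderiv_def d_def)
  have "((\<lambda>s. f (\<Phi> s z)) has_derivative (\<lambda>s. (s *\<^sub>R axis 1 1) \<bullet> d)) (at p)"
    by (rule has_derivative_compose[where g=f and f="\<lambda>s. \<Phi> s z", OF _ fd])
       (auto simp: \<Phi>_def intro!: derivative_eq_intros)
  then have 1: "d_rho f x = d $ 1"
    unfolding d_rho_def profile_def \<Phi> p_def[symmetric] z_def[symmetric]
    by (intro DERIV_imp_deriv) (simp add: has_field_derivative_def inner_axis' mult_commute_abs)
  have "((\<lambda>t. f (\<Phi> p t)) has_derivative (\<lambda>t. (t *\<^sub>R axis 3 1) \<bullet> d)) (at z)"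
    by (rule has_derivative_compose[where g=f and f="\<lambda>t. \<Phi> p t", OF _ fd])
       (auto simp: \<Phi>_def intro!: derivative_eq_intros)
  then have 2: "d_z f x = d $ 3"
    unfolding d_z_def profile_def \<Phi> p_def[symmetric] z_def[symmetric]
    by (intro DERIV_imp_deriv) (simp add: has_field_derivative_def inner_axis' mult_commute_abs)
  have eq: "f (\<Phi> (cyl_rho u) (cyl_z u)) = f u" for u
  proof -
    have "cyl_rho (\<Phi> (cyl_rho u) (cyl_z u)) = cyl_rho u" "cyl_z (\<Phi> (cyl_rho u) (cyl_z u)) = cyl_z u"
      unfolding \<Phi>[symmetric] using cyl_rho_nonneg[of u] by (simp_all add: cyl_rho_def[of "vector _"] cyl_z_def[of "vector _"])
    then show ?thesis using assms(1) unfolding axisym_def by blast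
  qed
  define v :: "real^3" where "v = (1 / p) *\<^sub>R vector [x $ 1, x $ 2, 0]"
  have c: "(cyl_rho has_derivative (\<lambda>h. h \<bullet> v)) (at x)"
    using cyl_rho_GDERIV[OF x] by (simp add: gderiv_def v_def p_def)
  have c3: "(cyl_z has_derivative (\<lambda>h. h \<bullet> axis 3 1)) (at x)"
    using GDERIV_component[of 3 x] by (simp add: gderiv_def cyl_z_def[abs_def])
  have "((\<lambda>u. \<Phi> (cyl_rho u) (cyl_z u)) has_derivative (\<lambda>h. \<Phi> (h \<bullet> v) (h \<bullet> axis 3 1))) (at x)"
    unfolding \<Phi>_def by (intro derivative_intros c c3)
  from has_derivative_compose[where g=f and f="\<lambda>u. \<Phi> (cyl_rho u) (cyl_z u)", OF this fd[unfolded p_def z_def]]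
  have "(f has_derivative (\<lambda>h. \<Phi> (h \<bullet> v) (h \<bullet> axis 3 1) \<bullet> d)) (at x)"
    unfolding eq .
  moreover have "\<Phi> (h \<bullet> v) (h \<bullet> axis 3 1) \<bullet> d = h \<bullet> (d $ 1 *\<^sub>R v + d $ 3 *\<^sub>R axis 3 1)" for h
    by (simp add: \<Phi>_def inner_add_left inner_add_right inner_axis' mult.commute)
  ultimately have "GDERIV f x :> d $ 1 *\<^sub>R v + d $ 3 *\<^sub>R axis 3 1"
    by (simp add: gderiv_def)
  then have g: "gf x = d $ 1 *\<^sub>R v + d $ 3 *\<^sub>R axis 3 1" by (rule GDERIV_unique[OF D[OF x]])
  have "norm v = 1" using p by (simp add: v_def norm_vector_cyl p_def)
  then have vv: "v \<bullet> v = 1" "v \<bullet> axis 3 1 = 0" "axis 3 1 \<bullet> v = 0"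
    by (simp_all add: norm_eq_1 inner_axis inner_axis') (simp_all add: v_def)
  have "(norm (gf x))\<^sup>2 = (d $ 1)\<^sup>2 + (d $ 3)\<^sup>2"
    unfolding power2_norm_eq_inner g
    by (simp add: inner_add_left inner_add_right vv power2_eq_square inner_axis_axis)
  then show ?thesis by (simp add: grad_abs_def 1 2)
qed

lemma axisym_kerr: "axisym (v0 J)" "axisym (Y0 J)"
  unfolding axisym_def v0_def Y0_def X0_def cos_th_def sin_th_def BL_R_def Kerr_Sigma_def rad_def
  by (intro allI impI, elim conjE, simp only:)+

lemma axisym_add: "axisym f \<Longrightarrow> axisym g \<Longrightarrow> axisym (\<lambda>x. f x + g x)"
  unfolding axisym_def by (intro allI impI arg_cong2[where f="(+)"]) blast+

section \<open>Cutoffs away from the axis and from infinity\<close>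

definition pos_sq :: "real \<Rightarrow> real" where "pos_sq t = (max 0 t)\<^sup>2"

text \<open>Squaring makes the positive part continuously differentiable, which is the regularity
  that the divergence theorem asks of a cutoff.\<close>

lemma pos_sq_deriv: "(pos_sq has_real_derivative 2 * max 0 t) (at t)"
proof -
  consider "t > 0" | "t < 0" | "t = 0" by linarith
  then show ?thesis
  proof cases
    case 1
    have "((\<lambda>t. t\<^sup>2) has_real_derivative 2 * t) (at t)" by (auto intro!: derivative_eq_intros)
    then have "(pos_sq has_real_derivative 2 * t) (at t)"
      by (rule has_field_derivative_transform_within_open[of _ _ _ "{0<..}"])
         (use 1 in \<open>auto simp: pos_sq_def\<close>)
    then show ?thesis using 1 by simp
  next
    case 2
    have "((\<lambda>t. 0) has_real_derivative 0) (at t)" by simp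
    then have "(pos_sq has_real_derivative 0) (at t)"
      by (rule has_field_derivative_transform_within_open[of _ _ _ "{..<0}"])
         (use 2 in \<open>auto simp: pos_sq_def\<close>)
    then show ?thesis using 2 by simp
  next
    case 3
    have "((\<lambda>h. pos_sq h / h) \<longlongrightarrow> 0) (at 0)"
    proof (rule Lim_null_comparison)
      show "\<forall>\<^sub>F h in at 0. norm (pos_sq h / h) \<le> \<bar>h\<bar>"
        by (rule always_eventually) (auto simp: pos_sq_def max_def power2_eq_square)
      show "((\<lambda>h. \<bar>h\<bar>) \<longlongrightarrow> (0::real)) (at 0)" by (intro tendsto_eq_intros) auto
    qed
    then show ?thesis using 3 by (simp add: has_field_derivative_iff pos_sq_def)
  qed
qed

text \<open>A cutoff to \<open>\<rho> \<ge> N\<^sup>-\<^sup>1\<^sup>/\<^sup>2\<close>, \<open>r \<le> N\<^sup>1\<^sup>/\<^sup>2\<close>, increasing in \<open>N\<close>, whose gradient is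
  \<open>O(1/\<rho>)\<close> uniformly in \<open>N\<close>.\<close>
definition cutoff :: "real \<Rightarrow> real^3 \<Rightarrow> real" where
  "cutoff N x = pos_sq (1 - 2 / (1 + N * (cyl_rho x)\<^sup>2)) * pos_sq (1 - (norm x)\<^sup>2 / N)"

definition cutoff_grad :: "real \<Rightarrow> real^3 \<Rightarrow> real^3" where
  "cutoff_grad N x =
    pos_sq (1 - 2 / (1 + N * (cyl_rho x)\<^sup>2)) *\<^sub>R (- (2 * max 0 (1 - (norm x)\<^sup>2 / N)) * (2 / N)) *\<^sub>R x
    + pos_sq (1 - (norm x)\<^sup>2 / N) *\<^sub>R
        (2 * max 0 (1 - 2 / (1 + N * (cyl_rho x)\<^sup>2)) * (4 * N / (1 + N * (cyl_rho x)\<^sup>2)\<^sup>2)) *\<^sub>R vector [x $ 1, x $ 2, 0]"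

definition cutoff_supp :: "real \<Rightarrow> (real^3) set" where
  "cutoff_supp N = {x. 1 \<le> N * (cyl_rho x)\<^sup>2 \<and> (norm x)\<^sup>2 \<le> N}"

lemma pos_sq_bounds: "0 \<le> pos_sq t" "t \<le> 1 \<Longrightarrow> pos_sq t \<le> 1" "t \<le> 0 \<Longrightarrow> pos_sq t = 0" "0 < t \<Longrightarrow> 0 < pos_sq t"
  by (auto simp: pos_sq_def power_le_one)

lemma pos_sq_mono: "s \<le> t \<Longrightarrow> pos_sq s \<le> pos_sq t"
  by (auto simp: pos_sq_def intro!: power_mono)

lemma cutoff_bounds: assumes "0 < N" shows "0 \<le> cutoff N x" "cutoff N x \<le> 1"
proof -
  have "0 < 1 + N * (cyl_rho x)\<^sup>2" using assms by (simp add: add_pos_nonneg)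
  then have "1 - 2 / (1 + N * (cyl_rho x)\<^sup>2) \<le> 1" "1 - (norm x)\<^sup>2 / N \<le> 1" using assms by auto
  then show "0 \<le> cutoff N x" "cutoff N x \<le> 1"
    unfolding cutoff_def by (auto intro!: mult_nonneg_nonneg mult_le_one pos_sq_bounds)
qed

lemma cutoff_supp: assumes "0 < N" "x \<notin> cutoff_supp N" shows "cutoff N x = 0"
proof -
  have "0 < 1 + N * (cyl_rho x)\<^sup>2" using assms by (simp add: add_pos_nonneg)
  then have "1 - 2 / (1 + N * (cyl_rho x)\<^sup>2) \<le> 0 \<or> 1 - (norm x)\<^sup>2 / N \<le> 0"
    using assms by (auto simp: cutoff_supp_def field_simps)
  then show ?thesis unfolding cutoff_def using pos_sq_bounds(3) by auto
qed

lemma cutoff_supp_compact: assumes "0 < N" shows "compact (cutoff_supp N)" "cutoff_supp N \<subseteq> off_axis"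
proof -
  have "cutoff_supp N \<subseteq> cball 0 (sqrt N)"
    by (auto simp: cutoff_supp_def intro!: real_le_rsqrt)
  then have "bounded (cutoff_supp N)" using bounded_subset bounded_cball by blast
  moreover have "closed (cutoff_supp N)"
    unfolding cutoff_supp_def cyl_rho_sq
    by (intro closed_Collect_conj closed_Collect_le continuous_intros)
  ultimately show "compact (cutoff_supp N)" by (simp add: compact_eq_bounded_closed)
  show "cutoff_supp N \<subseteq> off_axis" by (auto simp: cutoff_supp_def off_axis_def cyl_rho_sq)
qed

lemma cutoff_GDERIV: assumes "0 < N" shows "GDERIV (cutoff N) x :> cutoff_grad N x"
proof -
  have nz: "1 + N * (cyl_rho x)\<^sup>2 \<noteq> 0" using assms by (smt (verit) mult_nonneg_nonneg zero_le_power2)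
  have d1: "((\<lambda>t. pos_sq (1 - 2 / (1 + N * t))) has_real_derivative
      2 * max 0 (1 - 2 / (1 + N * (cyl_rho x)\<^sup>2)) * (2 * N / (1 + N * (cyl_rho x)\<^sup>2)\<^sup>2)) (at ((cyl_rho x)\<^sup>2))"
    by (rule DERIV_chain2[OF pos_sq_deriv], (rule derivative_eq_intros refl nz)+)
       (use nz in \<open>simp add: power2_eq_square\<close>)
  have d2: "((\<lambda>t. pos_sq (1 - t / N)) has_real_derivative
      2 * max 0 (1 - (norm x)\<^sup>2 / N) * (- 1 / N)) (at ((norm x)\<^sup>2))"
  proof -
    have "((\<lambda>t. 1 - t / N) has_real_derivative - 1 / N) (at ((norm x)\<^sup>2))"
      using assms by (auto intro!: derivative_eq_intros simp: field_simps)
    from DERIV_chain2[OF pos_sq_deriv this] show ?thesis .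
  qed
  have n: "GDERIV (\<lambda>x. (norm x)\<^sup>2) x :> 2 *\<^sub>R x"
    unfolding gderiv_def power2_norm_eq_inner
    by (auto intro!: derivative_eq_intros simp: inner_commute fun_eq_iff)
  show ?thesis
    unfolding cutoff_def[abs_def]
    by (rule GDERIV_subst[OF GDERIV_mult[OF GDERIV_DERIV_compose[OF cyl_rho_sq_GDERIV d1] GDERIV_DERIV_compose[OF n d2]]])
       (simp add: cutoff_grad_def)
qed

lemma continuous_cyl_rho: "continuous_on A cyl_rho"
  unfolding cyl_rho_def[abs_def] by (intro continuous_intros)

lemma continuous_vector_cyl: "continuous_on A (\<lambda>x::real^3. vector [x $ 1, x $ 2, 0] :: real^3)"
proof -
  have "(\<lambda>x::real^3. vector [x $ 1, x $ 2, 0] :: real^3) = (\<lambda>x. x $ 1 *\<^sub>R axis 1 1 + x $ 2 *\<^sub>R axis 2 1)"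
    by (simp add: vec_eq_iff forall_3 axis_def fun_eq_iff)
  then show ?thesis by (simp only:) (intro continuous_intros)
qed

lemma continuous_pos_sq: "continuous_on A f \<Longrightarrow> continuous_on A (\<lambda>x. pos_sq (f x))"
  unfolding pos_sq_def by (intro continuous_intros)

lemma cutoff_grad_continuous: assumes "0 < N" shows "continuous_on A (cutoff_grad N)"
proof -
  have nz: "1 + N * (cyl_rho x)\<^sup>2 \<noteq> 0" for x using assms by (smt (verit) mult_nonneg_nonneg zero_le_power2)
  show ?thesis
    unfolding cutoff_grad_def[abs_def]
    by (intro continuous_on_add continuous_on_scaleR continuous_pos_sq continuous_on_mult
          continuous_on_minus continuous_on_max continuous_on_diff continuous_on_divide
          continuous_on_power continuous_on_norm continuous_on_const continuous_on_id
          continuous_cyl_rho continuous_vector_cyl ballI)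
       (use nz assms in auto)
qed

text \<open>The first bound is uniform in N and serves for domination; the second gives pointwise
  convergence to 0. With t = N \<rho>^2 the inner factor contributes 8 t / (1 + t)^2 <= 8 over
  \<rho>, and the outer factor 4 r / N <= 4 / r <= 4 / \<rho>, because it is active only where r^2
  <= N.\<close>

lemma cutoff_grad_bounds:
  assumes N: "0 < N" and x: "x \<in> off_axis"
  shows "norm (cutoff_grad N x) \<le> 12 / cyl_rho x"
    and "norm (cutoff_grad N x) \<le> 4 * norm x / N + 8 / (N * (cyl_rho x) ^ 3)"
proof -
  define p where "p = cyl_rho x"
  define r where "r = norm x"
  have p: "0 < p" "p \<le> r" using cyl_rho_pos[OF x] cyl_rho_le_norm by (auto simp: p_def r_def)
  define t where "t = N * p\<^sup>2"
  have t: "0 < t" using N p by (simp add: t_def)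
  define f1 f2 where "f1 = 1 - 2 / (1 + t)" and "f2 = 1 - r\<^sup>2 / N"
  have f: "f1 \<le> 1" "f2 \<le> 1" using t N by (auto simp: f1_def f2_def)
  have m: "0 \<le> max 0 f1" "max 0 f1 \<le> 1" "0 \<le> max 0 f2" "max 0 f2 \<le> 1" using f by auto
  have A: "norm (pos_sq f1 *\<^sub>R (- (2 * max 0 f2) * (2 / N)) *\<^sub>R x) \<le> 1 * (2 * max 0 f2 * (2 / N) * r)"
    unfolding norm_scaleR abs_mult r_def
    by (intro mult_mono) (use m N pos_sq_bounds f in auto)
  have B: "norm (pos_sq f2 *\<^sub>R (2 * max 0 f1 * (4 * N / (1 + t)\<^sup>2)) *\<^sub>R (vector [x $ 1, x $ 2, 0] :: real^3))
      \<le> 1 * (2 * 1 * (4 * N / (1 + t)\<^sup>2) * p)"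
    unfolding norm_scaleR abs_mult norm_vector_cyl p_def[symmetric]
    by (intro mult_mono) (use m N p pos_sq_bounds f in auto)
  have "norm (cutoff_grad N x) \<le> norm (pos_sq f1 *\<^sub>R (- (2 * max 0 f2) * (2 / N)) *\<^sub>R x)
     + norm (pos_sq f2 *\<^sub>R (2 * max 0 f1 * (4 * N / (1 + t)\<^sup>2)) *\<^sub>R (vector [x $ 1, x $ 2, 0] :: real^3))"
    unfolding cutoff_grad_def p_def[symmetric] r_def[symmetric] t_def[symmetric] f1_def[symmetric] f2_def[symmetric]
    by (rule norm_triangle_ineq)
  with A B have le: "norm (cutoff_grad N x) \<le> 4 * max 0 f2 * r / N + 8 * N * p / (1 + t)\<^sup>2"
    by (simp add: mult_ac)
  have C: "8 * N * p / (1 + t)\<^sup>2 \<le> 8 / (N * p ^ 3)"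
  proof -
    have "8 * N * p / (1 + t)\<^sup>2 \<le> 8 * N * p / t\<^sup>2"
      using t N p by (intro divide_left_mono power_mono) auto
    also have "\<dots> = 8 / (N * p ^ 3)" unfolding t_def using N p by (simp add: field_simps eval_nat_numeral)
    finally show ?thesis .
  qed
  have "4 * max 0 f2 * r / N \<le> 4 * 1 * r / N"
    using m N p by (intro divide_right_mono mult_mono) auto
  then show "norm (cutoff_grad N x) \<le> 4 * norm x / N + 8 / (N * (cyl_rho x) ^ 3)"
    using le C unfolding p_def[symmetric] r_def[symmetric] by simp
  have "8 * N * p / Q = 8 * (t / Q) / p" for Q
    unfolding t_def using p by (simp add: power2_eq_square)
  then have "8 * N * p / (1 + t)\<^sup>2 = 8 * (t / (1 + t)\<^sup>2) / p" .
  also have "\<dots> \<le> 8 * 1 / p"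
  proof (intro divide_right_mono mult_left_mono)
    have "t \<le> (1 + t)\<^sup>2" using t by (simp add: power2_sum)
    then show "t / (1 + t)\<^sup>2 \<le> 1" using t by (simp add: divide_le_eq)
  qed (use p in auto)
  finally have 1: "8 * N * p / (1 + t)\<^sup>2 \<le> 8 / p" by simp
  have 2: "4 * max 0 f2 * r / N \<le> 4 / p"
  proof (cases "f2 \<le> 0")
    case True then show ?thesis using p by simp
  next
    case False
    then have "r\<^sup>2 \<le> N" using N by (simp add: f2_def field_simps)
    have "4 * max 0 f2 * r / N \<le> 4 * 1 * r / r\<^sup>2"
      using m N p \<open>r\<^sup>2 \<le> N\<close> by (intro frac_le mult_mono) auto
    also have "\<dots> \<le> 4 / p" using p by (simp add: power2_eq_square frac_le)
    finally show ?thesis .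
  qed
  from le 1 2 have "norm (cutoff_grad N x) \<le> 4 / p + 8 / p" by linarith
  then show "norm (cutoff_grad N x) \<le> 12 / cyl_rho x" by (simp add: p_def flip: add_divide_distrib)
qed

lemma cutoff_mono: assumes "0 < M" "M \<le> N" shows "cutoff M x \<le> cutoff N x"
proof -
  have "0 < 1 + M * (cyl_rho x)\<^sup>2" "M * (cyl_rho x)\<^sup>2 \<le> N * (cyl_rho x)\<^sup>2"
    using assms by (auto simp: add_pos_nonneg mult_right_mono)
  then have "2 / (1 + N * (cyl_rho x)\<^sup>2) \<le> 2 / (1 + M * (cyl_rho x)\<^sup>2)" by (intro frac_le) auto
  moreover have "(norm x)\<^sup>2 / N \<le> (norm x)\<^sup>2 / M" using assms by (intro frac_le) auto
  ultimately show ?thesis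
    unfolding cutoff_def by (intro mult_mono pos_sq_mono pos_sq_bounds) auto
qed

lemma cutoff_tendsto: assumes "x \<in> off_axis" shows "(\<lambda>n. cutoff (real (Suc n)) x) \<longlonglongrightarrow> 1"
proof -
  have N: "filterlim (\<lambda>n. real (Suc n)) at_top sequentially"
    by (intro filterlim_compose[OF filterlim_real_sequentially filterlim_Suc])
  have p: "0 < (cyl_rho x)\<^sup>2" using cyl_rho_pos[OF assms] by simp
  have "(\<lambda>n. 2 / (1 + real (Suc n) * (cyl_rho x)\<^sup>2)) \<longlonglongrightarrow> 0"
    by (rule tendsto_divide_0[OF tendsto_const filterlim_at_top_imp_at_infinity])
       (intro filterlim_tendsto_add_at_top[OF tendsto_const] filterlim_at_top_mult_tendsto_pos[OF tendsto_const p] N)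
  then have 1: "(\<lambda>n. max 0 (1 - 2 / (1 + real (Suc n) * (cyl_rho x)\<^sup>2))) \<longlonglongrightarrow> max 0 (1 - 0)"
    by (intro tendsto_intros)
  have "(\<lambda>n. (norm x)\<^sup>2 / real (Suc n)) \<longlonglongrightarrow> 0"
    by (rule tendsto_divide_0[OF tendsto_const filterlim_at_top_imp_at_infinity[OF N]])
  then have 2: "(\<lambda>n. max 0 (1 - (norm x)\<^sup>2 / real (Suc n))) \<longlonglongrightarrow> max 0 (1 - 0)"
    by (intro tendsto_intros)
  have "(\<lambda>n. (max 0 (1 - 2 / (1 + real (Suc n) * (cyl_rho x)\<^sup>2)))\<^sup>2 * (max 0 (1 - (norm x)\<^sup>2 / real (Suc n)))\<^sup>2)
      \<longlonglongrightarrow> (max 0 (1 - 0))\<^sup>2 * (max 0 (1 - 0))\<^sup>2"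
    by (intro tendsto_mult tendsto_power 1 2)
  then show ?thesis by (simp add: cutoff_def pos_sq_def)
qed

lemma cutoff_grad_tendsto:
  assumes "x \<in> off_axis" shows "(\<lambda>n. cutoff_grad (real (Suc n)) x) \<longlonglongrightarrow> 0"
proof (rule Lim_null_comparison)
  have "norm (cutoff_grad N x) \<le> (4 * norm x + 8 / (cyl_rho x) ^ 3) * inverse N" if "0 < N" for N
  proof -
    have "4 * norm x / N + 8 / (N * c) = (4 * norm x + 8 / c) * inverse N" for c
      by (simp add: divide_inverse distrib_right)
    with cutoff_grad_bounds(2)[OF that assms] show ?thesis by metis
  qed
  then show "\<forall>\<^sub>F n in sequentially. norm (cutoff_grad (real (Suc n)) x)
      \<le> (4 * norm x + 8 / (cyl_rho x) ^ 3) * inverse (real (Suc n))"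
    by (intro always_eventually allI) (simp only: of_nat_0_less_iff zero_less_Suc)
  show "(\<lambda>n. (4 * norm x + 8 / (cyl_rho x) ^ 3) * inverse (real (Suc n))) \<longlonglongrightarrow> 0"
    using tendsto_mult[OF tendsto_const LIMSEQ_inverse_real_of_nat, of "4 * norm x + 8 / (cyl_rho x) ^ 3"]
    by (simp only: mult_zero_right)
qed

section \<open>The energy comparison\<close>

text \<open>The pointwise consequences of a small norm, with decay constants normalised to 1. The
  assumption \<open>small\<close> is the bound S <= s0, spelled out because \<open>S\<close> is
  defined only inside the locale; the bounds on \<open>gfun\<close> are those that
  \<open>gfun_near_0\<close> provides for such an s0.\<close>

locale kerr_perturbation =
  fixes J \<beta> \<rho>0 s0 :: real and \<alpha> y :: "real^3 \<Rightarrow> real" and ga gy :: "real^3 \<Rightarrow> real^3"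
  assumes J: "J \<noteq> 0" and \<beta>: "\<beta> < -1/2" and \<rho>0: "0 < \<rho>0"
    and ga: "\<And>x. GDERIV \<alpha> x :> ga x" and ga_cont: "continuous_on UNIV ga"
    and gy: "\<And>x. GDERIV y x :> gy x" and gy_cont: "continuous_on UNIV gy"
    and \<alpha>_bound: "\<And>x. \<bar>\<alpha> x\<bar> \<le> sigma x powr \<beta>"
    and y_bound: "\<And>x. \<bar>y x\<bar> \<le> sigma x powr \<beta>"
    and y_axis: "\<And>x. cyl_rho x \<le> \<rho>0 \<Longrightarrow> y x = 0"
    and s0: "s0 < 1"
    and g_nonneg: "\<And>S. 0 \<le> S \<Longrightarrow> S \<le> s0 \<Longrightarrow> 0 \<le> gfun S"
    and g_le_1: "\<And>S. 0 \<le> S \<Longrightarrow> S \<le> s0 \<Longrightarrow> gfun S \<le> 1"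
    and g_ge: "\<And>S. 0 \<le> S \<Longrightarrow> S \<le> s0 \<Longrightarrow> 1 \<le> (1 + S) * gfun S"
    and g_lipschitz: "\<And>S T. 0 \<le> S \<Longrightarrow> S \<le> T \<Longrightarrow> T \<le> s0 \<Longrightarrow> \<bar>gfun T - gfun S\<bar> \<le> T - S"
    and small: "\<And>x. x \<in> off_axis \<Longrightarrow> cosh (\<alpha> x) - 1 + exp (- \<alpha> x) * (y x / X0 J x)\<^sup>2 / 2 \<le> s0"
begin

text \<open>\<open>S = cosh d - 1\<close> for the distance \<open>d\<close> between the two maps, and \<open>D = div F\<close> for the
  flux \<open>F\<close>, the field \<open>\<langle>\<partial>u\<^sub>0, V\<rangle>\<close>, corrected by a multiple of \<open>\<partial> ln \<rho>\<close> because
  the energy is written with \<open>v\<close> instead of \<open>ln X = v + 2 ln \<rho>\<close>.\<close>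
definition "w x = y x / X0 J x"
definition "E x = exp (- \<alpha> x)"
definition "S x = (exp (\<alpha> x) + E x + E x * (w x)\<^sup>2) / 2 - 1"
text \<open>\<open>a\<close> is the gradient of ln X_0, while \<open>b\<close> and \<open>q\<close>
  are the gradients of Y_0 and y divided by X_0: the components of the derivatives in the
  orthonormal frame at the base map.\<close>

definition "a x = grad_v0 J x + 2 *\<^sub>R grad_ln_rho x"
definition "b x = X0 J x *\<^sub>R twist_field J x"
definition "q x = (1 / X0 J x) *\<^sub>R gy x"
definition "dS x = (exp (\<alpha> x) - (1 + S x)) *\<^sub>R ga x + (E x * w x) *\<^sub>R (q x - w x *\<^sub>R a x)"
text \<open>(\<open>G\<close>, \<open>k\<close> w) is the initial velocity of the geodesic in the
  orthonormal frame: d / sinh d times (1 + S - E, E w), a vector of length sinh d.\<close>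

definition "G x = gfun (S x) * (1 + S x - E x)"
definition "dG x = (gfun' (S x) * (1 + S x - E x)) *\<^sub>R dS x + gfun (S x) *\<^sub>R (dS x + E x *\<^sub>R ga x)"
definition "k x = gfun (S x) * E x"
definition "dk x = (gfun' (S x) * E x) *\<^sub>R dS x - (gfun (S x) * E x) *\<^sub>R ga x"
definition "F x = G x *\<^sub>R grad_v0 J x + (2 * (G x - \<alpha> x)) *\<^sub>R grad_ln_rho x + (k x * y x) *\<^sub>R twist_field J x"
definition "D x = dG x \<bullet> a x - G x * (b x \<bullet> b x) + w x * (dk x \<bullet> b x) + k x * (q x \<bullet> b x) - 2 * (ga x \<bullet> grad_ln_rho x)"
definition "e0 x = (norm (grad_v0 J x))\<^sup>2 + (norm (b x))\<^sup>2"
definition "e1 x = (norm (grad_v0 J x + ga x))\<^sup>2 + (E x)\<^sup>2 * (norm (b x + q x))\<^sup>2"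
definition "Q x = e1 x - e0 x - 2 * D x"

section \<open>Gradients and the convexity estimate for the perturbed map\<close>

lemma S_eq: "S x = cosh (\<alpha> x) - 1 + E x * (w x)\<^sup>2 / 2"
  by (simp add: S_def E_def cosh_def add_divide_distrib)

lemma E_pos: "0 < E x" by (simp add: E_def)

lemma S_bounds:
  "cosh (\<alpha> x) - 1 \<le> S x" "0 \<le> S x" "x \<in> off_axis \<Longrightarrow> S x \<le> s0"
proof -
  have "0 \<le> E x * (w x)\<^sup>2 / 2" using E_pos[of x] by simp
  then show "cosh (\<alpha> x) - 1 \<le> S x" unfolding S_eq by linarith
  then show "0 \<le> S x" using cosh_real_ge_1[of "\<alpha> x"] by linarith
  show "x \<in> off_axis \<Longrightarrow> S x \<le> s0" using small[of x] by (simp add: S_eq E_def w_def)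
qed

lemma S_abs: "x \<in> off_axis \<Longrightarrow> \<bar>S x\<bar> < 1"
  using S_bounds(2,3)[of x] s0 by linarith

lemma X0_pos: "x \<in> off_axis \<Longrightarrow> 0 < X0 J x"
  using X0_ge[OF J] by blast

text \<open>The scalar estimate holds for each of the three Cartesian derivatives separately;
  summing gives the estimate for gradients.\<close>

lemma Q_bound:
  assumes "x \<in> off_axis"
  shows "(norm (dS x))\<^sup>2 \<le> 3 * Q x"
proof -
  define Qi where "Qi i = (a x $ i + ga x $ i)\<^sup>2 + (E x)\<^sup>2 * (b x $ i + q x $ i)\<^sup>2 - (a x $ i)\<^sup>2 - (b x $ i)\<^sup>2
      - 2 * (dG x $ i * a x $ i - gfun (S x) * (1 + S x - E x) * (b x $ i)\<^sup>2 + w x * b x $ i * dk x $ i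
        + gfun (S x) * E x * q x $ i * b x $ i)" for i
  have Q: "Q x = (\<Sum>i\<in>UNIV. Qi i)"
  proof -
    \<comment> \<open>Passing from v to ln X changes e1 - e0 by four times the inner product of
      \<open>ga\<close> with \<open>grad_ln_rho\<close>, which is exactly what the last term of
      \<open>D\<close> compensates.\<close>
    have "Q x = (norm (a x + ga x))\<^sup>2 + (E x)\<^sup>2 * (norm (b x + q x))\<^sup>2 - (norm (a x))\<^sup>2 - (norm (b x))\<^sup>2
       - 2 * (dG x \<bullet> a x - G x * (b x \<bullet> b x) + w x * (dk x \<bullet> b x) + k x * (q x \<bullet> b x))"
      unfolding Q_def e1_def e0_def D_def power2_norm_eq_inner a_def
      by (simp add: inner_add_left inner_add_right inner_commute algebra_simps)
    then show ?thesis
      unfolding Qi_def power2_norm_eq_inner G_def k_def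
      by (simp add: inner_vec_def sum_3 power2_eq_square algebra_simps)
  qed
  have "(dS x $ i)\<^sup>2 \<le> 3 * Qi i" for i
  proof (rule convexity_bound[where E="E x" and ?e1.0="exp (\<alpha> x)" and S="S x" and g="gfun (S x)" and g'="gfun' (S x)"
        and a="a x $ i" and b="b x $ i" and p="ga x $ i" and q="q x $ i" and w="w x" and dG="dG x $ i" and dk="dk x $ i"])
    show "E x * exp (\<alpha> x) = 1" by (simp add: E_def flip: exp_add)
    show "0 < E x" by (rule E_pos)
    show "S x \<le> 1" using S_abs[OF assms] by linarith
    show "S x * (S x + 2) * gfun' (S x) + (1 + S x) * gfun (S x) = 1" by (rule gfun_ode[OF S_abs[OF assms]])
    show "0 \<le> gfun (S x)" "gfun (S x) \<le> 1" "1 \<le> (1 + S x) * gfun (S x)"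
      using g_nonneg g_le_1 g_ge S_bounds[of x] assms by auto
  qed (simp_all add: S_def dS_def dG_def dk_def Qi_def)
  then have "(\<Sum>i\<in>UNIV. (dS x $ i)\<^sup>2) \<le> (\<Sum>i\<in>UNIV. 3 * Qi i)" by (rule sum_mono)
  then show ?thesis
    unfolding Q power2_norm_eq_inner by (simp add: inner_vec_def sum_distrib_left power2_eq_square)
qed

lemma X0_GDERIV: assumes "x \<in> off_axis" shows "GDERIV (X0 J) x :> X0 J x *\<^sub>R a x"
proof (rule GDERIV_transform_off_axis[OF _ assms])
  have "DERIV exp (v0 J x) :> exp (v0 J x)" by simp
  note GDERIV_mult[OF GDERIV_DERIV_compose[OF v0_GDERIV[OF J assms] this] cyl_rho_sq_GDERIV]
  then show "GDERIV (\<lambda>x. exp (v0 J x) * (cyl_rho x)\<^sup>2) x :> X0 J x *\<^sub>R a x"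
    by (rule GDERIV_subst)
       (use cyl_rho_pos[OF assms] in \<open>simp add: exp_v0[OF J assms] a_def grad_ln_rho_eq[OF assms] scaleR_add_right\<close>)
  show "exp (v0 J u) * (cyl_rho u)\<^sup>2 = X0 J u" if "u \<in> off_axis" for u
    using cyl_rho_pos[OF that] by (simp add: exp_v0[OF J that])
qed

lemma w_GDERIV: assumes "x \<in> off_axis" shows "GDERIV w x :> q x - w x *\<^sub>R a x"
proof -
  note X = X0_pos[OF assms]
  have "GDERIV (\<lambda>x. y x * inverse (X0 J x)) x :> q x - w x *\<^sub>R a x"
    by (rule GDERIV_subst[OF GDERIV_mult[OF gy GDERIV_inverse[OF X0_GDERIV[OF assms]]]])
       (use X in \<open>auto simp: q_def w_def divide_inverse power2_eq_square\<close>)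
  then show ?thesis by (simp add: w_def[abs_def] divide_inverse)
qed

lemma E_GDERIV: "GDERIV E x :> - E x *\<^sub>R ga x"
proof -
  have "DERIV (\<lambda>t. exp (- t)) (\<alpha> x) :> - exp (- \<alpha> x)" by (auto intro!: derivative_eq_intros)
  from GDERIV_DERIV_compose[OF ga this] show ?thesis by (simp add: E_def[abs_def])
qed

lemma S_GDERIV: assumes "x \<in> off_axis" shows "GDERIV S x :> dS x"
proof -
  have "DERIV exp (\<alpha> x) :> exp (\<alpha> x)" by simp
  note eD = GDERIV_DERIV_compose[OF ga this]
  have sD: "DERIV (\<lambda>t. t / 2 - 1) t :> 1 / 2" for t :: real by (auto intro!: derivative_eq_intros)
  have "GDERIV (\<lambda>x. (exp (\<alpha> x) + E x + E x * (w x * w x)) / 2 - 1) x :> dS x"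
    by (rule GDERIV_subst[OF GDERIV_DERIV_compose[OF GDERIV_add[OF GDERIV_add[OF eD E_GDERIV]
          GDERIV_mult[OF E_GDERIV GDERIV_mult[OF w_GDERIV[OF assms] w_GDERIV[OF assms]]]] sD]])
       (simp add: dS_def vec_eq_iff S_def power2_eq_square field_simps)
  then show ?thesis by (simp add: S_def[abs_def] power2_eq_square)
qed

lemma g_GDERIV: assumes "x \<in> off_axis" shows "GDERIV (\<lambda>x. gfun (S x)) x :> gfun' (S x) *\<^sub>R dS x"
  by (rule GDERIV_DERIV_compose[OF S_GDERIV[OF assms] gfun_deriv[OF S_abs[OF assms]]])

lemma G_GDERIV: assumes "x \<in> off_axis" shows "GDERIV G x :> dG x"
  unfolding G_def[abs_def]
  by (rule GDERIV_subst[OF GDERIV_mult[OF g_GDERIV[OF assms]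
        GDERIV_diff[OF GDERIV_add[OF GDERIV_const S_GDERIV[OF assms]] E_GDERIV]]])
     (simp add: dG_def)

lemma k_GDERIV: assumes "x \<in> off_axis" shows "GDERIV k x :> dk x"
  unfolding k_def[abs_def]
  by (rule GDERIV_subst[OF GDERIV_mult[OF g_GDERIV[OF assms] E_GDERIV]])
     (simp add: dk_def)

lemma GDERIV_imp_continuous_on: "(\<And>x. x \<in> off_axis \<Longrightarrow> GDERIV f x :> f' x) \<Longrightarrow> continuous_on off_axis f"
  unfolding gderiv_def
  by (meson continuous_at_imp_continuous_on has_derivative_continuous)

lemma perturb_cont:
  "continuous_on off_axis (X0 J)" "continuous_on off_axis w" "continuous_on off_axis E"
  "continuous_on off_axis S" "continuous_on off_axis G" "continuous_on off_axis k"
  "continuous_on off_axis \<alpha>" "continuous_on off_axis y" "continuous_on off_axis (\<lambda>x. gfun (S x))"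
  "continuous_on off_axis ga" "continuous_on off_axis gy"
  using GDERIV_imp_continuous_on[OF X0_GDERIV] GDERIV_imp_continuous_on[OF w_GDERIV] GDERIV_imp_continuous_on[OF E_GDERIV]
    GDERIV_imp_continuous_on[OF S_GDERIV] GDERIV_imp_continuous_on[OF G_GDERIV] GDERIV_imp_continuous_on[OF k_GDERIV]
    GDERIV_imp_continuous_on[OF ga] GDERIV_imp_continuous_on[OF gy] GDERIV_imp_continuous_on[OF g_GDERIV]
    continuous_on_subset[OF ga_cont] continuous_on_subset[OF gy_cont] by simp_all

lemma density_cont:
  "continuous_on off_axis (\<lambda>x. gfun' (S x))" "continuous_on off_axis a" "continuous_on off_axis b"
  "continuous_on off_axis q" "continuous_on off_axis dS" "continuous_on off_axis dG" "continuous_on off_axis dk"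
  "continuous_on off_axis F" "continuous_on off_axis D" "continuous_on off_axis e0" "continuous_on off_axis e1"
  "continuous_on off_axis Q"
proof -
  note I = continuous_on_add continuous_on_diff continuous_on_minus continuous_on_mult continuous_on_scaleR
    continuous_on_inner continuous_on_power continuous_on_norm continuous_on_const perturb_cont continuous_kerr_fields[OF J]
  show g': "continuous_on off_axis (\<lambda>x. gfun' (S x))"
  proof (rule continuous_on_compose2[OF _ perturb_cont(4)])
    show "continuous_on {-1<..<1} gfun'"
      by (intro continuous_at_imp_continuous_on ballI DERIV_isCont[OF gfun'_deriv]) (auto simp: abs_less_iff)
    show "S ` off_axis \<subseteq> {-1<..<1}" using S_abs by (force simp: abs_less_iff)
  qed
  show a: "continuous_on off_axis a" unfolding a_def[abs_def] by (intro I)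
  show b: "continuous_on off_axis b" unfolding b_def[abs_def] by (intro I)
  have X: "\<forall>x\<in>off_axis. X0 J x \<noteq> 0" using X0_pos by force
  show q: "continuous_on off_axis q" unfolding q_def[abs_def] by (intro I continuous_on_divide X)
  have ex: "continuous_on off_axis (\<lambda>x. exp (\<alpha> x))" by (intro continuous_on_exp perturb_cont)
  show dS: "continuous_on off_axis dS" unfolding dS_def[abs_def] by (intro I a q ex)
  show dG: "continuous_on off_axis dG" unfolding dG_def[abs_def] by (intro I dS g')
  show dk: "continuous_on off_axis dk" unfolding dk_def[abs_def] by (intro I dS g')
  show "continuous_on off_axis F" unfolding F_def[abs_def] by (intro I)
  show D: "continuous_on off_axis D" unfolding D_def[abs_def] by (intro I dG dk a b q)
  show e0: "continuous_on off_axis e0" unfolding e0_def[abs_def] by (intro I b)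
  show e1: "continuous_on off_axis e1" unfolding e1_def[abs_def] by (intro I b q)
  show "continuous_on off_axis Q" unfolding Q_def[abs_def] by (intro I e0 e1 D)
qed

section \<open>The divergence of the flux under a cutoff\<close>

lemma measurable_off_axis:
  assumes "continuous_on off_axis (f :: real^3 \<Rightarrow> real)"
  shows "(off_axis_ext f) \<in> borel_measurable borel"
proof -
  have "(\<lambda>x. indicator off_axis x *\<^sub>R f x) \<in> borel_measurable borel"
    using open_off_axis by (intro borel_measurable_continuous_on_indicator assms) auto
  moreover have "(\<lambda>x. indicator off_axis x *\<^sub>R f x) = (off_axis_ext f)" by auto
  ultimately show ?thesis by simp
qed

lemma integral_cutoff_divergence:
  assumes W: "div_on_off_axis W d" and N: "0 < N"
    and \<psi>: "\<And>x. x \<in> off_axis \<Longrightarrow> GDERIV \<psi> x :> g\<psi> x" and g\<psi>: "continuous_on off_axis g\<psi>"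
  shows "has_bochner_integral lborel (\<lambda>x. if x \<in> off_axis then
      \<psi> x * (cutoff_grad N x \<bullet> W x) + cutoff N x * (g\<psi> x \<bullet> W x + \<psi> x * d x) else 0) 0"
proof -
  obtain V where V: "\<And>x i. x \<in> off_axis \<Longrightarrow> GDERIV (\<lambda>x. W x $ i) x :> V i x"
    "\<And>i. continuous_on off_axis (\<lambda>x. V i x $ i)" "\<And>x. x \<in> off_axis \<Longrightarrow> (\<Sum>i\<in>UNIV. V i x $ i) = d x"
    using W unfolding div_on_off_axis_def by blast
  have cN: "continuous_on off_axis (cutoff N)"
    by (rule GDERIV_imp_continuous_on[OF cutoff_GDERIV[OF N]])
  have "has_bochner_integral lborel (\<lambda>x. if x \<in> off_axis then
      (cutoff N x *\<^sub>R g\<psi> x + \<psi> x *\<^sub>R cutoff_grad N x) \<bullet> W x + (cutoff N x * \<psi> x) * (\<Sum>i\<in>UNIV. V i x $ i) else 0) 0"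
  proof (rule integral_divergence_eq_0[OF open_off_axis cutoff_supp_compact[OF N] _ _ _ V(1,2)])
    show "cutoff N x * \<psi> x = 0" if "x \<notin> cutoff_supp N" for x using cutoff_supp[OF N that] by simp
    show "GDERIV (\<lambda>x. cutoff N x * \<psi> x) x :> cutoff N x *\<^sub>R g\<psi> x + \<psi> x *\<^sub>R cutoff_grad N x" if "x \<in> off_axis" for x
      by (rule GDERIV_mult[OF cutoff_GDERIV[OF N] \<psi>[OF that]])
    show "continuous_on off_axis (\<lambda>x. cutoff N x *\<^sub>R g\<psi> x + \<psi> x *\<^sub>R cutoff_grad N x)"
      by (intro continuous_on_add continuous_on_scaleR cN g\<psi> GDERIV_imp_continuous_on[OF \<psi>] cutoff_grad_continuous[OF N])
  qed
  moreover have "(if x \<in> off_axis then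
      (cutoff N x *\<^sub>R g\<psi> x + \<psi> x *\<^sub>R cutoff_grad N x) \<bullet> W x + (cutoff N x * \<psi> x) * (\<Sum>i\<in>UNIV. V i x $ i) else 0)
    = (if x \<in> off_axis then
      \<psi> x * (cutoff_grad N x \<bullet> W x) + cutoff N x * (g\<psi> x \<bullet> W x + \<psi> x * d x) else 0)" for x
    using V(3)[of x] by (simp add: inner_add_left algebra_simps)
  ultimately show ?thesis by simp
qed

text \<open>The flux is a sum of scalar functions times fields of known divergence, so no second
  derivative of the perturbation occurs. The field equations turn its divergence into
  \<open>D\<close>: the Laplacian of v_0 gives the term with |b|^2, and the other two fields are
  divergence-free.\<close>

lemma integral_flux_divergence:
  assumes N: "0 < N"
  shows "has_bochner_integral lborel
    (\<lambda>x. if x \<in> off_axis then cutoff_grad N x \<bullet> F x + cutoff N x * D x else 0) 0"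
proof -
  note c = perturb_cont density_cont
  have 1: "has_bochner_integral lborel (\<lambda>x. if x \<in> off_axis then
      G x * (cutoff_grad N x \<bullet> grad_v0 J x) + cutoff N x * (dG x \<bullet> grad_v0 J x + G x * - (X0 J x * norm (twist_field J x))\<^sup>2) else 0) 0"
    by (rule integral_cutoff_divergence[OF div_grad_v0[OF J] N G_GDERIV c(17)])
  have H: "GDERIV (\<lambda>x. 2 * (G x - \<alpha> x)) x :> 2 *\<^sub>R (dG x - ga x)" if "x \<in> off_axis" for x
    by (rule GDERIV_subst[OF GDERIV_mult[OF GDERIV_const GDERIV_diff[OF G_GDERIV[OF that] ga]]]) simp
  have 2: "has_bochner_integral lborel (\<lambda>x. if x \<in> off_axis then
      (2 * (G x - \<alpha> x)) * (cutoff_grad N x \<bullet> grad_ln_rho x)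
       + cutoff N x * ((2 *\<^sub>R (dG x - ga x)) \<bullet> grad_ln_rho x + (2 * (G x - \<alpha> x)) * 0) else 0) 0"
    by (rule integral_cutoff_divergence[OF div_grad_ln_rho N H], assumption)
       (intro continuous_on_scaleR continuous_on_diff continuous_on_const c)
  have 3: "has_bochner_integral lborel (\<lambda>x. if x \<in> off_axis then
      (k x * y x) * (cutoff_grad N x \<bullet> twist_field J x)
       + cutoff N x * ((k x *\<^sub>R gy x + y x *\<^sub>R dk x) \<bullet> twist_field J x + (k x * y x) * 0) else 0) 0"
    by (rule integral_cutoff_divergence[OF div_twist_field[OF J] N GDERIV_mult[OF k_GDERIV gy]], assumption)
       (intro continuous_on_scaleR continuous_on_add c)
  note has_bochner_integral_add[OF has_bochner_integral_add[OF 1 2] 3]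
  moreover have "G x * (cutoff_grad N x \<bullet> grad_v0 J x) + cutoff N x * (dG x \<bullet> grad_v0 J x + G x * - (X0 J x * norm (twist_field J x))\<^sup>2)
     + ((2 * (G x - \<alpha> x)) * (cutoff_grad N x \<bullet> grad_ln_rho x)
       + cutoff N x * ((2 *\<^sub>R (dG x - ga x)) \<bullet> grad_ln_rho x + (2 * (G x - \<alpha> x)) * 0))
     + ((k x * y x) * (cutoff_grad N x \<bullet> twist_field J x)
       + cutoff N x * ((k x *\<^sub>R gy x + y x *\<^sub>R dk x) \<bullet> twist_field J x + (k x * y x) * 0))
     = cutoff_grad N x \<bullet> F x + cutoff N x * D x" if "x \<in> off_axis" for x
  proof -
    have X: "X0 J x \<noteq> 0" using X0_pos[OF that] by simp
    have "w x * (dk x \<bullet> b x) = y x * (dk x \<bullet> twist_field J x)" "q x \<bullet> b x = gy x \<bullet> twist_field J x"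
      "b x \<bullet> b x = (X0 J x * norm (twist_field J x))\<^sup>2"
      using X by (simp_all add: w_def b_def q_def power_mult_distrib power2_norm_eq_inner) (simp add: power2_eq_square)
    then show ?thesis
      unfolding F_def D_def a_def
      by (simp add: inner_add_left inner_add_right inner_diff_left algebra_simps)
  qed
  ultimately show ?thesis
    by (simp cong: if_cong add: if_distrib[of "\<lambda>u. u + _"] )
qed

section \<open>Size of the flux and of the unperturbed energy\<close>

lemma sigma_powr_le_1: "sigma x powr \<beta> \<le> 1" "0 \<le> sigma x powr \<beta>"
  using powr_mono[of \<beta> 0 "sigma x"] \<beta> sigma_ge_1[of x] by auto

lemma exp_bounds:
  assumes "x \<in> off_axis" shows "\<bar>sinh (\<alpha> x)\<bar> \<le> 2" "E x \<le> 4"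
proof -
  have c: "cosh (\<alpha> x) \<le> 2" using S_bounds(1)[of x] S_abs[OF assms] by linarith
  then have "exp (\<alpha> x) + exp (- \<alpha> x) \<le> 4" by (simp add: cosh_def)
  moreover have "0 < exp (\<alpha> x)" "0 < exp (- \<alpha> x)" by auto
  moreover have "\<bar>(u - v) / 2\<bar> \<le> 2 \<and> v \<le> 4" if "u + v \<le> 4" "0 < u" "0 < v" for u v :: real
    using that by (auto simp: abs_le_iff)
  ultimately have "\<bar>sinh (\<alpha> x)\<bar> \<le> 2 \<and> E x \<le> 4"
    unfolding sinh_field_def E_def by blast
  then show "\<bar>sinh (\<alpha> x)\<bar> \<le> 2" "E x \<le> 4" by auto
qed

lemma w_bound:
  assumes x: "x \<in> off_axis"
  shows "\<bar>w x\<bar> \<le> indicator (Omega_rho \<rho>0) x * (sigma x powr \<beta> / (cyl_rho x)\<^sup>2)"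
proof (cases "x \<in> Omega_rho \<rho>0")
  case True
  have "\<bar>w x\<bar> = \<bar>y x\<bar> / X0 J x" using X0_pos[OF x] by (simp add: w_def)
  also have "\<dots> \<le> sigma x powr \<beta> / (cyl_rho x)\<^sup>2"
    using y_bound[of x] X0_ge(1)[OF J x] cyl_rho_pos[OF x] by (intro frac_le) auto
  finally show ?thesis using True by simp
next
  case False
  then have "y x = 0" using y_axis by (auto simp: Omega_rho_def not_less)
  then show ?thesis by (simp add: w_def)
qed

lemma w_bound_uniform: assumes x: "x \<in> off_axis" shows "\<bar>w x\<bar> \<le> sigma x powr \<beta> / \<rho>0\<^sup>2"
proof (cases "x \<in> Omega_rho \<rho>0")
  case True
  have "\<bar>w x\<bar> \<le> sigma x powr \<beta> / (cyl_rho x)\<^sup>2" using w_bound[OF x] True by simp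
  also have "\<dots> \<le> sigma x powr \<beta> / \<rho>0\<^sup>2"
    using True \<rho>0 by (intro divide_left_mono power_mono) (auto simp: Omega_rho_def)
  finally show ?thesis .
next
  case False
  then have "\<bar>w x\<bar> \<le> 0" using w_bound[OF x] by simp
  also have "0 \<le> sigma x powr \<beta> / \<rho>0\<^sup>2" by simp
  finally show ?thesis .
qed

text \<open>If w = 0 the geodesic is vertical and \<open>G\<close> = \<alpha> by
  \<open>gfun_sinh\<close>. In general S exceeds cosh \<alpha> - 1 by t = E w^2 / 2 <= 2 w^2, and
  the Lipschitz bound for \<open>gfun\<close> with |sinh \<alpha>| <= 2 gives 3 t. This tames the
  coefficient of grad ln \<rho>, a field as large as 1 / \<rho>.\<close>

lemma G_bound: assumes x: "x \<in> off_axis" shows "\<bar>G x - \<alpha> x\<bar> \<le> 6 * (w x)\<^sup>2"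
proof -
  define t where "t = E x * (w x)\<^sup>2 / 2"
  have t: "0 \<le> t" "t \<le> 2 * (w x)\<^sup>2"
    using E_pos[of x] exp_bounds(2)[OF x] by (auto simp: t_def mult_right_mono)
  define C where "C = cosh (\<alpha> x) - 1"
  have C: "0 \<le> C" "C \<le> S x" "S x = C + t" "C \<le> s0" "S x \<le> s0"
    using cosh_real_ge_1[of "\<alpha> x"] S_bounds[of x] x by (auto simp: C_def t_def S_eq)
  have "gfun C * sinh (\<alpha> x) = \<alpha> x" unfolding C_def using gfun_sinh[OF s0] C(4) by (simp add: C_def)
  moreover have "1 + S x - E x = sinh (\<alpha> x) + t"
    by (simp add: S_def t_def sinh_def E_def field_simps)
  ultimately have "G x - \<alpha> x = (gfun (S x) - gfun C) * sinh (\<alpha> x) + gfun (S x) * t"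
    by (simp add: G_def algebra_simps)
  also have "\<bar>\<dots>\<bar> \<le> \<bar>gfun (S x) - gfun C\<bar> * \<bar>sinh (\<alpha> x)\<bar> + \<bar>gfun (S x)\<bar> * \<bar>t\<bar>"
    by (rule order_trans[OF abs_triangle_ineq]) (simp add: abs_mult)
  also have "\<dots> \<le> t * 2 + 1 * t"
    using g_lipschitz[OF C(1,2,5)] exp_bounds(1)[OF x] g_nonneg[of "S x"] g_le_1[of "S x"] C t
    by (intro add_mono mult_mono) auto
  finally show ?thesis using t by simp
qed

lemma k_bound: assumes x: "x \<in> off_axis" shows "\<bar>k x\<bar> \<le> 4"
proof -
  have "\<bar>k x\<bar> = \<bar>gfun (S x)\<bar> * E x" using E_pos[of x] by (simp add: k_def abs_mult)
  also have "\<dots> \<le> 1 * 4"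
    using g_nonneg[of "S x"] g_le_1[of "S x"] S_bounds[of x] x exp_bounds(2)[OF x] E_pos[of x]
    by (intro mult_mono) auto
  finally show ?thesis by simp
qed

lemma norm_grad_ln_rho: assumes "x \<in> off_axis" shows "norm (grad_ln_rho x) = 1 / cyl_rho x"
  unfolding grad_ln_rho_eq[OF assms] using cyl_rho_pos[OF assms]
  by (simp add: norm_vector_cyl power2_eq_square)

text \<open>Trades the Kerr length scale for the scale 1 of sigma: 1 + r <= (1 + 1/m) (r +
  m).\<close>

definition "radius_const = (1 + 1 / m0 J)"

lemma radius_bound: assumes "0 \<le> r" shows "1 / (r + m0 J) \<le> radius_const / (1 + r)"
proof -
  have m: "0 < m0 J" by (rule m0_pos[OF J])
  have "1 + r \<le> radius_const * (r + m0 J)" using m assms by (simp add: radius_const_def field_simps)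
  then show ?thesis using m assms by (simp add: field_simps)
qed

text \<open>The factor 56 is 2 times 28: sigma >= (1 + r) / 2 costs a factor (1/2) powr (-1/2) <= 2,
  and 28 is the constant of the twist bound, which also covers the gradient of v_0.\<close>

lemma far_bound:
  assumes x: "x \<in> off_axis"
  shows "sigma x powr \<beta> * (28 * m0 J / (norm x * (norm x + m0 J))) / cyl_rho x \<le> 56 * m0 J * radius_const * dom_far x"
proof -
  define r where "r = norm x"
  have r: "0 < r" using off_axis_polar(1)[OF x] by (simp add: r_def)
  have m: "0 < m0 J" by (rule m0_pos[OF J])
  have p: "0 < cyl_rho x" by (rule cyl_rho_pos[OF x])
  have radius_const: "0 < radius_const" using m by (simp add: radius_const_def add_pos_pos)
  have "sigma x powr \<beta> \<le> sigma x powr (-1/2)" using \<beta> sigma_ge_1[of x] by (intro powr_mono) auto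
  also have "\<dots> \<le> ((1 + r) / 2) powr (-1/2)"
    using sigma_ge_norm(1)[of x] r by (intro powr_mono2') (auto simp: r_def add_pos_nonneg)
  also have "\<dots> = (1 / 2) powr (-1/2) * (1 + r) powr (-1/2)"
    using r powr_mult[of "1/2" "1 + r" "-1/2"] by simp
  also have "\<dots> \<le> 2 * (1 + r) powr (-1/2)"
  proof (rule mult_right_mono)
    have "(1 / 2 :: real) powr (-1/2) \<le> (1/2) powr (-1)" by (intro powr_mono') auto
    then show "(1 / 2 :: real) powr (-1/2) \<le> 2" by (simp add: powr_minus_divide)
  qed simp
  finally have s: "sigma x powr \<beta> \<le> 2 * (1 + r) powr (-1/2)" .
  have "sigma x powr \<beta> * (1 / (r + m0 J)) \<le> (2 * (1 + r) powr (-1/2)) * (radius_const / (1 + r))"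
    using s radius_bound[of r] r m by (intro mult_mono) auto
  also have "\<dots> = 2 * radius_const / (1 + r) powr (3/2)"
  proof -
    have "(1 + r) powr (3/2) = (1 + r) * (1 + r) powr (1/2)" using r by (simp add: powr_mult_base)
    then show ?thesis by (simp add: powr_minus_divide)
  qed
  finally have "28 * m0 J / (r * cyl_rho x) * (sigma x powr \<beta> * (1 / (r + m0 J)))
      \<le> 28 * m0 J / (r * cyl_rho x) * (2 * radius_const / (1 + r) powr (3/2))"
    using r m p by (intro mult_left_mono) auto
  then show ?thesis unfolding dom_far_def r_def[symmetric] by (simp add: mult_ac)
qed

text \<open>The density is O(r^-2 (1 + r)^-2), integrable at both ends; \<rho> <= r brings it under
  the function that also dominates the flux.\<close>

lemma e0_bound:
  assumes x: "x \<in> off_axis"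
  shows "e0 x \<le> 2 * (28 * m0 J * radius_const)\<^sup>2 * dom_far x"
proof -
  define r where "r = norm x"
  have r: "0 < r" using off_axis_polar(1)[OF x] by (simp add: r_def)
  have m: "0 < m0 J" by (rule m0_pos[OF J])
  have p: "0 < cyl_rho x" "cyl_rho x \<le> r" using cyl_rho_pos[OF x] cyl_rho_le_norm by (auto simp: r_def)
  have radius_const: "0 < radius_const" using m by (simp add: radius_const_def add_pos_pos)
  define B where "B = 28 * m0 J / (r * (r + m0 J))"
  have "20 * m0 J / (r * (r + m0 J)) \<le> B" unfolding B_def using r m by (intro divide_right_mono) auto
  then have "norm (grad_v0 J x) \<le> B" using grad_v0_bound[OF J x] by (simp add: r_def)
  moreover have "norm (b x) \<le> B"
    using twist_field_bound[OF J x] X0_pos[OF x] by (simp add: b_def B_def r_def)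
  ultimately have "e0 x \<le> B\<^sup>2 + B\<^sup>2" unfolding e0_def by (intro add_mono power_mono) auto
  also have "\<dots> = 2 * (28 * m0 J / r * (1 / (r + m0 J)))\<^sup>2" by (simp add: B_def)
  also have "\<dots> \<le> 2 * (28 * m0 J / r * (radius_const / (1 + r)))\<^sup>2"
    using radius_bound[of r] r m by (intro mult_left_mono power_mono) auto
  also have "\<dots> = 2 * (28 * m0 J * radius_const)\<^sup>2 * (1 / (r * r * (1 + r)\<^sup>2))"
    by (simp add: power_mult_distrib power_divide power2_eq_square)
  also have "\<dots> \<le> 2 * (28 * m0 J * radius_const)\<^sup>2 * dom_far x"
  proof (rule mult_left_mono)
    have "(1 + r) powr (3/2) \<le> (1 + r) powr 2" using r by (intro powr_mono) auto
    then have "(1 + r) powr (3/2) \<le> (1 + r)\<^sup>2" using r by (simp add: powr_numeral)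
    then have "cyl_rho x * r * (1 + r) powr (3/2) \<le> r * r * (1 + r)\<^sup>2"
      using p r by (intro mult_mono) auto
    moreover have "0 < cyl_rho x * r * (1 + r) powr (3/2)" using p r by simp
    ultimately show "1 / (r * r * (1 + r)\<^sup>2) \<le> dom_far x"
      unfolding dom_far_def r_def[symmetric] by (intro divide_left_mono) (auto intro!: mult_pos_pos simp: r)
  qed simp
  finally show ?thesis .
qed

text \<open>Division by \<rho> anticipates the gradient of a cutoff. The coefficients 1, 6 /
  \<rho>0^4 and 4 / \<rho>0^2 stem from \<alpha>, from \<open>G\<close> - \<alpha> and from
  \<open>k\<close> w, each multiplied by a decaying Kerr field. The term with grad ln \<rho> has no
  such factor and relies on w^2 and its support.\<close>

lemma F_bound:
  assumes x: "x \<in> off_axis"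
  shows "norm (F x) / cyl_rho x
    \<le> (1 + 6 / \<rho>0 ^ 4 + 4 / \<rho>0\<^sup>2) * (56 * m0 J * radius_const) * dom_far x + 12 * dom_cyl \<beta> \<rho>0 x"
proof -
  define r where "r = norm x"
  have r: "0 < r" using off_axis_polar(1)[OF x] by (simp add: r_def)
  have m: "0 < m0 J" by (rule m0_pos[OF J])
  have p: "0 < cyl_rho x" by (rule cyl_rho_pos[OF x])
  define s where "s = sigma x powr \<beta>"
  have s: "0 \<le> s" "s \<le> 1" using sigma_powr_le_1 by (auto simp: s_def)
  define B where "B = 28 * m0 J / (r * (r + m0 J))"
  have B0: "0 \<le> B" using r m by (simp add: B_def)
  have "20 * m0 J / (r * (r + m0 J)) \<le> B" unfolding B_def using r m by (intro divide_right_mono) auto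
  then have v: "norm (grad_v0 J x) \<le> B" using grad_v0_bound[OF J x] by (simp add: r_def)
  have bB: "norm (b x) \<le> B"
    using twist_field_bound[OF J x] X0_pos[OF x] by (simp add: b_def B_def r_def)
  have ky: "(k x * y x) *\<^sub>R twist_field J x = (k x * w x) *\<^sub>R b x"
    using X0_pos[OF x] by (simp add: w_def b_def)
  have w1: "\<bar>w x\<bar> \<le> s / \<rho>0\<^sup>2" using w_bound_uniform[OF x] by (simp add: s_def)
  have w2: "(w x)\<^sup>2 \<le> s / \<rho>0 ^ 4"
  proof -
    have "(w x)\<^sup>2 = \<bar>w x\<bar> * \<bar>w x\<bar>" by (simp add: power2_eq_square)
    also have "\<dots> \<le> (s / \<rho>0\<^sup>2) * (1 / \<rho>0\<^sup>2)"
      using w1 s \<rho>0 by (intro mult_mono order_trans[OF w1] divide_right_mono) auto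
    also have "\<dots> = s / \<rho>0 ^ 4" by (simp flip: power_add)
    finally show ?thesis .
  qed
  have w3: "(w x)\<^sup>2 / (cyl_rho x)\<^sup>2 \<le> dom_cyl \<beta> \<rho>0 x"
  proof -
    have "(w x)\<^sup>2 \<le> (indicator (Omega_rho \<rho>0) x * (s / (cyl_rho x)\<^sup>2))\<^sup>2"
      using power_mono[OF w_bound[OF x], of 2] by (simp add: s_def)
    also have "\<dots> = indicator (Omega_rho \<rho>0) x * (s\<^sup>2 / (cyl_rho x) ^ 4)"
      by (simp add: indicator_def power_divide flip: power_mult)
    also have "s\<^sup>2 = sigma x powr (2 * \<beta>)"
      unfolding s_def power2_eq_square by (simp flip: powr_add)
    finally have "(w x)\<^sup>2 / (cyl_rho x)\<^sup>2 \<le> indicator (Omega_rho \<rho>0) x * (sigma x powr (2 * \<beta>) / (cyl_rho x) ^ 4) / (cyl_rho x)\<^sup>2"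
      by (intro divide_right_mono) auto
    also have "\<dots> = dom_cyl \<beta> \<rho>0 x" by (simp add: dom_cyl_def flip: power_add)
    finally show ?thesis .
  qed
  have "norm (F x) \<le> norm (G x *\<^sub>R grad_v0 J x) + norm ((2 * (G x - \<alpha> x)) *\<^sub>R grad_ln_rho x)
     + norm ((k x * w x) *\<^sub>R b x)"
    unfolding F_def ky by (intro order_trans[OF norm_triangle_ineq] add_right_mono norm_triangle_ineq)
  also have "\<dots> \<le> (s + 6 * (s / \<rho>0 ^ 4)) * B + 12 * (w x)\<^sup>2 * (1 / cyl_rho x) + 4 * (s / \<rho>0\<^sup>2) * B"
  proof (intro add_mono)
    have "\<bar>G x\<bar> \<le> s + 6 * (w x)\<^sup>2" using G_bound[OF x] \<alpha>_bound[of x] unfolding s_def by linarith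
    also have "\<dots> \<le> s + 6 * (s / \<rho>0 ^ 4)" using w2 by simp
    finally show "norm (G x *\<^sub>R grad_v0 J x) \<le> (s + 6 * (s / \<rho>0 ^ 4)) * B"
      unfolding norm_scaleR using v by (intro mult_mono) auto
    have "\<bar>2 * (G x - \<alpha> x)\<bar> \<le> 12 * (w x)\<^sup>2" using G_bound[OF x] by (simp add: abs_mult)
    then show "norm ((2 * (G x - \<alpha> x)) *\<^sub>R grad_ln_rho x) \<le> 12 * (w x)\<^sup>2 * (1 / cyl_rho x)"
      unfolding norm_scaleR norm_grad_ln_rho[OF x] using p by (intro mult_right_mono) auto
    have "\<bar>k x * w x\<bar> \<le> 4 * (s / \<rho>0\<^sup>2)"
      unfolding abs_mult using k_bound[OF x] w1 by (intro mult_mono) auto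
    then show "norm ((k x * w x) *\<^sub>R b x) \<le> 4 * (s / \<rho>0\<^sup>2) * B"
      unfolding norm_scaleR using bB s \<rho>0 by (intro mult_mono) auto
  qed
  also have "\<dots> = (1 + 6 / \<rho>0 ^ 4 + 4 / \<rho>0\<^sup>2) * (s * B) + 12 * ((w x)\<^sup>2 / cyl_rho x)"
    by (simp add: algebra_simps)
  finally have "norm (F x) / cyl_rho x \<le> ((1 + 6 / \<rho>0 ^ 4 + 4 / \<rho>0\<^sup>2) * (s * B) + 12 * ((w x)\<^sup>2 / cyl_rho x)) / cyl_rho x"
    using p by (intro divide_right_mono) auto
  also have "\<dots> = (1 + 6 / \<rho>0 ^ 4 + 4 / \<rho>0\<^sup>2) * (s * B / cyl_rho x) + 12 * ((w x)\<^sup>2 / (cyl_rho x)\<^sup>2)"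
    by (simp add: add_divide_distrib power2_eq_square)
  also have "\<dots> \<le> (1 + 6 / \<rho>0 ^ 4 + 4 / \<rho>0\<^sup>2) * (56 * m0 J * radius_const * dom_far x) + 12 * dom_cyl \<beta> \<rho>0 x"
    using far_bound[OF x] w3 \<rho>0 unfolding s_def B_def r_def
    by (intro add_mono mult_left_mono) (auto intro!: add_nonneg_nonneg)
  finally show ?thesis by (simp add: mult.assoc)
qed

text \<open>A vertical line through a point off the axis stays off it, so a vanishing gradient makes
  S constant along it, and the decay of \<alpha> and w at its end forces the constant to be 0. Then
  the maps agree off the axis and, by continuity, everywhere.\<close>

lemma dS_nonzero:
  assumes "\<alpha> x0 \<noteq> 0 \<or> y x0 \<noteq> 0"
  shows "\<exists>x\<in>off_axis. dS x \<noteq> 0"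
proof (rule ccontr)
  assume "\<not> ?thesis"
  then have dS0: "\<And>x. x \<in> off_axis \<Longrightarrow> dS x = 0" by blast
  have S0: "S x = 0" if x: "x \<in> off_axis" for x
  proof -
    define l where "l t = x + t *\<^sub>R axis 3 1" for t :: real
    have lU: "l t \<in> off_axis" for t using x by (auto simp: l_def off_axis_def axis_def)
    have "((\<lambda>t. S (l t)) has_real_derivative 0) (at t)" for t
    proof -
      have "(l has_derivative (\<lambda>s. s *\<^sub>R axis 3 1)) (at t)"
        unfolding l_def[abs_def] by (auto intro!: derivative_eq_intros)
      moreover have "(S has_derivative (\<lambda>h. h \<bullet> dS (l t))) (at (l t))"
        using S_GDERIV[OF lU] by (simp add: gderiv_def)
      ultimately have "((\<lambda>t. S (l t)) has_derivative (\<lambda>s. (s *\<^sub>R axis 3 1) \<bullet> dS (l t))) (at t)"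
        by (rule has_derivative_compose[where g=S])
      then show ?thesis by (simp add: has_field_derivative_def dS0[OF lU] flip: lambda_zero)
    qed
    then have const: "S (l t) = S (l 0)" for t
      by (metis DERIV_isconst_all)
    have lim: "((\<lambda>t. sigma (l t) powr \<beta>) \<longlongrightarrow> 0) at_top"
    proof (rule tendsto_neg_powr)
      show "\<beta> < 0" using \<beta> by simp
      show "filterlim (\<lambda>t. sigma (l t)) at_top at_top"
      proof (rule filterlim_at_top_mono)
        show "filterlim (\<lambda>t. x $ 3 + t) at_top (at_top :: real filter)"
          by (intro filterlim_tendsto_add_at_top[OF tendsto_const] filterlim_ident)
        have "x $ 3 + t \<le> sigma (l t)" for t
          using component_le_norm_cart[of "l t" 3] sigma_ge_norm(2)[of "l t"] by (simp add: l_def axis_def)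
        then show "\<forall>\<^sub>F t in at_top. x $ 3 + t \<le> sigma (l t)" by simp
      qed
    qed
    have a0: "((\<lambda>t. \<alpha> (l t)) \<longlongrightarrow> 0) at_top"
      by (rule Lim_null_comparison[OF _ lim]) (simp add: \<alpha>_bound)
    have "((\<lambda>t. sigma (l t) powr \<beta> / \<rho>0\<^sup>2) \<longlongrightarrow> 0 / \<rho>0\<^sup>2) at_top"
      by (intro tendsto_divide lim tendsto_const) (use \<rho>0 in simp)
    then have w0: "((\<lambda>t. w (l t)) \<longlongrightarrow> 0) at_top"
      by (intro Lim_null_comparison[of "\<lambda>t. w (l t)"]) (auto simp: w_bound_uniform[OF lU])
    have "((\<lambda>t. S (l t)) \<longlongrightarrow> (exp 0 + exp (- 0) + exp (- 0) * 0\<^sup>2) / 2 - 1) at_top"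
      unfolding S_def E_def by (intro tendsto_intros a0 w0) auto
    then have "((\<lambda>t. S (l t)) \<longlongrightarrow> 0) at_top" by simp
    then have "((\<lambda>t::real. S (l 0)) \<longlongrightarrow> 0) at_top" by (subst (asm) const)
    then show ?thesis by (simp add: tendsto_const_iff l_def)
  qed
  have \<alpha>0: "\<alpha> x = 0" "y x = 0" if "x \<in> off_axis" for x
  proof -
    have "cosh (\<alpha> x) - 1 \<ge> 0" "E x * (w x)\<^sup>2 / 2 \<ge> 0" using cosh_real_ge_1[of "\<alpha> x"] E_pos[of x] by auto
    then have "cosh (\<alpha> x) = 1" "E x * (w x)\<^sup>2 / 2 = 0" using S0[OF that] unfolding S_eq by linarith+
    then show "\<alpha> x = 0" "y x = 0"
      using E_pos[of x] X0_pos[OF that] cosh_real_one_iff by (auto simp: w_def)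
  qed
  \<comment> \<open>A point of the axis is approached along the first coordinate direction, which
    leaves the axis at once.\<close>
  have "f x0 = 0" if f0: "\<And>x. x \<in> off_axis \<Longrightarrow> f x = 0" and fg: "\<And>x. GDERIV f x :> gf x" for f gf
  proof -
    have "isCont f x0" using fg[of x0] has_derivative_continuous unfolding gderiv_def by blast
    moreover have "((\<lambda>n. x0 + inverse (real (Suc n)) *\<^sub>R axis 1 1) \<longlongrightarrow> x0 + 0 *\<^sub>R axis 1 1) sequentially"
      by (intro tendsto_add tendsto_scaleR tendsto_const LIMSEQ_inverse_real_of_nat)
    ultimately have "(\<lambda>n. f (x0 + inverse (real (Suc n)) *\<^sub>R axis 1 1)) \<longlonglongrightarrow> f x0"
      using isCont_tendsto_compose[of x0 f] by simp
    moreover have "f (x0 + inverse (real (Suc n)) *\<^sub>R axis 1 1) = 0" if "x0 \<notin> off_axis" for n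
      by (rule f0) (use that in \<open>simp add: off_axis_def axis_def\<close>)
    ultimately show ?thesis using f0[of x0] by (cases "x0 \<in> off_axis") (auto simp: LIMSEQ_const_iff)
  qed
  from this[OF \<alpha>0(1) ga] this[OF \<alpha>0(2) gy] assms show False by blast
qed

lemma integrable_off_axis:
  fixes f h :: "real^3 \<Rightarrow> real"
  assumes "continuous_on off_axis f" "integrable lborel h" "\<And>x. x \<in> off_axis \<Longrightarrow> \<bar>f x\<bar> \<le> h x"
  shows "integrable lborel (off_axis_ext f)"
proof (rule Bochner_Integration.integrable_bound[OF assms(2)])
  show "(off_axis_ext f) \<in> borel_measurable lborel"
    using measurable_off_axis[OF assms(1)] by simp
  show "AE x in lborel. norm (off_axis_ext f x) \<le> norm (h x)"
    using AE_off_axis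
  proof eventually_elim
    case (elim x)
    then show ?case using order_trans[OF assms(3) abs_ge_self] by simp
  qed
qed

lemma e0_integrable: "integrable lborel (off_axis_ext e0)"
proof (rule integrable_off_axis[OF density_cont(10)])
  show "integrable lborel (\<lambda>x. 2 * (28 * m0 J * radius_const)\<^sup>2 * dom_far x)"
    by (intro integrable_mult_right dom_far_integrable)
  show "\<bar>e0 x\<bar> \<le> 2 * (28 * m0 J * radius_const)\<^sup>2 * dom_far x" if "x \<in> off_axis" for x
    using e0_bound[OF that] by (simp add: e0_def)
qed

text \<open>For a cutoff \<eta>, the integral of \<eta> Q is that of \<eta> (e1 - e0) plus twice
  that of the inner product of grad \<eta> with F. The last term tends to 0 by domination, the
  middle one to the energy difference, and the left side is increasing, so it suffices that it is
  positive for one cutoff.\<close>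

lemma energy_strict:
  assumes ne: "\<alpha> x0 \<noteq> 0 \<or> y x0 \<noteq> 0"
    and int: "integrable lborel (off_axis_ext e1)"
  shows "integral\<^sup>L lborel (off_axis_ext e0) < integral\<^sup>L lborel (off_axis_ext e1)"
proof -
  define ed where "ed x = (if x \<in> off_axis then e1 x - e0 x else 0)" for x
  have ed_int: "integrable lborel ed"
  proof -
    have "ed = (\<lambda>x. off_axis_ext e1 x - off_axis_ext e0 x)"
      by (auto simp: ed_def)
    then show ?thesis using int e0_integrable by simp
  qed
  have ed_eq: "integral\<^sup>L lborel ed = integral\<^sup>L lborel (off_axis_ext e1) - integral\<^sup>L lborel (off_axis_ext e0)"
    unfolding ed_def by (subst Bochner_Integration.integral_diff[OF int e0_integrable, symmetric]) (auto intro!: Bochner_Integration.integral_cong)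
  define N where "N n = real (Suc n)" for n
  have N: "0 < N n" for n by (simp add: N_def)
  define CF where "CF x = 12 * ((1 + 6 / \<rho>0 ^ 4 + 4 / \<rho>0\<^sup>2) * (56 * m0 J * radius_const) * dom_far x + 12 * dom_cyl \<beta> \<rho>0 x)" for x
  have CF: "integrable lborel CF"
    unfolding CF_def by (intro integrable_mult_right Bochner_Integration.integrable_add dom_far_integrable dom_cyl_integrable \<beta> \<rho>0)
  define P where "P n x = (if x \<in> off_axis then cutoff_grad (N n) x \<bullet> F x else 0)" for n x
  have cN: "continuous_on off_axis (cutoff (N n))" for n
    by (rule GDERIV_imp_continuous_on[OF cutoff_GDERIV[OF N]])
  have P_m: "P n \<in> borel_measurable lborel" for n
    unfolding P_def using measurable_off_axis[OF continuous_on_inner[OF cutoff_grad_continuous[OF N] density_cont(8)]] by simp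
  have P_le: "\<bar>P n x\<bar> \<le> CF x" if x: "x \<in> off_axis" for n x
  proof -
    have "\<bar>P n x\<bar> \<le> norm (cutoff_grad (N n) x) * norm (F x)"
      using x Cauchy_Schwarz_ineq2 by (simp add: P_def)
    also have "\<dots> \<le> 12 / cyl_rho x * norm (F x)"
      by (intro mult_right_mono cutoff_grad_bounds(1)[OF N x]) auto
    also have "\<dots> = 12 * (norm (F x) / cyl_rho x)" by simp
    also have "\<dots> \<le> CF x" unfolding CF_def by (intro mult_left_mono F_bound[OF x]) auto
    finally show ?thesis .
  qed
  have P_bd: "AE x in lborel. norm (P n x) \<le> CF x" for n
    using AE_off_axis by eventually_elim (use P_le in auto)
  have P_lim: "AE x in lborel. (\<lambda>n. P n x) \<longlonglongrightarrow> 0"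
    using AE_off_axis
  proof eventually_elim
    case (elim x)
    have "(\<lambda>n. cutoff_grad (N n) x \<bullet> F x) \<longlonglongrightarrow> 0 \<bullet> F x"
      unfolding N_def by (intro tendsto_inner tendsto_const cutoff_grad_tendsto[OF elim])
    then show ?case using elim by (simp add: P_def)
  qed
  have P_int: "integrable lborel (P n)" for n
    by (rule integrable_dominated_convergence2[where s=P and f="\<lambda>x. 0", OF _ P_m CF P_lim P_bd]) simp
  have P_conv: "(\<lambda>n. integral\<^sup>L lborel (P n)) \<longlonglongrightarrow> 0"
    using integral_dominated_convergence[where s=P and f="\<lambda>x. 0", OF _ P_m CF P_lim P_bd] by simp
  define B where "B n x = cutoff (N n) x * ed x" for n x
  have B_m: "B n \<in> borel_measurable lborel" for n
  proof -
    have "(\<lambda>x. if x \<in> off_axis then cutoff (N n) x * (e1 x - e0 x) else 0) \<in> borel_measurable borel"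
      by (intro measurable_off_axis continuous_on_mult continuous_on_diff cN density_cont)
    moreover have "B n = (\<lambda>x. if x \<in> off_axis then cutoff (N n) x * (e1 x - e0 x) else 0)"
      by (auto simp: B_def ed_def)
    ultimately show ?thesis by simp
  qed
  have B_bd: "AE x in lborel. norm (B n x) \<le> \<bar>ed x\<bar>" for n
    using cutoff_bounds[OF N] by (auto simp: B_def abs_mult mult_left_le_one_le)
  have B_lim: "AE x in lborel. (\<lambda>n. B n x) \<longlonglongrightarrow> ed x"
    using AE_off_axis
  proof eventually_elim
    case (elim x)
    from tendsto_mult[OF cutoff_tendsto[OF elim] tendsto_const[of "ed x"]]
    show ?case by (simp add: B_def N_def)
  qed
  have ed_m: "ed \<in> borel_measurable lborel" using ed_int by auto
  have ed_abs: "integrable lborel (\<lambda>x. \<bar>ed x\<bar>)" using ed_int by simp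
  have B_int: "integrable lborel (B n)" for n
    by (rule integrable_dominated_convergence2[where s=B, OF ed_m B_m ed_abs B_lim B_bd])
  have B_conv: "(\<lambda>n. integral\<^sup>L lborel (B n)) \<longlonglongrightarrow> integral\<^sup>L lborel ed"
    by (rule integral_dominated_convergence[where s=B, OF ed_m B_m ed_abs B_lim B_bd])
  define R where "R n x = (if x \<in> off_axis then cutoff (N n) x * Q x else 0)" for n x
  have R_eq: "R n x = B n x + 2 * P n x
     - 2 * (if x \<in> off_axis then cutoff_grad (N n) x \<bullet> F x + cutoff (N n) x * D x else 0)" for n x
    by (auto simp: R_def B_def P_def ed_def Q_def algebra_simps)
  have R_hbi: "has_bochner_integral lborel (R n) (integral\<^sup>L lborel (B n) + 2 * integral\<^sup>L lborel (P n))" for n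
  proof -
    have "has_bochner_integral lborel (\<lambda>x. B n x + 2 * P n x
       - 2 * (if x \<in> off_axis then cutoff_grad (N n) x \<bullet> F x + cutoff (N n) x * D x else 0))
       (integral\<^sup>L lborel (B n) + 2 * integral\<^sup>L lborel (P n) - 2 * 0)"
      by (intro has_bochner_integral_diff has_bochner_integral_add has_bochner_integral_mult_right
           has_bochner_integral_integrable B_int P_int integral_flux_divergence N)
    then show ?thesis by (simp add: R_eq[abs_def])
  qed
  have Q0: "0 \<le> Q x" if "x \<in> off_axis" for x
    using Q_bound[OF that] zero_le_power2[of "norm (dS x)"] by linarith
  have R0: "0 \<le> R n x" for n x
    using Q0 cutoff_bounds(1)[OF N] by (simp add: R_def)
  have R_mono: "R n x \<le> R n' x" if "n \<le> n'" for n n' x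
    using Q0 cutoff_mono[OF N, of n "N n'" x] that by (simp add: R_def N_def mult_right_mono)
  obtain x1 where x1: "x1 \<in> off_axis" "dS x1 \<noteq> 0" using dS_nonzero[OF ne] by blast
  have "eventually (\<lambda>n. cutoff (N n) x1 > 0) sequentially"
    unfolding N_def by (rule order_tendstoD(1)[OF cutoff_tendsto[OF x1(1)]]) simp
  then obtain n0 where n0: "cutoff (N n0) x1 > 0" by (auto simp: eventually_sequentially)
  have pos: "0 < integral\<^sup>L lborel (R n0)"
  proof (rule ccontr)
    assume "\<not> ?thesis"
    moreover have "0 \<le> integral\<^sup>L lborel (R n0)" using R0 by (intro integral_nonneg_AE) auto
    ultimately have "integral\<^sup>L lborel (R n0) = 0" by linarith
    then have "AE x in lborel. R n0 x = 0"
      using integral_nonneg_eq_0_iff_AE[of lborel "R n0"] R_hbi[of n0] R0 by (simp add: has_bochner_integral_iff)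
    \<comment> \<open>If the integral vanished, the open set where the cutoff and the gradient of S
      are both nonzero would be null, yet it contains \<open>x1\<close>.\<close>
    define Z where "Z = off_axis \<inter> (\<lambda>x. cutoff (N n0) x * (norm (dS x))\<^sup>2) -` {0<..}"
    have "open Z"
      unfolding Z_def
      by (rule continuous_open_preimage[OF _ open_off_axis open_greaterThan])
         (intro continuous_on_mult cN continuous_on_power continuous_on_norm density_cont)
    moreover have "x1 \<in> Z" using x1 n0 by (simp add: Z_def)
    moreover have "AE x in lborel. x \<notin> Z"
      using \<open>AE x in lborel. R n0 x = 0\<close>
    proof eventually_elim
      case (elim x)
      show ?case
      proof
        assume z: "x \<in> Z"
        then have x: "x \<in> off_axis" and c: "0 < cutoff (N n0) x * (norm (dS x))\<^sup>2" by (auto simp: Z_def)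
        have "cutoff (N n0) x * (norm (dS x))\<^sup>2 \<le> cutoff (N n0) x * (3 * Q x)"
          by (intro mult_left_mono Q_bound[OF x] cutoff_bounds(1)[OF N])
        also have "\<dots> = 3 * R n0 x" using x by (simp add: R_def)
        finally show False using c elim by simp
      qed
    qed
    then have "Z \<in> null_sets lborel"
      using AE_iff_null_sets[of Z lborel] \<open>open Z\<close> by simp
    then have "negligible Z"
      using null_sets_completionI negligible_iff_null_sets by blast
    ultimately show False using open_not_negligible by blast
  qed
  have "(\<lambda>n. integral\<^sup>L lborel (B n) + 2 * integral\<^sup>L lborel (P n)) \<longlonglongrightarrow> integral\<^sup>L lborel ed + 2 * 0"
    by (intro tendsto_intros B_conv P_conv)
  moreover have "integral\<^sup>L lborel (R n0) \<le> integral\<^sup>L lborel (B n) + 2 * integral\<^sup>L lborel (P n)" if "n0 \<le> n" for n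
  proof -
    have "integral\<^sup>L lborel (R n0) \<le> integral\<^sup>L lborel (R n)"
      using R_hbi R_mono[OF that] by (intro integral_mono) (auto simp: has_bochner_integral_iff)
    then show ?thesis using R_hbi[of n] by (simp add: has_bochner_integral_iff)
  qed
  ultimately have "integral\<^sup>L lborel (R n0) \<le> integral\<^sup>L lborel ed + 2 * 0"
    by (intro LIMSEQ_le_const) auto
  with pos ed_eq show ?thesis by simp
qed

section \<open>The mass expressed by the two energy densities\<close>

lemma kerr_weight:
  assumes x: "x \<in> off_axis"
  shows "cyl_rho x powr (-4) * exp (-2 * v0 J x) = 1 / (X0 J x)\<^sup>2"
proof -
  note p = cyl_rho_pos[OF x] and X = X0_pos[OF x]
  have "exp (-2 * v0 J x) = inverse ((exp (v0 J x))\<^sup>2)"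
    by (simp add: exp_minus flip: exp_double)
  also have "\<dots> = cyl_rho x ^ 4 / (X0 J x)\<^sup>2"
    unfolding exp_v0[OF J x] using p X by (simp add: field_simps flip: power_mult)
  finally show ?thesis using p by (simp add: powr_minus_divide powr_numeral)
qed

lemma mass_M_base:
  "mass_M (v0 J) (Y0 J) = ennreal (1 / (32 * pi)) * (\<integral>\<^sup>+x. ennreal (off_axis_ext e0 x) \<partial>lborel)"
  unfolding mass_M_def
proof (intro arg_cong2[where f="(*)"] refl nn_integral_cong_AE)
  show "AE x in lborel. ennreal ((grad_abs (v0 J) x)\<^sup>2 + cyl_rho x powr (-4) * exp (-2 * v0 J x) * (grad_abs (Y0 J) x)\<^sup>2)
     = ennreal (off_axis_ext e0 x)"
    using AE_off_axis
  proof eventually_elim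
    case (elim x)
    have 1: "(grad_abs (v0 J) x)\<^sup>2 = (norm (grad_v0 J x))\<^sup>2"
      by (rule grad_abs_eq_norm[OF axisym_kerr(1) v0_GDERIV[OF J] elim])
    have 2: "(grad_abs (Y0 J) x)\<^sup>2 = (norm ((X0 J x)\<^sup>2 *\<^sub>R twist_field J x))\<^sup>2"
      by (rule grad_abs_eq_norm[OF axisym_kerr(2) Y0_GDERIV[OF J] elim])
    show ?case
      unfolding 1 2 kerr_weight[OF elim] using elim X0_pos[OF elim]
      by (simp add: e0_def b_def power_mult_distrib power2_eq_square)
  qed
qed

lemma mass_M_perturbed:
  assumes "axisym \<alpha>" "axisym y"
  shows "mass_M (\<lambda>x. v0 J x + \<alpha> x) (\<lambda>x. Y0 J x + y x)
    = ennreal (1 / (32 * pi)) * (\<integral>\<^sup>+x. ennreal (off_axis_ext e1 x) \<partial>lborel)"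
  unfolding mass_M_def
proof (intro arg_cong2[where f="(*)"] refl nn_integral_cong_AE)
  show "AE x in lborel. ennreal ((grad_abs (\<lambda>x. v0 J x + \<alpha> x) x)\<^sup>2
      + cyl_rho x powr (-4) * exp (-2 * (v0 J x + \<alpha> x)) * (grad_abs (\<lambda>x. Y0 J x + y x) x)\<^sup>2)
     = ennreal (off_axis_ext e1 x)"
    using AE_off_axis
  proof eventually_elim
    case (elim x)
    have 1: "(grad_abs (\<lambda>x. v0 J x + \<alpha> x) x)\<^sup>2 = (norm (grad_v0 J x + ga x))\<^sup>2"
      by (rule grad_abs_eq_norm[OF axisym_add[OF axisym_kerr(1) assms(1)] GDERIV_add[OF v0_GDERIV[OF J] ga] elim])
    have "(grad_abs (\<lambda>x. Y0 J x + y x) x)\<^sup>2 = (norm ((X0 J x)\<^sup>2 *\<^sub>R twist_field J x + gy x))\<^sup>2"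
      by (rule grad_abs_eq_norm[OF axisym_add[OF axisym_kerr(2) assms(2)] GDERIV_add[OF Y0_GDERIV[OF J] gy] elim])
    also have "(X0 J x)\<^sup>2 *\<^sub>R twist_field J x + gy x = X0 J x *\<^sub>R (b x + q x)"
      using X0_pos[OF elim] by (simp add: b_def q_def scaleR_add_right power2_eq_square)
    finally have 2: "(grad_abs (\<lambda>x. Y0 J x + y x) x)\<^sup>2 = (X0 J x)\<^sup>2 * (norm (b x + q x))\<^sup>2"
      by (simp add: power_mult_distrib)
    have ex: "exp (-2 * (v0 J x + \<alpha> x)) = exp (-2 * v0 J x) * (E x)\<^sup>2"
      by (simp add: E_def power2_eq_square flip: exp_add)
    have 3: "cyl_rho x powr (-4) * exp (-2 * (v0 J x + \<alpha> x)) = (E x)\<^sup>2 / (X0 J x)\<^sup>2"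
      unfolding ex mult.assoc[symmetric] kerr_weight[OF elim] by simp
    show ?case unfolding 1 2 3 using elim X0_pos[OF elim] by (simp add: e1_def)
  qed
qed

text \<open>The unperturbed mass is finite, so an infinite perturbed mass is larger at once.
  Otherwise both are real integrals and \<open>energy_strict\<close> applies.\<close>

lemma mass_M_strict:
  assumes ax: "axisym \<alpha>" "axisym y" and ne: "\<alpha> x0 \<noteq> 0 \<or> y x0 \<noteq> 0"
  shows "mass_M (v0 J) (Y0 J) < mass_M (\<lambda>x. v0 J x + \<alpha> x) (\<lambda>x. Y0 J x + y x)"
proof -
  define i0 where "i0 = integral\<^sup>L lborel (off_axis_ext e0)"
  have nn0: "0 \<le> off_axis_ext e0 x" "0 \<le> off_axis_ext e1 x" for x
    by (auto simp: e0_def e1_def)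
  have I0: "(\<integral>\<^sup>+x. ennreal (off_axis_ext e0 x) \<partial>lborel) = ennreal i0"
    unfolding i0_def by (rule nn_integral_eq_integral[OF e0_integrable]) (use nn0 in auto)
  have i0: "0 \<le> i0" unfolding i0_def by (rule integral_nonneg_AE) (use nn0 in auto)
  have c: "0 < 1 / (32 * pi)" by simp
  have M0: "mass_M (v0 J) (Y0 J) = ennreal (1 / (32 * pi) * i0)"
    unfolding mass_M_base I0 by (rule ennreal_mult[symmetric]) (use c i0 in auto)
  show ?thesis
  proof (cases "(\<integral>\<^sup>+x. ennreal (off_axis_ext e1 x) \<partial>lborel) = \<infinity>")
    case True
    then have "mass_M (\<lambda>x. v0 J x + \<alpha> x) (\<lambda>x. Y0 J x + y x) = \<infinity>"
      unfolding mass_M_perturbed[OF ax] using c by (simp add: ennreal_mult_top)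
    then show ?thesis unfolding M0 by simp
  next
    case False
    define i1 where "i1 = integral\<^sup>L lborel (off_axis_ext e1)"
    have int: "integrable lborel (off_axis_ext e1)"
    proof (rule integrableI_nonneg)
      show "(off_axis_ext e1) \<in> borel_measurable lborel"
        using measurable_off_axis[OF density_cont(11)] by simp
    qed (use nn0 False in \<open>auto simp: less_top[symmetric]\<close>)
    have I1: "(\<integral>\<^sup>+x. ennreal (off_axis_ext e1 x) \<partial>lborel) = ennreal i1"
      unfolding i1_def by (rule nn_integral_eq_integral[OF int]) (use nn0 in auto)
    have lt: "i0 < i1" unfolding i0_def i1_def by (rule energy_strict[OF ne int])
    have "mass_M (\<lambda>x. v0 J x + \<alpha> x) (\<lambda>x. Y0 J x + y x) = ennreal (1 / (32 * pi) * i1)"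
      unfolding mass_M_perturbed[OF ax] I1 by (rule ennreal_mult[symmetric]) (use c i0 lt in auto)
    moreover have "1 / (32 * pi) * i0 < 1 / (32 * pi) * i1" using lt c by (intro mult_strict_left_mono)
    ultimately show ?thesis unfolding M0 using i0 by (simp add: ennreal_less_iff)
  qed
qed

end

section \<open>From the weighted norm to the pointwise hypotheses\<close>

lemma C1_R3_gradient:
  assumes "C1_R3 f"
  obtains gf where "\<And>x. GDERIV f x :> gf x" "continuous_on UNIV gf"
proof -
  obtain f' :: "real^3 \<Rightarrow> ((real^3) \<Rightarrow>\<^sub>L real)" where f':
    "\<And>x. (f has_derivative blinfun_apply (f' x)) (at x)" "continuous_on UNIV f'"
    using assms unfolding C1_R3_def by blast
  define gf :: "real^3 \<Rightarrow> real^3" where "gf x = (\<chi> i. f' x (axis i 1))" for x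
  have "h \<bullet> gf x = f' x h" for x h
  proof -
    have "f' x h = f' x (\<Sum>i\<in>UNIV. h $ i *\<^sub>R axis i 1)"
      by (simp add: basis_expansion flip: scalar_mult_eq_scaleR)
    also have "\<dots> = (\<Sum>i\<in>UNIV. h $ i * f' x (axis i 1))"
      by (simp add: blinfun.sum_right blinfun.scaleR_right)
    finally show ?thesis by (simp add: gf_def inner_vec_def)
  qed
  then have "GDERIV f x :> gf x" for x using f'(1)[of x] by (simp add: gderiv_def)
  moreover have "continuous_on UNIV gf"
    unfolding gf_def[abs_def]
    by (intro continuous_on_vec_lambda bounded_bilinear.continuous_on[OF bounded_bilinear_blinfun_apply]
          f'(2) continuous_on_const)
  ultimately show ?thesis by (rule that)
qed

lemma wquant_nonneg: "0 \<le> wquant \<beta> f x"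
  by (simp add: wquant_def grad_abs_def)

lemma C1w_norm_bound:
  assumes "C1w_finite \<beta> A f" "x \<in> A"
  shows "\<bar>f x\<bar> \<le> C1w_norm \<beta> A f * sigma x powr \<beta>" "0 \<le> C1w_norm \<beta> A f"
proof -
  have s: "0 < sigma x" using sigma_ge_1[of x] by linarith
  have le: "wquant \<beta> f x \<le> C1w_norm \<beta> A f"
    unfolding C1w_norm_def using assms by (intro cSUP_upper) (auto simp: C1w_finite_def)
  then show "0 \<le> C1w_norm \<beta> A f" using wquant_nonneg order_trans by blast
  have "sigma x powr (-\<beta>) * \<bar>f x\<bar> \<le> wquant \<beta> f x" by (simp add: wquant_def grad_abs_def)
  also note le
  finally have "sigma x powr (-\<beta>) * \<bar>f x\<bar> * sigma x powr \<beta> \<le> C1w_norm \<beta> A f * sigma x powr \<beta>"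
    by (intro mult_right_mono) auto
  moreover have "sigma x powr (-\<beta>) * sigma x powr \<beta> = 1" using s by (simp flip: powr_add)
  ultimately show "\<bar>f x\<bar> \<le> C1w_norm \<beta> A f * sigma x powr \<beta>" by (simp add: mult_ac)
qed

theorem theorem1:
  fixes J \<beta> \<rho>0 :: real
  assumes "J \<noteq> 0" and "\<beta> < -1/2" and "\<rho>0 > 0"
  shows "\<exists>\<epsilon>>0. \<forall>\<alpha> y. in_B \<beta> \<rho>0 \<alpha> y \<and> B_norm \<beta> \<rho>0 \<alpha> y < \<epsilon> \<and> (\<alpha>, y) \<noteq> ((\<lambda>x. 0), (\<lambda>x. 0))
      \<longrightarrow> mass_M (\<lambda>x. v0 J x + \<alpha> x) (\<lambda>x. Y0 J x + y x) > mass_M (v0 J) (Y0 J)"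
proof (rule gfun_near_0, goal_cases)
  case (1 s0)
  note s0 = 1
  have "isCont cosh (0::real)" by (intro continuous_intros)
  then have "\<exists>d>0. \<forall>t::real. dist t 0 < d \<longrightarrow> dist (cosh t) (cosh 0) < s0 / 2"
    unfolding continuous_at_eps_delta by (rule allE[of _ "s0 / 2"]) (use s0(1) in \<open>simp add: dist_real_def\<close>)
  then obtain d where d: "d > 0" "\<And>t::real. \<bar>t\<bar> < d \<Longrightarrow> \<bar>cosh t - 1\<bar> < s0 / 2"
    by (auto simp: dist_real_def)
  \<comment> \<open>The entry 1 yields exp (-\<alpha>) <= 3 and the decay constants 1;
    \<open>d\<close> yields cosh \<alpha> - 1 <= s0 / 2; the last entry yields |y / X_0| <= s0 / 3,
    since X_0 >= \<rho>0^2 wherever y is nonzero.\<close>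
  define \<epsilon> where "\<epsilon> = min (min 1 d) (\<rho>0\<^sup>2 * (s0 / 3))"
  have \<epsilon>: "0 < \<epsilon>" "\<epsilon> \<le> 1" "\<epsilon> \<le> d" "\<epsilon> \<le> \<rho>0\<^sup>2 * (s0 / 3)"
    using d s0 assms by (auto simp: \<epsilon>_def)
  have "mass_M (v0 J) (Y0 J) < mass_M (\<lambda>x. v0 J x + \<alpha> x) (\<lambda>x. Y0 J x + y x)"
    if B: "in_B \<beta> \<rho>0 \<alpha> y" and norm: "B_norm \<beta> \<rho>0 \<alpha> y < \<epsilon>" and ne: "(\<alpha>, y) \<noteq> ((\<lambda>x. 0), (\<lambda>x. 0))" for \<alpha> y
  proof -
    from B have ax: "axisym \<alpha>" "axisym y" and C1: "C1_R3 \<alpha>" "C1_R3 y"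
      and fin: "C1w_finite \<beta> UNIV \<alpha>" "C1w_finite \<beta> (Omega_rho \<rho>0) y"
      and y0: "\<And>x. cyl_rho x \<le> \<rho>0 \<Longrightarrow> y x = 0"
      unfolding in_B_def by auto
    \<comment> \<open>The supremum over \<open>Omega_rho\<close> is nonnegative because the set is
      nonempty; hence each summand of the norm is itself below \<epsilon>.\<close>
    have "cyl_rho (vector [\<rho>0 + 1, 0, 0]) > \<rho>0" using assms by (simp add: cyl_rho_def)
    then have "vector [\<rho>0 + 1, 0, 0] \<in> Omega_rho \<rho>0" by (simp add: Omega_rho_def)
    then have n: "C1w_norm \<beta> UNIV \<alpha> < \<epsilon>" "C1w_norm \<beta> (Omega_rho \<rho>0) y < \<epsilon>"
      using norm C1w_norm_bound(2)[OF fin(1) UNIV_I] C1w_norm_bound(2)[OF fin(2)]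
      unfolding B_norm_def by fastforce+
    have s1: "sigma x powr \<beta> \<le> 1" "0 < sigma x powr \<beta>" for x
      using powr_mono[of \<beta> 0 "sigma x"] assms sigma_ge_1[of x] by auto
    have \<alpha>: "\<bar>\<alpha> x\<bar> < \<epsilon> * sigma x powr \<beta>" for x
      using C1w_norm_bound(1)[OF fin(1) UNIV_I, of x] mult_strict_right_mono[OF n(1) s1(2)[of x]] by linarith
    have y: "\<bar>y x\<bar> < \<epsilon> * sigma x powr \<beta>" for x
    proof (cases "x \<in> Omega_rho \<rho>0")
      case True
      then show ?thesis
        using C1w_norm_bound(1)[OF fin(2) True] mult_strict_right_mono[OF n(2) s1(2)[of x]] by linarith
    next
      case False
      then have "y x = 0" using y0 by (auto simp: Omega_rho_def not_less)
      then show ?thesis using \<epsilon>(1) s1(2)[of x] by simp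
    qed
    have es: "\<epsilon> * sigma x powr \<beta> \<le> \<epsilon>" "\<epsilon> * sigma x powr \<beta> \<le> sigma x powr \<beta>" for x
      using \<epsilon>(1,2) s1[of x] by (auto simp: mult_left_le mult_left_le_one_le)
    obtain ga gy where g: "\<And>x. GDERIV \<alpha> x :> ga x" "continuous_on UNIV ga"
      "\<And>x. GDERIV y x :> gy x" "continuous_on UNIV gy"
      using C1_R3_gradient[OF C1(1)] C1_R3_gradient[OF C1(2)] by metis
    have small: "cosh (\<alpha> x) - 1 + exp (- \<alpha> x) * (y x / X0 J x)\<^sup>2 / 2 \<le> s0" if x: "x \<in> off_axis" for x
    proof -
      have a: "\<bar>\<alpha> x\<bar> < \<epsilon>" "\<bar>y x\<bar> < \<epsilon>" using \<alpha>[of x] y[of x] es(1)[of x] by linarith+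
      have 1: "cosh (\<alpha> x) - 1 \<le> s0 / 2" using d(2)[of "\<alpha> x"] a(1) \<epsilon>(3) by linarith
      have "exp (- \<alpha> x) \<le> exp 1" using a(1) \<epsilon>(2) by simp
      then have E: "exp (- \<alpha> x) \<le> 3" using exp_le by linarith
      have w: "\<bar>y x / X0 J x\<bar> \<le> s0 / 3"
      proof (cases "cyl_rho x \<le> \<rho>0")
        case True
        then show ?thesis using y0[OF True] s0(1) by simp
      next
        case False
        have "\<rho>0\<^sup>2 \<le> (cyl_rho x)\<^sup>2" using False assms by (intro power_mono) auto
        then have X: "\<rho>0\<^sup>2 \<le> X0 J x" using X0_ge(1)[OF assms(1) x] by linarith
        have "\<bar>y x / X0 J x\<bar> \<le> (\<rho>0\<^sup>2 * (s0 / 3)) / \<rho>0\<^sup>2"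
          unfolding abs_divide using a(2) \<epsilon>(4) X X0_ge(2)[OF assms(1) x] assms
          by (intro frac_le) auto
        then show ?thesis using assms by simp
      qed
      have "(y x / X0 J x)\<^sup>2 \<le> (s0 / 3)\<^sup>2" using power_mono[OF w, of 2] by (simp only: power2_abs abs_ge_zero)
      then have "exp (- \<alpha> x) * (y x / X0 J x)\<^sup>2 \<le> 3 * (s0 / 3)\<^sup>2" using E by (intro mult_mono) auto
      also have "\<dots> = s0 * (s0 / 3)" by (simp add: power2_eq_square)
      also have "\<dots> \<le> 1 * (s0 / 3)" using s0 by (intro mult_right_mono) auto
      finally show ?thesis using 1 s0(1) by simp
    qed
    interpret kerr_perturbation J \<beta> \<rho>0 s0 \<alpha> y ga gy
    proof unfold_locales
      show "\<bar>\<alpha> x\<bar> \<le> sigma x powr \<beta>" for x using \<alpha>[of x] es(2)[of x] by linarith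
      show "\<bar>y x\<bar> \<le> sigma x powr \<beta>" for x using y[of x] es(2)[of x] by linarith
    qed (use assms g y0 s0 small in \<open>auto\<close>)
    obtain x0 where "\<alpha> x0 \<noteq> 0 \<or> y x0 \<noteq> 0" using ne by (auto simp: fun_eq_iff)
    then show ?thesis by (rule mass_M_strict[OF ax])
  qed
  then show ?case using \<epsilon>(1) by blast
qed

end
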